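(* Let $F$ be a formally real Pythagorean field with $|F^\times/(F^\times)^2|<\infty$. Assume that, for some integer $d\ge0$, $$c_1(G_F(2))=d+1\quad\text{and}\quad c_2(G_F(2))=\frac{d(d+1)}{2}.$$ Then $F$ is an SAP field with exactly $d+1$ orderings.
   Context: A field $F$ is Pythagorean if every finite sum of squares in $F$ is a square in $F$; a Pythagorean field is formally real if $-1$ is not a square. A formally real Pythagorean field $K$ with $|K^\times/(K^\times)^2|=2^{d+1}$ (for an integer $d\ge0$) is called an SAP field if $K$ admits exactly $d+1$ orderings. $G_F(2)$ denotes the maximal pro-$2$ quotient of the absolute Galois group of $F$ (the Galois group of the maximal $2$-extension of $F$). For a pro-$2$-group $G$, the Zassenhaus ($2$-)filtration is defined by $G_{(1)}=G$ and, for $n\ge2$, $G_{(n)}=G_{(\lceil n/2\rceil)}^2\prod_{i+j=n}[G_{(i)},G_{(j)}]$ (with $i,j\ge1$), where for closed subgroups $H,K$, $[H,K]$ is the smallest closed subgroup containing all commutators $[x,y]=x^{-1}y^{-1}xy$ with $x\in H,y\in K$, and $H^2$ is the smallest closed subgroup containing all squares of elements of $H$. Put $c_n(G)=\dim_{\mathbb{F}_2}(G_{(n)}/G_{(n+1)})$. *)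

theory Defs
  imports
    "HOL-Analysis.Analysis"
    "HOL-Algebra.Algebra"
    "HOL-Algebra.Algebraic_Closure_Type"
begin

section \<open>Pythagorean fields, orderings and SAP fields\<close>

text \<open>The base field \<open>F\<close> is the type \<open>'a :: field\<close>; predicates on \<open>F\<close> take it as \<open>TYPE('a)\<close>.\<close>

definition is_pythagorean :: "'a::field itself \<Rightarrow> bool" where
  "is_pythagorean _ \<longleftrightarrow> (\<forall>xs :: 'a list. \<exists>y :: 'a. (\<Sum>x\<leftarrow>xs. x ^ 2) = y ^ 2)"

definition is_formally_real_pythagorean :: "'a::field itself \<Rightarrow> bool" where
  "is_formally_real_pythagorean F \<longleftrightarrow> is_pythagorean F \<and> \<not> (\<exists>y :: 'a. -1 = y ^ 2)"

definition square_class_group :: "'a::field itself \<Rightarrow> 'a set monoid" where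
  "square_class_group _ =
     units_of (ring_of_type_algebra :: 'a ring) Mod {x ^ 2 | x :: 'a. x \<noteq> 0}"

definition field_orderings :: "'a::field itself \<Rightarrow> 'a rel set" where
  "field_orderings _ = {r. linear_order r
      \<and> (\<forall>x y z. (x, y) \<in> r \<longrightarrow> (x + z, y + z) \<in> r)
      \<and> (\<forall>x y. (0, x) \<in> r \<longrightarrow> (0, y) \<in> r \<longrightarrow> (0, x * y) \<in> r)}"

definition is_SAP :: "'a::field itself \<Rightarrow> bool" where
  "is_SAP F \<longleftrightarrow> is_formally_real_pythagorean F \<and>
     (\<exists>d::nat. order (square_class_group F) = 2 ^ (d + 1) \<and>
       finite (field_orderings F) \<and> card (field_orderings F) = d + 1)"


section \<open>The Galois group of the maximal 2-extension\<close>

text \<open>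
  All extensions of \<open>F\<close> are taken inside the algebraic closure type \<open>'a alg_closure\<close>, into which
  \<open>F\<close> is embedded by \<open>to_ac\<close>.
\<close>

definition intermediate_field :: "'a::field alg_closure set \<Rightarrow> bool" where
  "intermediate_field E \<longleftrightarrow>
     subfield E (ring_of_type_algebra :: 'a alg_closure ring) \<and> range to_ac \<subseteq> E"

definition ac_scale :: "'a::field \<Rightarrow> 'a alg_closure \<Rightarrow> 'a alg_closure" where
  "ac_scale c x = to_ac c * x"

definition finite_extension :: "'a::field alg_closure set \<Rightarrow> bool" where
  "finite_extension E \<longleftrightarrow> intermediate_field E \<and>
     (\<exists>B. finite B \<and> module.span (ac_scale :: 'a \<Rightarrow> _) B = E)"

definition extension_degree :: "'a::field alg_closure set \<Rightarrow> nat" where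
  "extension_degree E = vector_space.dim (ac_scale :: 'a \<Rightarrow> _) E"

text \<open>Automorphisms of \<open>E\<close> over \<open>F\<close> are represented by functions that are \<open>undefined\<close> outside \<open>E\<close>.\<close>

definition field_auts :: "'a::field alg_closure set \<Rightarrow> ('a alg_closure \<Rightarrow> 'a alg_closure) set" where
  "field_auts E = {\<sigma> \<in> Bij E.
      (\<forall>x\<in>E. \<forall>y\<in>E. \<sigma> (x + y) = \<sigma> x + \<sigma> y \<and> \<sigma> (x * y) = \<sigma> x * \<sigma> y) \<and>
      (\<forall>c. \<sigma> (to_ac c) = to_ac c)}"

definition galois_group :: "'a::field alg_closure set \<Rightarrow> ('a alg_closure \<Rightarrow> 'a alg_closure) monoid" where
  "galois_group E = (BijGroup E)\<lparr>carrier := field_auts E\<rparr>"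

text \<open>Every element of \<open>'a alg_closure\<close> is algebraic over \<open>F\<close>, so \<open>E\<close> is Galois over \<open>F\<close> iff
  \<open>F\<close> is the fixed field of the automorphism group.\<close>

definition galois_extension :: "'a::field alg_closure set \<Rightarrow> bool" where
  "galois_extension E \<longleftrightarrow> intermediate_field E \<and>
     {x \<in> E. \<forall>\<sigma>\<in>field_auts E. \<sigma> x = x} = range to_ac"

definition finite_galois_2_extension :: "'a::field alg_closure set \<Rightarrow> bool" where
  "finite_galois_2_extension E \<longleftrightarrow>
     finite_extension E \<and> galois_extension E \<and> (\<exists>k::nat. extension_degree E = 2 ^ k)"

text \<open>The maximal 2-extension \<open>F(2)\<close>: the compositum of all finite Galois extensions of
  2-power degree.\<close>

definition maximal_2_extension :: "'a::field itself \<Rightarrow> 'a alg_closure set" where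
  "maximal_2_extension _ =
     \<Inter>{L. intermediate_field L \<and> (\<forall>E. finite_galois_2_extension E \<longrightarrow> E \<subseteq> L)}"

text \<open>The cosets \<open>\<sigma> Gal(L/E)\<close>, with \<open>E\<close> finite Galois over \<open>F\<close>, are a base of the Krull topology.\<close>

definition krull_topology ::
    "'a::field alg_closure set \<Rightarrow> ('a alg_closure \<Rightarrow> 'a alg_closure) topology" where
  "krull_topology L = topology_generated_by
     {{\<tau> \<in> field_auts L. \<forall>x\<in>E. \<tau> x = \<sigma> x} | \<sigma> E.
        \<sigma> \<in> field_auts L \<and> finite_extension E \<and> galois_extension E \<and> E \<subseteq> L}"

definition galois_group_2 :: "'a::field itself \<Rightarrow> ('a alg_closure \<Rightarrow> 'a alg_closure) monoid" where
  "galois_group_2 F = galois_group (maximal_2_extension F)"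

definition galois_group_2_topology ::
    "'a::field itself \<Rightarrow> ('a alg_closure \<Rightarrow> 'a alg_closure) topology" where
  "galois_group_2_topology F = krull_topology (maximal_2_extension F)"


section \<open>The Zassenhaus 2-filtration\<close>

text \<open>A topological group is given by a group \<open>G\<close> and a topology \<open>T\<close> on its carrier.\<close>

definition closed_subgroup_generated :: "'g monoid \<Rightarrow> 'g topology \<Rightarrow> 'g set \<Rightarrow> 'g set" where
  "closed_subgroup_generated G T S = \<Inter>{H. subgroup H G \<and> closedin T H \<and> S \<subseteq> H}"

definition closed_commutator :: "'g monoid \<Rightarrow> 'g topology \<Rightarrow> 'g set \<Rightarrow> 'g set \<Rightarrow> 'g set" where
  "closed_commutator G T H K = closed_subgroup_generated G T
     {inv\<^bsub>G\<^esub> x \<otimes>\<^bsub>G\<^esub> inv\<^bsub>G\<^esub> y \<otimes>\<^bsub>G\<^esub> x \<otimes>\<^bsub>G\<^esub> y | x y. x \<in> H \<and> y \<in> K}"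

definition closed_square :: "'g monoid \<Rightarrow> 'g topology \<Rightarrow> 'g set \<Rightarrow> 'g set" where
  "closed_square G T H = closed_subgroup_generated G T {x \<otimes>\<^bsub>G\<^esub> x | x. x \<in> H}"

text \<open>The terms are indexed from 1; the value at index 0 is irrelevant.  For \<open>n \<ge> 2\<close>,
  \<open>(n + 1) div 2\<close> is the ceiling of \<open>n / 2\<close>.\<close>

fun zassenhaus :: "'g monoid \<Rightarrow> 'g topology \<Rightarrow> nat \<Rightarrow> 'g set" where
  "zassenhaus G T n =
     (if n \<le> 1 then carrier G
      else closed_square G T (zassenhaus G T ((n + 1) div 2)) <#>\<^bsub>G\<^esub>
        foldr (\<lambda>i P. closed_commutator G T (zassenhaus G T i) (zassenhaus G T (n - i)) <#>\<^bsub>G\<^esub> P)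
          [1..<n] {\<one>\<^bsub>G\<^esub>})"

declare zassenhaus.simps [simp del]

text \<open>
  In an elementary abelian 2-group, written multiplicatively, an \<open>\<bbbF>\<^sub>2\<close>-linear combination of
  elements of \<open>B\<close> is the product of a finite subset of \<open>B\<close> (the support of the coefficients).
\<close>

definition F2_basis :: "'g monoid \<Rightarrow> 'g set \<Rightarrow> bool" where
  "F2_basis V B \<longleftrightarrow> B \<subseteq> carrier V \<and>
     (\<forall>v\<in>carrier V. \<exists>!S. finite S \<and> S \<subseteq> B \<and> v = finprod V (\<lambda>b. b) S)"

definition F2_dim :: "'g monoid \<Rightarrow> enat" where
  "F2_dim V = (if \<exists>B. finite B \<and> F2_basis V B
               then enat (card (SOME B. finite B \<and> F2_basis V B)) else \<infinity>)"

definition zassenhaus_dim :: "'g monoid \<Rightarrow> 'g topology \<Rightarrow> nat \<Rightarrow> enat" where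
  "zassenhaus_dim G T n =
     F2_dim (G\<lparr>carrier := zassenhaus G T n\<rparr> Mod zassenhaus G T (n + 1))"

end

theory Submission
  imports Defs
begin

text \<open>
  Write \<open>G\<close> for the Galois group of \<open>F(2)\<close> over \<open>F\<close> and \<open>G2\<close>, \<open>G3\<close> for the second and third terms of
  its Zassenhaus filtration, so that \<open>G / G2\<close> is the Frattini quotient.  The proof replaces Galois
  cohomology by involutions.

  Each ordering of \<open>F\<close> gives an involution of \<open>G\<close>: a maximal extension of \<open>F\<close> on which the
  positive cone stays positive is euclidean, adjoining a square root of \<open>-1\<close> to it yields the
  quadratic closure of \<open>F\<close>, and the involution is the conjugation (lemmas \<open>euclidean_hull\<close>,
  \<open>involution\<close>).  It fixes a square root of \<open>a\<close> exactly when \<open>a\<close> is positive.  Since \<open>F\<close> is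
  Pythagorean, every nonsquare is negative for some ordering (\<open>nonsquare_negative\<close>).  A closed
  subgroup of index two is the stabilizer of the square root of a nonsquare
  (\<open>index_two_stabilizer\<close>), so none of them contains all these involutions.  In a pro-2 group a
  proper closed subgroup lies in a closed subgroup of index two, whence the involutions generate
  \<open>G\<close> topologically.

  Choose among them \<open>y\<^sub>0, \<dots>, y\<^sub>d\<close> representing a basis of \<open>G / G2\<close>, which has dimension \<open>d + 1\<close> by
  the first hypothesis.  As \<open>y\<^sub>i\<^sup>2 = 1\<close>, the quotient \<open>G2 / G3\<close> is spanned by the classes of the
  commutators \<open>[y\<^sub>i, y\<^sub>j]\<close> with \<open>i < j\<close> (\<open>rho_G2\<close>).  There are \<open>d (d + 1) / 2\<close> of them, so the second
  hypothesis says that they are linearly independent.  Let \<open>x\<close> be the involution of any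
  ordering, congruent modulo \<open>G2\<close> to the product of the \<open>y\<^sub>i\<close> with \<open>i \<in> S\<close>.  Squaring gives
  \<open>1 = x\<^sup>2 \<equiv> \<Prod> [y\<^sub>i, y\<^sub>j]\<close> over \<open>i < j\<close> in \<open>S\<close> (\<open>square_of_product\<close>), and independence leaves only one
  element in \<open>S\<close>.  Hence the involutions of the orderings are themselves a basis of \<open>G / G2\<close>
  (\<open>involutions_basis\<close>), and there are \<open>d + 1\<close> orderings.  For each ordering there is then a closed
  subgroup of index two omitting just its involution, that is, an element of \<open>F\<close> negative for this
  ordering only.  So the square classes correspond to the subsets of the set of orderings.

  On the Galois side only a fragment of the theory is used.  \<open>F(2)\<close> lies in the quadratic closure
  \<open>Q\<close>, because a finite Galois extension of 2-power degree is a tower of quadratic extensions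
  (\<open>galois_2_sub_Q\<close>, through the degree formula \<open>galois_degree\<close>); and inside \<open>Q\<close> homomorphisms
  extend by adjoining one square root at a time (\<open>extend_to_aut\<close>).
\<close>

section \<open>Finite 2-groups\<close>

text \<open>
  An odd prime dividing the order would give, by Sylow, a subgroup of that prime order and with it
  an element whose order is not a power of two.
\<close>

lemma (in group) finite_2_group_order:
  assumes fin: "finite (carrier G)"
    and pow: "\<And>g. g \<in> carrier G \<Longrightarrow> \<exists>m. g [^]\<^bsub>G\<^esub> ((2::nat) ^ m) = \<one>\<^bsub>G\<^esub>"
  shows "\<exists>k. order G = 2 ^ k"
proof -
  have pos: "order G > 0" using order_gt_0_iff_finite fin by blast
  have *: "p = 2" if p: "Factorial_Ring.prime p" "p dvd order G" for p :: nat
  proof -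
    obtain m where "order G = p ^ 1 * m" using p by (auto elim: dvdE)
    from sylow_thm[OF p(1) is_group this fin]
    obtain H where H: "subgroup H G" "card H = p" by auto
    have "card H \<noteq> 1" using H p(1) by auto
    then obtain h where h: "h \<in> H" "h \<noteq> \<one>"
      using subgroup.one_closed[OF H(1)] card_1_singleton_iff
      by (metis is_singletonI' is_singleton_altdef empty_iff)
    have hG: "h \<in> carrier G" using h H(1) subgroup.mem_carrier by metis
    interpret HG: group "G\<lparr>carrier := H\<rparr>" using H(1) subgroup_imp_group by blast
    have "h [^]\<^bsub>G\<lparr>carrier := H\<rparr>\<^esub> order (G\<lparr>carrier := H\<rparr>) = \<one>\<^bsub>G\<lparr>carrier := H\<rparr>\<^esub>"
      using HG.pow_order_eq_1 h by simp
    hence 1: "h [^] p = \<one>" using H(2) by (simp add: order_def flip: nat_pow_consistent)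
    obtain k where 2: "h [^] ((2::nat) ^ k) = \<one>" using pow hG by blast
    have d: "ord h dvd p" "ord h dvd 2 ^ k" using 1 2 hG pow_eq_id by auto
    have "ord h \<noteq> 1" using h(2) hG ord_eq_1 by blast
    hence "ord h = p" using d(1) p(1) by (metis prime_nat_iff)
    hence "p dvd 2" using d(2) p(1) prime_dvd_power by metis
    thus ?thesis using p(1) by (metis primes_dvd_imp_eq two_is_prime_nat)
  qed
  show ?thesis
  proof (cases "order G = 1")
    case True thus ?thesis by (intro exI[of _ 0]) simp
  next
    case False
    have "order G = 2 ^ multiplicity 2 (order G) * (order G div 2 ^ multiplicity 2 (order G))"
      by (simp add: multiplicity_dvd)
    moreover have "order G div 2 ^ multiplicity 2 (order G) = 1"
    proof (rule ccontr)
      let ?r = "order G div 2 ^ multiplicity 2 (order G)"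
      assume "?r \<noteq> 1"
      then obtain p where p: "Factorial_Ring.prime p" "p dvd ?r" using prime_factor_nat by blast
      have "p dvd order G" using p(2) by (metis dvd_mult calculation)
      hence "2 dvd ?r" using * p by blast
      thus False using multiplicity_decompose[of "order G" 2] pos by simp
    qed
    ultimately show ?thesis by (metis mult.right_neutral)
  qed
qed

text \<open>
  Orbits under a 2-group have 2-power size, so the number of fixed points has the parity of the
  whole set.
\<close>

lemma even_fixed_points:
  assumes "group_action G E \<phi>" and ord: "order G = 2 ^ k" and fin: "finite E" and ev: "even (card E)"
    and x: "x \<in> E" "\<And>g. g \<in> carrier G \<Longrightarrow> \<phi> g x = x"
  shows "\<exists>y\<in>E. y \<noteq> x \<and> (\<forall>g\<in>carrier G. \<phi> g y = y)"
proof (rule ccontr)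
  interpret group_action G E \<phi> by fact
  interpret group_hom G "BijGroup E" \<phi> by (rule group_hom)
  assume no: "\<not> ?thesis"
  have orbx: "orbit G \<phi> x = {x}" 
  proof -
    have "\<phi> \<one>\<^bsub>G\<^esub> x = x" using x(2) G.one_closed by blast
    thus ?thesis unfolding orbit_def using x(2) G.one_closed by (auto intro!: exI[of _ "\<one>\<^bsub>G\<^esub>"])
  qed
  have fino: "finite (orbits G E \<phi>)" unfolding orbits_def using fin by simp
  have sub: "orb \<subseteq> E" if "orb \<in> orbits G E \<phi>" for orb
    using that orbits_coverture by blast
  have E: "E = \<Union>(orbits G E \<phi>)" by (rule orbits_coverture[symmetric])
  have cd: "card E = (\<Sum>orb\<in>orbits G E \<phi>. card orb)"
    by (subst E, rule card_Union_disjoint)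
       (use disjoint_union sub fin in \<open>auto simp: pairwise_def disjnt_def intro: finite_subset[OF sub fin]\<close>)
  have evo: "even (card orb)" if "orb \<in> orbits G E \<phi>" "orb \<noteq> {x}" for orb
  proof -
    obtain y where y: "y \<in> E" "orb = orbit G \<phi> y" using \<open>orb \<in> _\<close> unfolding orbits_def by auto
    have "card orb dvd 2 ^ k" using orbit_stabilizer_theorem[OF y(1)] y(2) ord by (metis dvd_triv_left)
    then obtain j where j: "card orb = 2 ^ j" by (auto simp: divides_primepow_nat)
    have "j \<noteq> 0"
    proof
      assume "j = 0"
      then have "card orb = 1" using j by simp
      then obtain z where z: "orb = {z}" using card_1_singletonE by blast
      have yo: "y \<in> orb" using orbit_refl y by simp
      hence "\<phi> g y = y" if "g \<in> carrier G" for g using z y(2) that unfolding orbit_def by blast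
      hence "y = x" using no y(1) by blast
      thus False using that(2) z yo by auto
    qed
    thus ?thesis using j by simp
  qed
  have xo: "{x} \<in> orbits G E \<phi>" unfolding orbits_def using orbx x(1) by blast
  have "card E = card {x} + (\<Sum>orb\<in>orbits G E \<phi> - {{x}}. card orb)"
    unfolding cd by (rule sum.remove[OF fino xo])
  moreover have "even (\<Sum>orb\<in>orbits G E \<phi> - {{x}}. card orb)"
    using evo by (intro dvd_sum) auto
  ultimately show False using ev by simp
qed

text \<open>
  Normalizers grow in 2-groups: \<open>H\<close> acts on its cosets with the fixed point \<open>H\<close>, so there is a second
  fixed coset \<open>H c\<close>, and \<open>c\<close> normalizes \<open>H\<close>.
\<close>

lemma (in group) two_group_step:
  assumes ord: "order G = 2 ^ k" and H: "subgroup H G" "H \<noteq> carrier G"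
  shows "\<exists>x\<in>carrier G - H. x \<otimes>\<^bsub>G\<^esub> x \<in> H \<and> (\<forall>h\<in>H. x \<otimes>\<^bsub>G\<^esub> h \<otimes>\<^bsub>G\<^esub> inv\<^bsub>G\<^esub> x \<in> H)"
proof -
  have fin: "finite (carrier G)" using ord order_gt_0_iff_finite by simp
  have Hsub: "H \<subseteq> carrier G" using H(1) subgroup.subset by auto
  define \<phi> where "\<phi> = (\<lambda>h. \<lambda>C\<in>rcosets H. C #> inv h)"
  have cl: "C #> g \<in> rcosets H" if "C \<in> rcosets H" "g \<in> carrier G" for C g
    using that Hsub by (auto simp: RCOSETS_def coset_mult_assoc)
  have act: "group_action (G\<lparr>carrier := H\<rparr>) (rcosets H) \<phi>"
  proof -
    have Cs: "C \<subseteq> carrier G" if "C \<in> rcosets H" for C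
      using that rcosets_subset_PowG[OF H(1)] by blast
    have bij: "\<phi> g \<in> Bij (rcosets H)" if g: "g \<in> H" for g
    proof -
      have gG: "g \<in> carrier G" using g Hsub by auto
      have "bij_betw (\<phi> g) (rcosets H) (rcosets H)"
        by (rule bij_betwI[where g = "\<lambda>C. C #> g"])
           (use gG cl Cs in \<open>auto simp: \<phi>_def coset_mult_assoc\<close>)
      thus ?thesis unfolding Bij_def by (auto simp: \<phi>_def)
    qed
    have "\<phi> \<in> hom (G\<lparr>carrier := H\<rparr>) (BijGroup (rcosets H))"
    proof (rule homI)
      fix x assume "x \<in> carrier (G\<lparr>carrier := H\<rparr>)"
      thus "\<phi> x \<in> carrier (BijGroup (rcosets H))" using bij by (simp add: BijGroup_def)
    next
      fix x y assume "x \<in> carrier (G\<lparr>carrier := H\<rparr>)" "y \<in> carrier (G\<lparr>carrier := H\<rparr>)"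
      hence xy: "x \<in> H" "y \<in> H" by auto
      hence xyG: "x \<in> carrier G" "y \<in> carrier G" using Hsub by auto
      have "\<phi> (x \<otimes> y) = compose (rcosets H) (\<phi> x) (\<phi> y)"
        by (rule ext) (use xyG Cs cl in \<open>auto simp: \<phi>_def compose_def coset_mult_assoc inv_mult_group\<close>)
      thus "\<phi> (x \<otimes>\<^bsub>G\<lparr>carrier := H\<rparr>\<^esub> y) = \<phi> x \<otimes>\<^bsub>BijGroup (rcosets H)\<^esub> \<phi> y"
        using xy bij by (simp add: BijGroup_def)
    qed
    thus ?thesis unfolding group_action_def group_hom_def group_hom_axioms_def
      using subgroup_imp_group[OF H(1)] group_BijGroup by blast
  qed
  have lag: "card (rcosets H) * card H = 2 ^ k" using lagrange[OF H(1)] ord by simp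
  obtain j where j: "card H = 2 ^ j" using lag by (metis dvd_triv_right divides_primepow_nat two_is_prime_nat)
  obtain i where i: "card (rcosets H) = 2 ^ i"
    using lag by (metis dvd_triv_left divides_primepow_nat two_is_prime_nat)
  have "i \<noteq> 0"
  proof
    assume "i = 0"
    hence "card H = card (carrier G)" using lag i ord by (simp add: order_def)
    thus False using Hsub H(2) fin card_subset_eq by blast
  qed
  hence ev: "even (card (rcosets H))" using i by simp
  have HR: "H \<in> rcosets H" using subgroup.subgroup_in_rcosets[OF H(1) is_group] .
  have finR: "finite (rcosets H)" using rcosets_subset_PowG[OF H(1)] fin finite_subset by blast
  have "\<exists>C\<in>rcosets H. C \<noteq> H \<and> (\<forall>g\<in>carrier (G\<lparr>carrier := H\<rparr>). \<phi> g C = C)"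
  proof (rule even_fixed_points[OF act _ finR ev HR])
    show "order (G\<lparr>carrier := H\<rparr>) = 2 ^ j" using j by (simp add: order_def)
    show "\<phi> g H = H" if "g \<in> carrier (G\<lparr>carrier := H\<rparr>)" for g
      using that HR H(1) Hsub by (simp add: \<phi>_def) (metis coset_join2 subgroup.m_inv_closed subsetD)
  qed
  then obtain C where C: "C \<in> rcosets H" "C \<noteq> H" "\<And>g. g \<in> H \<Longrightarrow> \<phi> g C = C" by auto
  then obtain c where c: "c \<in> carrier G" "C = H #> c" by (auto simp: RCOSETS_def)
  have cH: "c \<notin> H" using c C(2) H(1) by (metis coset_join2)
  have norm: "c \<otimes> h \<otimes> inv c \<in> H" if h: "h \<in> H" for h
  proof -
    have hG: "h \<in> carrier G" using h Hsub by auto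
    have "inv h \<in> H" using h H(1) subgroup.m_inv_closed by metis
    hence "C #> h = C" using C(1) C(3)[of "inv h"] hG by (simp add: \<phi>_def)
    hence "H #> (c \<otimes> h) = H #> c" using c hG Hsub by (simp add: coset_mult_assoc)
    moreover have "c \<otimes> h \<in> H #> (c \<otimes> h)" using c hG H(1) rcos_self by simp
    ultimately have "c \<otimes> h \<in> H #> c" by simp
    thus ?thesis using subgroup.rcos_module_imp[OF H(1) is_group c(1)] by blast
  qed
  \<comment> \<open>repeated squaring brings \<open>c\<close> into \<open>H\<close>; the last iterate outside \<open>H\<close> is the witness\<close>
  have nrm: "\<forall>h\<in>H. c [^] (n::nat) \<otimes> h \<otimes> inv (c [^] n) \<in> H" for n
  proof (induction n)
    case 0 thus ?case using Hsub by auto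
  next
    case (Suc n)
    show ?case
    proof
      fix h assume h: "h \<in> H"
      hence hG: "h \<in> carrier G" using Hsub by auto
      have "c [^] n \<otimes> (c \<otimes> h \<otimes> inv c) \<otimes> inv (c [^] n) \<in> H" using Suc norm h by blast
      moreover have "c [^] n \<otimes> (c \<otimes> h \<otimes> inv c) \<otimes> inv (c [^] n) = c [^] Suc n \<otimes> h \<otimes> inv (c [^] Suc n)"
        using c(1) hG by (simp add: m_assoc inv_mult_group)
      ultimately show "c [^] Suc n \<otimes> h \<otimes> inv (c [^] Suc n) \<in> H" by simp
    qed
  qed
  have "c [^] ((2::nat) ^ k) \<in> H"
    using pow_order_eq_1[OF c(1)] ord subgroup.one_closed[OF H(1)] by simp
  then obtain n where n: "c [^] ((2::nat) ^ n) \<in> H" and least: "\<And>m. m < n \<Longrightarrow> c [^] ((2::nat) ^ m) \<notin> H"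
    using exists_least_iff[of "\<lambda>n. c [^] ((2::nat) ^ n) \<in> H"] by blast
  have "n \<noteq> 0" using n cH c(1) by (cases n) auto
  then obtain m where m: "n = Suc m" by (cases n) auto
  let ?x = "c [^] ((2::nat) ^ m)"
  have "?x \<otimes> ?x = c [^] ((2::nat) ^ n)" using c(1) m by (simp add: nat_pow_mult mult_2)
  thus ?thesis using n least[of m] m nrm[of "2 ^ m"] c(1) by (intro bexI[of _ ?x]) auto
qed

text \<open>
  Index two expressed through products of elements outside \<open>M\<close>; this form passes to preimages and to
  infinite groups without counting cosets.
\<close>

definition index_two :: "('g, 'm) monoid_scheme \<Rightarrow> 'g set \<Rightarrow> bool" where
  "index_two G M \<longleftrightarrow> subgroup M G \<and> M \<noteq> carrier G \<and>
     (\<forall>x\<in>carrier G - M. \<forall>y\<in>carrier G - M. x \<otimes>\<^bsub>G\<^esub> y \<in> M)"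

lemma (in group) subgroup_adjoin:
  assumes H: "subgroup H G" and x: "x \<in> carrier G" and xx: "x \<otimes> x \<in> H"
    and norm: "\<forall>h\<in>H. x \<otimes> h \<otimes> inv x \<in> H"
  shows "subgroup (H \<union> (H #> x)) G"
proof -
  have Hsub: "H \<subseteq> carrier G" using H subgroup.subset by auto
  note HG[simp] = subsetD[OF Hsub]
  note hm = subgroup.m_closed[OF H] and hi = subgroup.m_inv_closed[OF H]
  have mem: "y \<in> H #> x \<longleftrightarrow> y \<in> carrier G \<and> y \<otimes> inv x \<in> H" for y
    using subgroup.rcos_module_imp[OF H is_group x] subgroup.rcos_module_rev[OF H is_group x]
      r_coset_subset_G[OF Hsub x] by blast
  have n2: "x \<otimes> h \<in> H #> x" if "h \<in> H" for h
    using norm that x HG[OF that] by (simp add: mem)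
  have n1: "h \<otimes> x \<in> H #> x" if "h \<in> H" for h
    using that x HG[OF that] by (simp add: mem m_assoc)
  have rep: "\<exists>h\<in>H. y = h \<otimes> x" if "y \<in> H #> x" for y
    using that by (auto simp: r_coset_def)
  have AB: "y \<otimes> z \<in> H #> x" if yz: "y \<in> H" "z \<in> H #> x" for y z
  proof -
    obtain h where h: "h \<in> H" "z = h \<otimes> x" using rep yz by blast
    show ?thesis using n1[of "y \<otimes> h"] h yz x hm by (simp add: m_assoc)
  qed
  have BA: "y \<otimes> z \<in> H #> x" if yz: "y \<in> H #> x" "z \<in> H" for y z
  proof -
    obtain h where h: "h \<in> H" "y = h \<otimes> x" using rep yz by blast
    have "x \<otimes> z \<in> H #> x" using n2 yz by blast
    from AB[OF h(1) this] show ?thesis using h yz x by (simp add: m_assoc)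
  qed
  have BB: "y \<otimes> z \<in> H" if yz: "y \<in> H #> x" "z \<in> H #> x" for y z
  proof -
    obtain h where h: "h \<in> H" "y = h \<otimes> x" using rep yz by blast
    obtain h' where h': "h' \<in> H" "z = h' \<otimes> x" using rep yz by blast
    have "h \<otimes> ((x \<otimes> h' \<otimes> inv x) \<otimes> (x \<otimes> x)) \<in> H" using hm h h' norm xx by blast
    also have "h \<otimes> ((x \<otimes> h' \<otimes> inv x) \<otimes> (x \<otimes> x)) = y \<otimes> z"
    proof -
      have "inv x \<otimes> (x \<otimes> x) = x" using x by (simp flip: m_assoc)
      thus ?thesis using h h' x by (simp add: m_assoc)
    qed
    finally show ?thesis .
  qed
  have IB: "inv y \<in> H #> x" if y: "y \<in> H #> x" for y
  proof -
    have yG: "y \<in> carrier G" using y mem by blast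
    have "inv (y \<otimes> y) \<in> H" using BB[OF y y] hi by blast
    from BA[OF y this] have "y \<otimes> inv (y \<otimes> y) \<in> H #> x" .
    thus ?thesis using yG by (simp add: inv_mult_group flip: m_assoc)
  qed
  show ?thesis
  proof (rule subgroupI)
    show "H \<union> (H #> x) \<subseteq> carrier G" using Hsub r_coset_subset_G[OF Hsub x] by blast
    show "H \<union> (H #> x) \<noteq> {}" using subgroup.one_closed[OF H] by blast
    show "inv a \<in> H \<union> (H #> x)" if "a \<in> H \<union> (H #> x)" for a using that IB hi by blast
    show "a \<otimes> b \<in> H \<union> (H #> x)" if "a \<in> H \<union> (H #> x)" "b \<in> H \<union> (H #> x)" for a b
      using that hm AB BA BB by blast
  qed
qed

text \<open>
  A maximal proper subgroup has index two, because adjoining the element of \<open>two_group_step\<close> already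
  gives the whole group.
\<close>

lemma (in group) two_group_index_two:
  assumes ord: "order G = 2 ^ k" and H: "subgroup H G" "H \<noteq> carrier G"
  shows "\<exists>M. index_two G M \<and> H \<subseteq> M"
proof -
  have fin: "finite (carrier G)" using ord order_gt_0_iff_finite by simp
  let ?S = "{M. subgroup M G \<and> H \<subseteq> M \<and> M \<noteq> carrier G}"
  have "finite ?S" by (rule finite_subset[of _ "Pow (carrier G)"]) (use fin subgroup.subset in auto)
  moreover have "H \<in> ?S" using H by auto
  ultimately have "\<exists>M\<in>?S. H \<subseteq> M \<and> (\<forall>M'\<in>?S. M \<subseteq> M' \<longrightarrow> M = M')"
    by (rule finite_has_maximal2)
  then obtain M where M: "M \<in> ?S" and max: "\<forall>M'\<in>?S. M \<subseteq> M' \<longrightarrow> M = M'" by (elim bexE conjE)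
  have sM: "subgroup M G" "M \<noteq> carrier G" using M by auto
  obtain x where x: "x \<in> carrier G - M" "x \<otimes> x \<in> M" "\<forall>h\<in>M. x \<otimes> h \<otimes> inv x \<in> M"
    using two_group_step[OF ord sM] by blast
  have sub: "subgroup (M \<union> (M #> x)) G" using subgroup_adjoin[OF sM(1)] x by blast
  have "x \<in> M #> x" using x sM(1) rcos_self by auto
  hence whole: "M \<union> (M #> x) = carrier G" using max sub M x(1) by blast
  have "y \<otimes> z \<in> M" if yz: "y \<in> carrier G - M" "z \<in> carrier G - M" for y z
  proof -
    have "y \<in> M #> x" "inv z \<in> M #> x" 
    proof -
      show "y \<in> M #> x" using whole yz by blast
      have "inv z \<notin> M" using yz subgroup.m_inv_closed[OF sM(1), of "inv z"] by auto
      thus "inv z \<in> M #> x" using whole yz by blast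
    qed
    then obtain a b where ab: "a \<in> M" "y = a \<otimes> x" "b \<in> M" "inv z = b \<otimes> x" by (auto simp: r_coset_def)
    have abG: "a \<in> carrier G" "b \<in> carrier G" using ab sM(1) subgroup.mem_carrier by metis+
    have "z = inv (b \<otimes> x)" using ab(4) yz by (metis DiffD1 inv_inv)
    hence "y \<otimes> z = a \<otimes> inv b"
      using ab abG x(1) inv_solve_left' by (simp add: inv_mult_group m_assoc flip: m_assoc[of x])
    thus ?thesis using ab sM(1) by (simp add: subgroup.m_closed subgroup.m_inv_closed)
  qed
  thus ?thesis using M unfolding index_two_def by blast
qed

section \<open>Elementary abelian 2-groups\<close>

text \<open>
  An elementary abelian 2-group is a vector space over the field with two elements in which linear
  combinations are products over finite subsets; symmetric difference of subsets plays the role of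
  addition of coefficient vectors.
\<close>

locale elementary_abelian_2_group = comm_group +
  assumes square_one: "v \<in> carrier G \<Longrightarrow> v \<otimes> v = \<one>"
begin

abbreviation sprod where "sprod S \<equiv> finprod G (\<lambda>v. v) S"

lemma inv_self: "v \<in> carrier G \<Longrightarrow> inv v = v"
  using square_one inv_equality by blast

lemma sprod_insert:
  assumes "finite S" "x \<notin> S" "insert x S \<subseteq> carrier G"
  shows "sprod (insert x S) = x \<otimes> sprod S"
  using assms by (intro finprod_insert) auto

lemma sprod_closed: "S \<subseteq> carrier G \<Longrightarrow> sprod S \<in> carrier G"
  by (rule finprod_closed) auto

lemma sprod_mult:
  assumes "finite S" "finite T" "S \<subseteq> carrier G" "T \<subseteq> carrier G"
  shows "sprod S \<otimes> sprod T = sprod ((S - T) \<union> (T - S))"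
proof -
  have 1: "sprod S = sprod (S - T) \<otimes> sprod (S \<inter> T)"
    using assms finprod_Un_disjoint[of "S - T" "S \<inter> T" "\<lambda>v. v"] by (simp add: Diff_Int Un_Diff_Int Int_Un_distrib subset_iff Pi_def)
       (metis Diff_disjoint Int_Diff Int_commute Un_Diff_Int inf_bot_right)
  have 2: "sprod T = sprod (T - S) \<otimes> sprod (S \<inter> T)"
    using assms finprod_Un_disjoint[of "T - S" "S \<inter> T" "\<lambda>v. v"] by (simp add: Diff_Int Un_Diff_Int Int_Un_distrib subset_iff Pi_def)
       (metis Diff_disjoint Int_Diff Int_commute Un_Diff_Int inf_bot_right)
  have 3: "sprod ((S - T) \<union> (T - S)) = sprod (S - T) \<otimes> sprod (T - S)"
    using assms by (intro finprod_Un_disjoint) auto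
  have c: "sprod (S - T) \<in> carrier G" "sprod (T - S) \<in> carrier G" "sprod (S \<inter> T) \<in> carrier G"
    using assms by (auto intro!: sprod_closed)
  have "sprod S \<otimes> sprod T = (sprod (S - T) \<otimes> sprod (T - S)) \<otimes> (sprod (S \<inter> T) \<otimes> sprod (S \<inter> T))"
    unfolding 1 2 using c by (simp add: m_ac)
  thus ?thesis unfolding 3 using c square_one by simp
qed

lemma subgroup_span:
  assumes "finite S" "S \<subseteq> carrier G"
  shows "subgroup (sprod ` Pow S) G"
proof (rule subgroupI)
  show "sprod ` Pow S \<subseteq> carrier G" using assms sprod_closed by blast
  show "sprod ` Pow S \<noteq> {}" by blast
  show "inv a \<in> sprod ` Pow S" if "a \<in> sprod ` Pow S" for a
    using that inv_self sprod_closed assms by (metis (no_types, lifting) PowD imageE subset_trans)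
  show "a \<otimes> b \<in> sprod ` Pow S" if ab: "a \<in> sprod ` Pow S" "b \<in> sprod ` Pow S" for a b
  proof -
    obtain A B where AB: "A \<subseteq> S" "a = sprod A" "B \<subseteq> S" "b = sprod B" using ab by (elim imageE) (rule that, simp_all)
    have "a \<otimes> b = sprod ((A - B) \<union> (B - A))"
      unfolding AB using AB assms by (intro sprod_mult) (auto intro: finite_subset)
    thus ?thesis using AB by blast
  qed
qed

lemma sprod_sub_span: "x \<in> S \<Longrightarrow> S \<subseteq> carrier G \<Longrightarrow> x \<in> sprod ` Pow S"
  using sprod_insert[of "{}" x] by (intro image_eqI[of _ _ "{x}"]) auto

definition indep :: "'a set \<Rightarrow> bool" where
  "indep S \<longleftrightarrow> finite S \<and> S \<subseteq> carrier G \<and> (\<forall>T\<subseteq>S. sprod T = \<one> \<longrightarrow> T = {})"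

lemma indep_inj: assumes "indep S" shows "inj_on sprod (Pow S)"
proof (rule inj_onI)
  fix A B assume AB: "A \<in> Pow S" "B \<in> Pow S" "sprod A = sprod B"
  have S: "finite S" "S \<subseteq> carrier G" using assms by (auto simp: indep_def)
  have f: "finite A" "finite B" "A \<subseteq> carrier G" "B \<subseteq> carrier G"
    using AB S by (auto intro: finite_subset)
  have "sprod ((A - B) \<union> (B - A)) = \<one>"
    using sprod_mult[OF f] AB(3) square_one sprod_closed f by simp
  moreover have "(A - B) \<union> (B - A) \<subseteq> S" using AB by blast
  ultimately have "(A - B) \<union> (B - A) = {}" using assms unfolding indep_def by (elim conjE allE impE)
  thus "A = B" by blast
qed

lemma inj_indep:
  assumes "inj_on sprod (Pow S)" "finite S" "S \<subseteq> carrier G"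
  shows "indep S"
proof -
  have "T = {}" if "T \<subseteq> S" "sprod T = \<one>" for T
    by (rule inj_onD[OF assms(1)]) (use that in auto)
  thus ?thesis using assms by (auto simp: indep_def)
qed

lemma indep_insert:
  assumes "indep S" "x \<in> carrier G" "x \<notin> sprod ` Pow S"
  shows "indep (insert x S)"
proof -
  have S: "finite S" "S \<subseteq> carrier G" using assms by (auto simp: indep_def)
  have "T = {}" if T: "T \<subseteq> insert x S" "sprod T = \<one>" for T
  proof (cases "x \<in> T")
    case False thus ?thesis using T assms(1) by (auto simp: indep_def)
  next
    case True
    let ?U = "T - {x}"
    have U: "finite ?U" "?U \<subseteq> carrier G" "?U \<subseteq> S" using T S by (auto intro: finite_subset)
    have "sprod (insert x ?U) = x \<otimes> sprod ?U"
      using U assms(2) by (intro sprod_insert) auto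
    hence "x \<otimes> sprod ?U = \<one>" using T True by (simp add: insert_absorb)
    hence "x = sprod ?U" using inv_self inv_equality U sprod_closed assms(2) by metis
    thus ?thesis using assms(3) U(3) by blast
  qed
  thus ?thesis using S assms(2) unfolding indep_def by auto
qed

text \<open>
  A maximal independent subset of the generators spans: a generator outside its span could be added.
\<close>

lemma basis_from_generators:
  assumes "finite (carrier G)" "A \<subseteq> carrier G"
    and gen: "\<And>U. subgroup U G \<Longrightarrow> A \<subseteq> U \<Longrightarrow> U = carrier G"
  obtains Y where "Y \<subseteq> A" "indep Y" "sprod ` Pow Y = carrier G"
proof -
  let ?S = "{Y. Y \<subseteq> A \<and> indep Y}"
  have "finite ?S" by (rule finite_subset[of _ "Pow (carrier G)"]) (use assms in auto)
  moreover have "{} \<in> ?S" by (auto simp: indep_def)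
  ultimately have "\<exists>Y\<in>?S. {} \<subseteq> Y \<and> (\<forall>Y'\<in>?S. Y \<subseteq> Y' \<longrightarrow> Y = Y')"
    by (rule finite_has_maximal2)
  then obtain Y where Y: "Y \<subseteq> A" "indep Y" and max: "\<And>Y'. Y' \<subseteq> A \<Longrightarrow> indep Y' \<Longrightarrow> Y \<subseteq> Y' \<Longrightarrow> Y = Y'"
    by (elim bexE conjE) blast
  have "A \<subseteq> sprod ` Pow Y"
  proof
    fix x assume x: "x \<in> A"
    show "x \<in> sprod ` Pow Y"
    proof (rule ccontr)
      assume n: "x \<notin> sprod ` Pow Y"
      have "Y = insert x Y" by (rule max) (use x Y n indep_insert assms(2) in auto)
      hence "x \<in> Y" by blast
      thus False using n sprod_sub_span[of x Y] Y by (auto simp: indep_def)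
    qed
  qed
  hence "sprod ` Pow Y = carrier G"
    using gen subgroup_span Y by (auto simp: indep_def)
  thus ?thesis using that Y by blast
qed

lemma card_indep:
  assumes "indep Y" "sprod ` Pow Y = carrier G" shows "card (carrier G) = 2 ^ card Y"
  using card_image[OF indep_inj[OF assms(1)]] assms by (simp add: card_Pow indep_def)

end

lemma F2_dim_card:
  assumes "comm_group V" "F2_dim V = enat k"
  shows "finite (carrier V) \<and> card (carrier V) = 2 ^ k"
proof -
  interpret comm_group V by fact
  let ?P = "\<lambda>B. finite B \<and> F2_basis V B"
  have ex: "\<exists>B. ?P B" using assms(2) unfolding F2_dim_def by (auto split: if_splits)
  define B where "B = (SOME B. ?P B)"
  have B: "finite B" "F2_basis V B" using someI_ex[OF ex] unfolding B_def by auto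
  have k: "card B = k" using assms(2) ex unfolding F2_dim_def B_def by simp
  have sub: "B \<subseteq> carrier V" and uni: "\<And>v. v \<in> carrier V \<Longrightarrow> \<exists>!S. finite S \<and> S \<subseteq> B \<and> v = finprod V (\<lambda>b. b) S"
    using B(2) unfolding F2_basis_def by auto
  have cl: "finprod V (\<lambda>b. b) S \<in> carrier V" if "S \<subseteq> B" for S
    using that sub by (intro finprod_closed) auto
  have "bij_betw (finprod V (\<lambda>b. b)) (Pow B) (carrier V)"
  proof (rule bij_betwI')
    show "(finprod V (\<lambda>b. b) S = finprod V (\<lambda>b. b) T) = (S = T)" if "S \<in> Pow B" "T \<in> Pow B" for S T
      using that uni[OF cl[of S]] B(1) by (metis PowD finite_subset)
    show "finprod V (\<lambda>b. b) S \<in> carrier V" if "S \<in> Pow B" for S using that cl by blast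
    show "\<exists>S\<in>Pow B. v = finprod V (\<lambda>b. b) S" if "v \<in> carrier V" for v using uni[OF that] by blast
  qed
  thus ?thesis using B(1) k bij_betw_same_card bij_betw_finite
    by (metis card_Pow finite_Pow_iff)
qed

section \<open>Groups topologised by normal subgroups of 2-power index\<close>

text \<open>
  The family \<open>\<N>\<close> abstracts the subgroups fixing a finite Galois extension.  The form in which
  profiniteness enters is that a closed subgroup and a point outside it are separated in a finite
  quotient, and that this quotient is a 2-group.
\<close>

locale pro_2_topology = group G for G :: "'a monoid" (structure) +
  fixes \<N> :: "'a set set"
  assumes nonempty: "\<N> \<noteq> {}"
    and normal: "N \<in> \<N> \<Longrightarrow> N \<lhd> G"
    and finite_index: "N \<in> \<N> \<Longrightarrow> finite (rcosets N)"
    and two_power: "N \<in> \<N> \<Longrightarrow> g \<in> carrier G \<Longrightarrow> \<exists>m. g [^] ((2::nat) ^ m) \<in> N"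
begin

definition T :: "'a topology" where
  "T = topology_generated_by {g <# N | g N. g \<in> carrier G \<and> N \<in> \<N>}"

text \<open>
  Finite intersections of members of \<open>\<N>\<close>: a base of neighbourhoods of the identity, whereas \<open>\<N>\<close> itself only
  gives a subbase.
\<close>

definition \<K> :: "'a set set" where
  "\<K> = {\<Inter>\<F> | \<F>. finite \<F> \<and> \<F> \<noteq> {} \<and> \<F> \<subseteq> \<N>}"

lemma K_induct [consumes 1, case_names base Int]:
  assumes "K \<in> \<K>" and "\<And>N. N \<in> \<N> \<Longrightarrow> P N" and "\<And>K K'. K \<in> \<K> \<Longrightarrow> K' \<in> \<N> \<Longrightarrow> P K \<Longrightarrow> P K' \<Longrightarrow> P (K \<inter> K')"
  shows "P K"
proof -
  obtain \<F> where F: "finite \<F>" "\<F> \<noteq> {}" "\<F> \<subseteq> \<N>" "K = \<Inter>\<F>" using assms(1) unfolding \<K>_def by blast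
  have "\<F> \<subseteq> \<N> \<Longrightarrow> \<Inter>\<F> \<in> \<K> \<and> P (\<Inter>\<F>)" using F(1,2)
  proof (induction \<F> rule: finite_ne_induct)
    case (singleton N) 
    have "{N} \<subseteq> \<N> \<Longrightarrow> \<Inter>{N} \<in> \<K>" unfolding \<K>_def by blast
    thus ?case using assms(2) singleton by auto
  next
    case (insert N \<F>)
    have "\<Inter>(insert N \<F>) \<in> \<K>" using insert unfolding \<K>_def by blast
    moreover have "P (\<Inter>\<F> \<inter> N)" using insert assms(2,3) by auto
    ultimately show ?case by (simp add: Int_commute)
  qed
  thus ?thesis using F by simp
qed

lemma N_in_K: "N \<in> \<N> \<Longrightarrow> N \<in> \<K>"
  unfolding \<K>_def by (rule CollectI, rule exI[of _ "{N}"]) auto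

lemma K_Int: "K \<in> \<K> \<Longrightarrow> K' \<in> \<K> \<Longrightarrow> K \<inter> K' \<in> \<K>"
  unfolding \<K>_def by clarify (metis (no_types, opaque_lifting) Inter_Un_distrib Un_empty Un_least finite_UnI)

lemma K_normal: "K \<in> \<K> \<Longrightarrow> K \<lhd> G"
  by (induction rule: K_induct) (auto intro: normal normal_subgroup_intersect)

lemma K_subgroup: "K \<in> \<K> \<Longrightarrow> subgroup K G"
  using K_normal normal_imp_subgroup by blast

lemma K_two_power: "K \<in> \<K> \<Longrightarrow> g \<in> carrier G \<Longrightarrow> \<exists>m. g [^] ((2::nat) ^ m) \<in> K"
proof (induction rule: K_induct)
  case (Int K N)
  obtain m where m: "g [^] ((2::nat) ^ m) \<in> K" using Int by blast
  obtain n where n: "g [^] ((2::nat) ^ n) \<in> N" using Int by blast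
  have pw: "h [^] (j::nat) \<in> A" if "A \<in> \<K>" "h \<in> A" for A h j
    using K_subgroup[OF that(1)] that(2) by (induction j) (auto intro: subgroup.one_closed subgroup.m_closed)
  have "g [^] ((2::nat) ^ (m + n)) \<in> K"
    using pw[OF Int(1) m, of "2 ^ n"] Int by (simp add: nat_pow_pow power_add)
  moreover have "g [^] ((2::nat) ^ (m + n)) \<in> N"
    using pw[OF N_in_K[OF Int(2)] n, of "2 ^ m"] Int by (simp add: nat_pow_pow power_add mult.commute)
  ultimately show ?case by blast
qed (rule two_power)

lemma K_finite_index: "K \<in> \<K> \<Longrightarrow> finite (rcosets K)"
proof (induction rule: K_induct)
  case (Int K N)
  have sub: "K \<subseteq> carrier G" "N \<subseteq> carrier G"
    using K_subgroup[OF Int(1)] normal[OF Int(2)] normal_imp_subgroup subgroup.subset by blast+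
  have "rcosets (K \<inter> N) \<subseteq> (\<lambda>(A, B). A \<inter> B) ` ((rcosets K) \<times> (rcosets N))"
  proof
    fix C assume "C \<in> rcosets (K \<inter> N)"
    then obtain g where g: "g \<in> carrier G" "C = (K \<inter> N) #> g" by (auto simp: RCOSETS_def)
    have "C = (K #> g) \<inter> (N #> g)"
    proof (intro equalityI subsetI)
      fix x assume "x \<in> C" thus "x \<in> (K #> g) \<inter> (N #> g)" unfolding g(2) by (auto simp: r_coset_def)
    next
      fix x assume x: "x \<in> (K #> g) \<inter> (N #> g)"
      then obtain k n where kn: "k \<in> K" "x = k \<otimes> g" "n \<in> N" "x = n \<otimes> g" by (auto simp: r_coset_def)
      have "k = n" using kn sub g(1) right_cancel[of g k n] by auto
      thus "x \<in> C" unfolding g(2) using kn by (auto simp: r_coset_def)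
    qed
    thus "C \<in> (\<lambda>(A, B). A \<inter> B) ` ((rcosets K) \<times> (rcosets N))"
      using g by (auto simp: RCOSETS_def)
  qed
  thus ?case using Int by (meson finite_SigmaI finite_imageI finite_subset)
qed (rule finite_index)

abbreviation congr where "congr K g h \<equiv> inv g \<otimes> h \<in> K"

lemma congr_coset:
  assumes "K \<lhd> G" "g \<in> carrier G" "h \<in> carrier G"
  shows "congr K g h \<longleftrightarrow> K #> g = K #> h"
proof -
  interpret normal K G by fact
  have "h \<in> g <# K \<longleftrightarrow> congr K g h"
  proof
    assume "h \<in> g <# K"
    then obtain k where k: "k \<in> K" "h = g \<otimes> k" by (auto simp: l_coset_def)
    thus "congr K g h" using assms mem_carrier by (simp flip: m_assoc)
  next
    assume "congr K g h"
    thus "h \<in> g <# K" using assms unfolding l_coset_def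
      by (auto intro!: bexI[of _ "inv g \<otimes> h"] simp flip: m_assoc)
  qed
  also have "h \<in> g <# K \<longleftrightarrow> h \<in> K #> g" using coset_eq assms by blast
  also have "\<dots> \<longleftrightarrow> K #> g = K #> h"
    using assms subgroup_axioms repr_independence rcos_self by blast
  finally show ?thesis by simp
qed

lemma congr_mult:
  assumes K: "K \<lhd> G" and c: "g \<in> carrier G" "h \<in> carrier G" "g' \<in> carrier G" "h' \<in> carrier G"
    and "congr K g h" "congr K g' h'"
  shows "congr K (g \<otimes> g') (h \<otimes> h')"
proof -
  interpret normal K G by fact
  have "K #> g = K #> h" "K #> g' = K #> h'" using assms congr_coset by blast+
  hence "K #> (g \<otimes> g') = K #> (h \<otimes> h')" using rcos_sum c by metis
  thus ?thesis using congr_coset K c by blast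
qed

lemma congr_inv:
  assumes K: "K \<lhd> G" and c: "g \<in> carrier G" "h \<in> carrier G" and "congr K g h"
  shows "congr K (inv g) (inv h)"
proof -
  interpret normal K G by fact
  have "K #> g = K #> h" using assms congr_coset by blast
  hence "K #> inv g = K #> inv h" using rcos_inv c by metis
  thus ?thesis using congr_coset K c by blast
qed

lemma congr_refl: "K \<in> \<K> \<Longrightarrow> g \<in> carrier G \<Longrightarrow> congr K g g"
  using K_subgroup subgroup.one_closed by fastforce

lemma openin_iff:
  "openin T U \<longleftrightarrow> U \<subseteq> carrier G \<and> (\<forall>g\<in>U. \<exists>K\<in>\<K>. \<forall>h\<in>carrier G. congr K g h \<longrightarrow> h \<in> U)"
proof
  assume "openin T U"
  hence "generate_topology_on {g <# N | g N. g \<in> carrier G \<and> N \<in> \<N>} U"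
    by (simp add: T_def openin_topology_generated_by_iff)
  thus "U \<subseteq> carrier G \<and> (\<forall>g\<in>U. \<exists>K\<in>\<K>. \<forall>h\<in>carrier G. congr K g h \<longrightarrow> h \<in> U)"
  proof induction
    case Empty thus ?case by simp
  next
    case (Int a b)
    show ?case
    proof (intro conjI ballI)
      show "a \<inter> b \<subseteq> carrier G" using Int by blast
      fix g assume g: "g \<in> a \<inter> b"
      then obtain K where K: "K \<in> \<K>" "\<forall>h\<in>carrier G. congr K g h \<longrightarrow> h \<in> a" using Int by blast
      obtain K' where K': "K' \<in> \<K>" "\<forall>h\<in>carrier G. congr K' g h \<longrightarrow> h \<in> b" using Int g by blast
      show "\<exists>K\<in>\<K>. \<forall>h\<in>carrier G. congr K g h \<longrightarrow> h \<in> a \<inter> b"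
        by (rule bexI[OF _ K_Int[OF K(1) K'(1)]]) (use K K' in blast)
    qed
  next
    case (UN \<U>)
    show ?case
    proof (intro conjI ballI)
      show "\<Union>\<U> \<subseteq> carrier G" using UN by blast
      fix g assume "g \<in> \<Union>\<U>"
      then obtain V where V: "V \<in> \<U>" "g \<in> V" by blast
      then obtain K where "K \<in> \<K>" "\<forall>h\<in>carrier G. congr K g h \<longrightarrow> h \<in> V" using UN(2)[OF V(1)] by blast
      thus "\<exists>K\<in>\<K>. \<forall>h\<in>carrier G. congr K g h \<longrightarrow> h \<in> \<Union>\<U>" using V(1) by blast
    qed
  next
    case (Basis s)
    then obtain g N where gN: "s = g <# N" "g \<in> carrier G" "N \<in> \<N>" by blast
    interpret normal N G using normal gN by blast
    have "\<exists>K\<in>\<K>. \<forall>h\<in>carrier G. congr K x h \<longrightarrow> h \<in> s" if x: "x \<in> s" for x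
    proof (rule bexI[OF _ N_in_K[OF gN(3)]], intro ballI impI)
      fix h assume h: "h \<in> carrier G" "congr N x h"
      obtain n where n: "n \<in> N" "x = g \<otimes> n" using x gN by (auto simp: l_coset_def)
      have "h = g \<otimes> (n \<otimes> (inv x \<otimes> h))"
        using n gN(2) h by (simp add: m_assoc inv_mult_group flip: m_assoc[of n] m_assoc[of g])
      thus "h \<in> s" using gN n h by (auto simp: l_coset_def)
    qed
    moreover have "s \<subseteq> carrier G" using gN l_coset_subset_G subset by simp
    ultimately show ?case by blast
  qed
next
  assume U: "U \<subseteq> carrier G \<and> (\<forall>g\<in>U. \<exists>K\<in>\<K>. \<forall>h\<in>carrier G. congr K g h \<longrightarrow> h \<in> U)"
  have "\<exists>V. openin T V \<and> g \<in> V \<and> V \<subseteq> U" if g: "g \<in> U" for g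
  proof -
    obtain K where K: "K \<in> \<K>" "\<forall>h\<in>carrier G. congr K g h \<longrightarrow> h \<in> U" using U g by blast
    have gG: "g \<in> carrier G" using g U by blast
    obtain \<F> where F: "finite \<F>" "\<F> \<noteq> {}" "\<F> \<subseteq> \<N>" "K = \<Inter>\<F>" using K(1) unfolding \<K>_def by blast
    let ?V = "\<Inter>N\<in>\<F>. g <# N"
    have "openin T (g <# N)" if "N \<in> \<F>" for N
      unfolding T_def using that F gG by (intro topology_generated_by_Basis) blast
    hence "openin T ?V" using F(1,2) by (intro openin_INT2) auto
    moreover have "g \<in> ?V"
    proof
      fix N assume "N \<in> \<F>"
      hence "\<one> \<in> N" using F normal normal_imp_subgroup subgroup.one_closed by blast
      thus "g \<in> g <# N" using gG unfolding l_coset_def by force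
    qed
    moreover have "?V \<subseteq> U"
    proof
      fix h assume h: "h \<in> ?V"
      have *: "h \<in> carrier G \<and> congr N g h" if N: "N \<in> \<F>" for N
      proof -
        have Nn: "subgroup N G" using N F normal normal_imp_subgroup by blast
        have "h \<in> g <# N" using h N by blast
        then obtain n where n: "n \<in> N" "h = g \<otimes> n" by (auto simp: l_coset_def)
        have "n \<in> carrier G" using Nn n subgroup.mem_carrier by metis
        thus ?thesis using n gG by (simp flip: m_assoc)
      qed
      hence "h \<in> carrier G" "congr K g h" using F by auto
      thus "h \<in> U" using K(2) by blast
    qed
    ultimately show ?thesis by blast
  qed
  thus "openin T U" by (subst openin_subopen) blast
qed

lemma topspace_T: "topspace T = carrier G"
proof -
  obtain N where "N \<in> \<N>" using nonempty by blast
  hence "openin T (carrier G)" using N_in_K by (auto simp: openin_iff)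
  hence "carrier G \<subseteq> topspace T" by (rule openin_subset)
  moreover have "openin T (topspace T)" by (rule openin_topspace)
  hence "topspace T \<subseteq> carrier G" unfolding openin_iff by (rule conjunct1)
  ultimately show ?thesis by blast
qed

lemma closedin_iff:
  "closedin T C \<longleftrightarrow> C \<subseteq> carrier G \<and> (\<forall>g\<in>carrier G. (\<forall>K\<in>\<K>. \<exists>c\<in>C. congr K g c) \<longrightarrow> g \<in> C)"
proof (cases "C \<subseteq> carrier G")
  case C: True
  have *: "(\<forall>h\<in>carrier G. congr K g h \<longrightarrow> h \<in> carrier G - C) \<longleftrightarrow> \<not> (\<exists>c\<in>C. congr K g c)" for K g
    using C by blast
  have "closedin T C \<longleftrightarrow> (\<forall>g\<in>carrier G - C. \<exists>K\<in>\<K>. \<not> (\<exists>c\<in>C. congr K g c))"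
    unfolding closedin_def topspace_T openin_iff * using C by simp
  also have "\<dots> \<longleftrightarrow> (\<forall>g\<in>carrier G. (\<forall>K\<in>\<K>. \<exists>c\<in>C. congr K g c) \<longrightarrow> g \<in> C)"
    by (simp add: Ball_def Bex_def) metis
  finally show ?thesis using C by simp
next
  case False thus ?thesis using closedin_subset[of T C] by (auto simp: topspace_T)
qed

lemma closedin_super: 
  assumes "K \<in> \<K>" "subgroup M G" "K \<subseteq> M" shows "closedin T M"
  unfolding closedin_iff
proof (intro conjI ballI impI)
  show M: "M \<subseteq> carrier G" using assms subgroup.subset by blast
  fix g assume g: "g \<in> carrier G" "\<forall>K\<in>\<K>. \<exists>c\<in>M. congr K g c"
  then obtain c where c: "c \<in> M" "congr K g c" using assms by blast
  have cG: "c \<in> carrier G" using c M by blast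
  have "c \<otimes> inv (inv g \<otimes> c) \<in> M" using assms c by (meson subgroup.m_closed subgroup.m_inv_closed subsetD)
  also have "c \<otimes> inv (inv g \<otimes> c) = g" using g cG by (simp add: inv_mult_group flip: m_assoc)
  finally show "g \<in> M" .
qed

text \<open>
  Maps built from multiplication and inversion respect congruence modulo normal subgroups, so this
  form of continuity covers squaring and commutators.
\<close>

lemma closedin_preimage:
  assumes C: "closedin T C" and f: "\<And>g. g \<in> carrier G \<Longrightarrow> f g \<in> carrier G"
    and cong: "\<And>K g h. K \<in> \<K> \<Longrightarrow> g \<in> carrier G \<Longrightarrow> h \<in> carrier G \<Longrightarrow> congr K g h \<Longrightarrow> congr K (f g) (f h)"
  shows "closedin T {g \<in> carrier G. f g \<in> C}"
  unfolding closedin_iff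
proof (intro conjI ballI impI)
  fix g assume g: "g \<in> carrier G" "\<forall>K\<in>\<K>. \<exists>c\<in>{g \<in> carrier G. f g \<in> C}. congr K g c"
  hence "\<forall>K\<in>\<K>. \<exists>c\<in>C. congr K (f g) c" using cong by blast
  thus "g \<in> {g \<in> carrier G. f g \<in> C}" using C f g(1) unfolding closedin_iff by blast
qed auto

lemma closedin_rcoset:
  assumes C: "closedin T C" and a: "a \<in> carrier G"
  shows "closedin T (C #> a)"
proof -
  have Cs: "C \<subseteq> carrier G" using C closedin_iff by blast
  have "C #> a = {g \<in> carrier G. g \<otimes> inv a \<in> C}"
  proof (intro equalityI subsetI)
    fix g assume "g \<in> C #> a"
    thus "g \<in> {g \<in> carrier G. g \<otimes> inv a \<in> C}" using a Cs by (auto simp: r_coset_def m_assoc)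
  next
    fix g assume "g \<in> {g \<in> carrier G. g \<otimes> inv a \<in> C}"
    thus "g \<in> C #> a" using a by (auto simp: r_coset_def m_assoc intro!: bexI[of _ "g \<otimes> inv a"])
  qed
  moreover have "closedin T {g \<in> carrier G. g \<otimes> inv a \<in> C}"
    by (rule closedin_preimage[OF C]) (use a in \<open>auto intro!: congr_mult K_normal congr_refl\<close>)
  ultimately show ?thesis by simp
qed

abbreviation csg where "csg S \<equiv> closed_subgroup_generated G T S"

lemma csg:
  assumes "S \<subseteq> carrier G"
  shows csg_subgroup: "subgroup (csg S) G" and csg_closed: "closedin T (csg S)"
    and csg_sup: "S \<subseteq> csg S"
proof -
  let ?H = "{H. subgroup H G \<and> closedin T H \<and> S \<subseteq> H}"
  have ne: "carrier G \<in> ?H" using assms topspace_T subgroup_self closedin_topspace[of T] by simp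
  show "subgroup (csg S) G" unfolding closed_subgroup_generated_def
    by (rule subgroups_Inter[OF _ ]) (use ne in \<open>blast+\<close>)
  show "closedin T (csg S)" unfolding closed_subgroup_generated_def
    by (rule closedin_Inter) (use ne in \<open>blast+\<close>)
  show "S \<subseteq> csg S" unfolding closed_subgroup_generated_def by blast
qed

lemma csg_least: "subgroup H G \<Longrightarrow> closedin T H \<Longrightarrow> S \<subseteq> H \<Longrightarrow> csg S \<subseteq> H"
  unfolding closed_subgroup_generated_def by blast

lemma closedin_conj: 
  assumes "closedin T H" "subgroup H G" "g \<in> carrier G"
  shows "closedin T {h \<in> carrier G. g \<otimes> h \<otimes> inv g \<in> H}" "subgroup {h \<in> carrier G. g \<otimes> h \<otimes> inv g \<in> H} G"
proof -
  show "closedin T {h \<in> carrier G. g \<otimes> h \<otimes> inv g \<in> H}"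
    by (rule closedin_preimage[OF assms(1)]) (use assms in \<open>auto intro!: congr_mult K_normal congr_refl\<close>)
  show "subgroup {h \<in> carrier G. g \<otimes> h \<otimes> inv g \<in> H} G"
  proof (rule subgroupI)
    have "\<one> \<in> {h \<in> carrier G. g \<otimes> h \<otimes> inv g \<in> H}" using assms subgroup.one_closed by fastforce
    thus "{h \<in> carrier G. g \<otimes> h \<otimes> inv g \<in> H} \<noteq> {}" by blast
    fix a assume a: "a \<in> {h \<in> carrier G. g \<otimes> h \<otimes> inv g \<in> H}"
    have "inv (g \<otimes> a \<otimes> inv g) \<in> H" by (rule subgroup.m_inv_closed[OF assms(2)]) (use a in simp)
    thus "inv a \<in> {h \<in> carrier G. g \<otimes> h \<otimes> inv g \<in> H}" using a assms by (simp add: inv_mult_group m_assoc)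
    fix b assume b: "b \<in> {h \<in> carrier G. g \<otimes> h \<otimes> inv g \<in> H}"
    have "(g \<otimes> a \<otimes> inv g) \<otimes> (g \<otimes> b \<otimes> inv g) \<in> H"
      by (rule subgroup.m_closed[OF assms(2)]) (use a b in simp_all)
    also have "(g \<otimes> a \<otimes> inv g) \<otimes> (g \<otimes> b \<otimes> inv g) = g \<otimes> (a \<otimes> b) \<otimes> inv g"
    proof -
      have "inv g \<otimes> (g \<otimes> (b \<otimes> inv g)) = b \<otimes> inv g" using a b assms by (simp flip: m_assoc)
      thus ?thesis using a b assms by (simp add: m_assoc)
    qed
    finally show "a \<otimes> b \<in> {h \<in> carrier G. g \<otimes> h \<otimes> inv g \<in> H}" using a b by simp
  qed auto
qed

lemma csg_normal:
  assumes "S \<subseteq> carrier G" and inv: "\<And>g s. g \<in> carrier G \<Longrightarrow> s \<in> S \<Longrightarrow> g \<otimes> s \<otimes> inv g \<in> S"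
  shows "csg S \<lhd> G"
  unfolding normal_inv_iff
proof (intro conjI ballI)
  show sg: "subgroup (csg S) G" by (rule csg_subgroup[OF assms(1)])
  fix g h assume g: "g \<in> carrier G" and h: "h \<in> csg S"
  have "csg S \<subseteq> {h \<in> carrier G. g \<otimes> h \<otimes> inv g \<in> csg S}"
    by (rule csg_least) (use closedin_conj[OF csg_closed[OF assms(1)] sg g] inv g csg_sup[OF assms(1)] assms(1) in auto)
  thus "g \<otimes> h \<otimes> inv g \<in> csg S" using h by blast
qed

lemma quotient_order:
  assumes K: "K \<in> \<K>"
  shows "\<exists>k. order (G Mod K) = 2 ^ k"
proof -
  interpret normal K G using K_normal K by blast
  interpret Q: group "G Mod K" by (rule factorgroup_is_group)
  show ?thesis
  proof (rule Q.finite_2_group_order)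
    show "finite (carrier (G Mod K))" using K_finite_index[OF K] by (simp add: FactGroup_def)
    fix C assume "C \<in> carrier (G Mod K)"
    then obtain g where g: "g \<in> carrier G" "C = K #> g" by (auto simp: carrier_FactGroup)
    obtain m where m: "g [^] ((2::nat) ^ m) \<in> K" using K_two_power K g by blast
    have "C [^]\<^bsub>G Mod K\<^esub> ((2::nat) ^ m) = K #> (g [^] ((2::nat) ^ m))"
      using g FactGroup_pow by simp
    also have "\<dots> = K" using m coset_join2 subgroup_axioms g(1) by blast
    finally show "\<exists>m. C [^]\<^bsub>G Mod K\<^esub> ((2::nat) ^ m) = \<one>\<^bsub>G Mod K\<^esub>" by auto
  qed
qed

lemma subgroup_preimage:
  assumes "K \<lhd> G" "subgroup M (G Mod K)"
  shows "subgroup {x \<in> carrier G. K #> x \<in> M} G" "K \<subseteq> {x \<in> carrier G. K #> x \<in> M}"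
proof -
  interpret normal K G by fact
  interpret M: subgroup M "G Mod K" by fact
  interpret Q: group "G Mod K" by (rule factorgroup_is_group)
  show "K \<subseteq> {x \<in> carrier G. K #> x \<in> M}"
    using M.one_closed coset_join2 subgroup_axioms mem_carrier by fastforce
  show "subgroup {x \<in> carrier G. K #> x \<in> M} G"
  proof (rule subgroupI)
    show "{x \<in> carrier G. K #> x \<in> M} \<noteq> {}"
      using M.one_closed coset_mult_one subset by (auto intro!: exI[of _ \<one>])
    fix a assume a: "a \<in> {x \<in> carrier G. K #> x \<in> M}"
    have "inv\<^bsub>G Mod K\<^esub> (K #> a) \<in> M" using a M.m_inv_closed by blast
    moreover have "inv\<^bsub>G Mod K\<^esub> (K #> a) = K #> inv a"
      using a rcos_inv M.subset by (subst inv_FactGroup) auto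
    ultimately show "inv a \<in> {x \<in> carrier G. K #> x \<in> M}" using a by simp
    fix b assume b: "b \<in> {x \<in> carrier G. K #> x \<in> M}"
    have "(K #> a) \<otimes>\<^bsub>G Mod K\<^esub> (K #> b) \<in> M" using a b M.m_closed by blast
    thus "a \<otimes> b \<in> {x \<in> carrier G. K #> x \<in> M}" using a b rcos_sum by simp
  qed auto
qed

lemma subgroup_image:
  assumes "K \<lhd> G" "subgroup H G"
  shows "subgroup ((\<lambda>x. K #> x) ` H) (G Mod K)"
proof -
  interpret normal K G by fact
  interpret Q: group "G Mod K" by (rule factorgroup_is_group)
  interpret group_hom G "G Mod K" "\<lambda>x. K #> x"
    using r_coset_hom_Mod by unfold_locales
  show ?thesis by (rule subgroup_img_is_subgroup[OF assms(2)])
qed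

text \<open>
  The pro-2 substitute for maximal subgroups: a point outside \<open>H\<close> stays outside \<open>H\<close> in some finite
  quotient, and there \<open>two_group_index_two\<close> applies.
\<close>

lemma closed_subgroup_index_two:
  assumes H: "subgroup H G" "closedin T H" "H \<noteq> carrier G"
  obtains M where "index_two G M" "closedin T M" "H \<subseteq> M"
proof -
  have HG: "H \<subseteq> carrier G" using H subgroup.subset by blast
  then obtain g where g: "g \<in> carrier G" "g \<notin> H" using H by blast
  have "\<not> (\<forall>K\<in>\<K>. \<exists>c\<in>H. congr K g c)" using H(2) g unfolding closedin_iff by blast
  then obtain K where K: "K \<in> \<K>" "\<And>c. c \<in> H \<Longrightarrow> \<not> congr K g c" by blast
  interpret normal K G using K_normal K by blast
  interpret Q: group "G Mod K" by (rule factorgroup_is_group)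
  obtain k where k: "order (G Mod K) = 2 ^ k" using quotient_order K by blast
  let ?H = "(\<lambda>x. K #> x) ` H"
  have sub: "subgroup ?H (G Mod K)" using subgroup_image normal_axioms H by blast
  have "K #> g \<noteq> K #> c" if "c \<in> H" for c
    using K(2)[OF that] congr_coset[OF normal_axioms g(1)] HG that by (metis subsetD)
  hence "K #> g \<notin> ?H" by blast
  moreover have "K #> g \<in> carrier (G Mod K)" using g by (simp add: carrier_FactGroup)
  ultimately have "?H \<noteq> carrier (G Mod K)" by blast
  from Q.two_group_index_two[OF k sub this]
  obtain M' where M': "index_two (G Mod K) M'" "?H \<subseteq> M'" by blast
  have sM': "subgroup M' (G Mod K)" "M' \<noteq> carrier (G Mod K)" using M' by (auto simp: index_two_def)
  define M where "M = {x \<in> carrier G. K #> x \<in> M'}"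
  have sM: "subgroup M G" "K \<subseteq> M" using subgroup_preimage[OF normal_axioms sM'(1)] by (auto simp: M_def)
  show ?thesis
  proof
    show "closedin T M" using closedin_super K(1) sM by blast
    show "H \<subseteq> M" using M'(2) HG by (auto simp: M_def)
    show "index_two G M" unfolding index_two_def
    proof (intro conjI ballI)
      show "subgroup M G" by fact
      obtain x where "x \<in> carrier G" "K #> x \<notin> M'"
        using sM' subgroup.subset[OF sM'(1)] by (auto simp: carrier_FactGroup)
      thus "M \<noteq> carrier G" by (auto simp: M_def)
      fix x y assume xy: "x \<in> carrier G - M" "y \<in> carrier G - M"
      hence "K #> x \<in> carrier (G Mod K) - M'" "K #> y \<in> carrier (G Mod K) - M'"
        by (auto simp: carrier_FactGroup M_def)
      hence "(K #> x) \<otimes>\<^bsub>G Mod K\<^esub> (K #> y) \<in> M'"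
        using M'(1) unfolding index_two_def by blast
      thus "x \<otimes> y \<in> M" using xy rcos_sum by (simp add: M_def)
    qed
  qed
qed

end

section \<open>The filtration of a group generated by involutions\<close>

lemma (in group) inv_cancel [simp]:
  "a \<in> carrier G \<Longrightarrow> b \<in> carrier G \<Longrightarrow> inv a \<otimes> (a \<otimes> b) = b"
  "a \<in> carrier G \<Longrightarrow> b \<in> carrier G \<Longrightarrow> a \<otimes> (inv a \<otimes> b) = b"
  by (simp_all flip: m_assoc)

lemma (in group) elementary_abelianI:
  assumes sq: "\<And>v. v \<in> carrier G \<Longrightarrow> v \<otimes> v = \<one>"
  shows "elementary_abelian_2_group G"
proof -
  have i: "inv v = v" if "v \<in> carrier G" for v using sq that inv_equality by blast
  have "x \<otimes> y = y \<otimes> x" if "x \<in> carrier G" "y \<in> carrier G" for x y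
    using that i[of "x \<otimes> y"] i[of x] i[of y] inv_mult_group[of x y] by simp
  then interpret comm_group G by (rule group_comm_groupI)
  show ?thesis by unfold_locales (rule sq)
qed

lemma (in group) set_mult_absorb:
  assumes "subgroup H G" "A \<subseteq> H" "\<one> \<in> A"
  shows "H <#> A = H"
proof -
  have HG: "H \<subseteq> carrier G" using assms subgroup.subset by blast
  have "h \<otimes> a \<in> H" if "h \<in> H" "a \<in> A" for h a
    using that assms(2) by (auto intro: subgroup.m_closed[OF assms(1)])
  moreover have "h \<in> H <#> A" if "h \<in> H" for h
    using that assms HG unfolding set_mult_def by force
  ultimately show ?thesis by (auto simp: set_mult_def)
qed

context pro_2_topology
begin

abbreviation commut where "commut x y \<equiv> inv x \<otimes> inv y \<otimes> x \<otimes> y"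

text \<open>
  \<open>G2\<close> is the second term of the filtration.  \<open>B\<close> is contained in the third term and will equal it as
  soon as squares of elements of \<open>G2\<close> lie in \<open>B\<close>.
\<close>

definition G2 :: "'a set" where "G2 = closed_square G T (carrier G)"

definition B :: "'a set" where "B = closed_commutator G T (carrier G) G2"

lemma squares_sub: "{x \<otimes> x | x. x \<in> carrier G} \<subseteq> carrier G" by auto

lemma G2_subgroup: "subgroup G2 G" and G2_closed: "closedin T G2"
  and square_in_G2: "x \<in> carrier G \<Longrightarrow> x \<otimes> x \<in> G2"
  unfolding G2_def closed_square_def using csg[OF squares_sub] by auto

lemma G2_sub: "G2 \<subseteq> carrier G" using G2_subgroup subgroup.subset by blast

lemma G2_normal: "G2 \<lhd> G"
  unfolding G2_def closed_square_def
proof (rule csg_normal[OF squares_sub])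
  fix g s assume g: "g \<in> carrier G" and "s \<in> {x \<otimes> x | x. x \<in> carrier G}"
  then obtain x where x: "x \<in> carrier G" "s = x \<otimes> x" by blast
  have "g \<otimes> s \<otimes> inv g = (g \<otimes> x \<otimes> inv g) \<otimes> (g \<otimes> x \<otimes> inv g)"
    using g x by (simp add: m_assoc)
  thus "g \<otimes> s \<otimes> inv g \<in> {x \<otimes> x | x. x \<in> carrier G}" using g x by blast
qed

text \<open>
  A commutator is a product of three squares, so the squares alone generate the second term.
\<close>

lemma commut_in_G2:
  assumes "x \<in> carrier G" "y \<in> carrier G" shows "commut x y \<in> G2"
proof -
  have "commut x y = (inv x \<otimes> inv x) \<otimes> ((x \<otimes> inv y) \<otimes> (x \<otimes> inv y)) \<otimes> (y \<otimes> y)"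
    using assms by (simp add: m_assoc)
  thus ?thesis using assms by (auto intro!: subgroup.m_closed[OF G2_subgroup] square_in_G2)
qed

lemma commut_sub: "H \<subseteq> carrier G \<Longrightarrow> K \<subseteq> carrier G \<Longrightarrow>
  {commut x y | x y. x \<in> H \<and> y \<in> K} \<subseteq> carrier G" by (auto simp: subset_iff)

lemma closed_commutator_swap:
  assumes "H \<subseteq> carrier G" "K \<subseteq> carrier G"
  shows "closed_commutator G T H K \<subseteq> closed_commutator G T K H"
  unfolding closed_commutator_def
proof (rule csg_least)
  note s = csg[OF commut_sub[OF assms(2,1)]]
  show "subgroup (csg {commut x y |x y. x \<in> K \<and> y \<in> H}) G" "closedin T (csg {commut x y |x y. x \<in> K \<and> y \<in> H})"
    by (rule s)+
  show "{commut x y |x y. x \<in> H \<and> y \<in> K} \<subseteq> csg {commut x y |x y. x \<in> K \<and> y \<in> H}"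
  proof clarify
    fix x y assume xy: "x \<in> H" "y \<in> K"
    have "inv (commut y x) \<in> csg {commut x y |x y. x \<in> K \<and> y \<in> H}"
      by (rule subgroup.m_inv_closed[OF s(1)]) (use s(3) xy in blast)
    also have "inv (commut y x) = commut x y"
      using xy assms by (simp add: subset_iff inv_mult_group m_assoc)
    finally show "commut x y \<in> csg {commut x y |x y. x \<in> K \<and> y \<in> H}" .
  qed
qed

lemma B_subgroup: "subgroup B G" and B_closed: "closedin T B"
  and commut_in_B: "x \<in> carrier G \<Longrightarrow> y \<in> G2 \<Longrightarrow> commut x y \<in> B"
  unfolding B_def closed_commutator_def using csg[OF commut_sub[OF order.refl G2_sub]] by auto

lemma B_normal: "B \<lhd> G"
  unfolding B_def closed_commutator_def
proof (rule csg_normal[OF commut_sub[OF order.refl G2_sub]])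
  fix g s assume g: "g \<in> carrier G" and "s \<in> {commut x y |x y. x \<in> carrier G \<and> y \<in> G2}"
  then obtain x y where xy: "x \<in> carrier G" "y \<in> G2" "s = commut x y" by blast
  have yG: "y \<in> carrier G" using xy G2_sub by blast
  have "g \<otimes> y \<otimes> inv g \<in> G2" using G2_normal g xy(2) by (simp add: normal_inv_iff)
  moreover have "g \<otimes> s \<otimes> inv g = commut (g \<otimes> x \<otimes> inv g) (g \<otimes> y \<otimes> inv g)"
    unfolding xy(3) using g xy(1) yG by (simp add: m_assoc inv_mult_group)
  ultimately show "g \<otimes> s \<otimes> inv g \<in> {commut x y |x y. x \<in> carrier G \<and> y \<in> G2}"
    using g xy(1) by blast
qed

lemma zassenhaus_1: "zassenhaus G T 1 = carrier G"
  by (simp add: zassenhaus.simps)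

lemma zassenhaus_2: "zassenhaus G T 2 = G2"
proof -
  let ?C = "closed_commutator G T (carrier G) (carrier G)"
  have 1: "zassenhaus G T (Suc 0) = carrier G" using zassenhaus_1 by simp
  have "?C \<subseteq> G2" unfolding closed_commutator_def
    by (rule csg_least[OF G2_subgroup G2_closed]) (use commut_in_G2 in blast)
  moreover have C: "subgroup ?C G" unfolding closed_commutator_def
    by (rule csg_subgroup) auto
  moreover have "zassenhaus G T 2 = G2 <#> (?C <#> {\<one>})"
  proof -
    have u: "[1..<2] = [1::nat]" by (simp add: upt_rec)
    show ?thesis by (subst zassenhaus.simps) (simp add: 1 G2_def u[simplified])
  qed
  moreover have "?C <#> {\<one>} = ?C" by (rule set_mult_absorb[OF C]) (use C subgroup.one_closed in auto)
  ultimately show ?thesis using set_mult_absorb[OF G2_subgroup] subgroup.one_closed[OF C] by simp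
qed

text \<open>
  Under the hypothesis both further factors of the third term are absorbed by \<open>B\<close>.
\<close>

lemma zassenhaus_3:
  assumes "\<And>z. z \<in> G2 \<Longrightarrow> z \<otimes> z \<in> B"
  shows "zassenhaus G T (2 + 1) = B"
proof -
  let ?C = "closed_commutator G T G2 (carrier G)" and ?S = "closed_square G T G2"
  have 1: "zassenhaus G T (Suc 0) = carrier G" using zassenhaus_1 by simp
  have CB: "?C = B" unfolding B_def using closed_commutator_swap G2_sub by blast
  have S: "?S \<subseteq> B" unfolding closed_square_def
    by (rule csg_least[OF B_subgroup B_closed]) (use assms in blast)
  have Ss: "subgroup ?S G" unfolding closed_square_def by (rule csg_subgroup) (use G2_sub in auto)
  have "zassenhaus G T (2 + 1) = ?S <#> (B <#> (?C <#> {\<one>}))"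
  proof -
    have u: "[1..<3] = [1, 2::nat]" by (simp add: upt_rec)
    show ?thesis by (subst zassenhaus.simps) (simp add: 1 zassenhaus_2 B_def u[simplified])
  qed
  also have "?C <#> {\<one>} = ?C" unfolding CB by (rule set_mult_absorb[OF B_subgroup]) (use B_subgroup subgroup.one_closed in auto)
  also have "B <#> ?C = B" unfolding CB by (rule set_mult_absorb[OF B_subgroup]) (use B_subgroup subgroup.one_closed in auto)
  also have "?S <#> B = B"
  proof -
    have "s \<otimes> b \<in> B" if "s \<in> ?S" "b \<in> B" for s b
      using that S by (auto intro: subgroup.m_closed[OF B_subgroup])
    moreover have "b \<in> ?S <#> B" if "b \<in> B" for b
      using that Ss[THEN subgroup.one_closed] subgroup.mem_carrier[OF B_subgroup that] unfolding set_mult_def by force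
    ultimately show ?thesis by (auto simp: set_mult_def)
  qed
  finally show ?thesis .
qed

text \<open>
  The Frattini quotient.
\<close>

abbreviation V where "V \<equiv> G Mod G2"

lemma V_elementary: "elementary_abelian_2_group V"
proof -
  interpret normal G2 G by (rule G2_normal)
  interpret V: group V by (rule factorgroup_is_group)
  show ?thesis
  proof (rule V.elementary_abelianI)
    fix v assume "v \<in> carrier V"
    then obtain x where x: "x \<in> carrier G" "v = G2 #> x" by (auto simp: carrier_FactGroup)
    hence "v \<otimes>\<^bsub>V\<^esub> v = G2 #> (x \<otimes> x)" by (simp add: rcos_sum)
    thus "v \<otimes>\<^bsub>V\<^esub> v = \<one>\<^bsub>V\<^esub>" using x square_in_G2[OF x(1)] coset_join2 G2_subgroup by simp
  qed
qed

text \<open>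
  Index two forces squares into \<open>M\<close>, so membership in \<open>M\<close> depends on the class modulo \<open>G2\<close> only.
\<close>

lemma closed_index_two_G2:
  assumes "index_two G M" "closedin T M" shows "G2 \<subseteq> M"
  unfolding G2_def closed_square_def
proof (rule csg_least[OF _ assms(2)])
  show M: "subgroup M G" using assms by (auto simp: index_two_def)
  show "{x \<otimes> x |x. x \<in> carrier G} \<subseteq> M"
  proof clarify
    fix x assume "x \<in> carrier G"
    thus "x \<otimes> x \<in> M" using assms(1) subgroup.m_closed[OF M] unfolding index_two_def by (cases "x \<in> M") auto
  qed
qed

lemma closedin_finite_cosets:
  assumes K: "K \<lhd> G" "closedin T K" and D: "finite D" "D \<subseteq> carrier (G Mod K)"
  shows "closedin T {x \<in> carrier G. K #> x \<in> D}"
proof -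
  interpret normal K G by fact
  have "{x \<in> carrier G. K #> x \<in> D} = \<Union>D"
  proof (intro equalityI subsetI)
    fix x assume "x \<in> {x \<in> carrier G. K #> x \<in> D}"
    thus "x \<in> \<Union>D" using rcos_self subgroup_axioms by blast
  next
    fix x assume "x \<in> \<Union>D"
    then obtain C where C: "C \<in> D" "x \<in> C" by blast
    then obtain g where g: "g \<in> carrier G" "C = K #> g" using D by (auto simp: carrier_FactGroup)
    have "x \<in> carrier G" using C g r_coset_subset_G subset by blast
    moreover have "K #> x = C" using C g repr_independence subgroup_axioms by simp
    ultimately show "x \<in> {x \<in> carrier G. K #> x \<in> D}" using C by simp
  qed
  moreover have "closedin T (\<Union>D)"
  proof (rule closedin_Union[OF D(1)])
    fix C assume "C \<in> D"
    then obtain g where g: "g \<in> carrier G" "C = K #> g" using D by (auto simp: carrier_FactGroup)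
    thus "closedin T C" using closedin_rcoset K(2) by simp
  qed
  ultimately show ?thesis by simp
qed

text \<open>
  The preimage of a proper subgroup of the finite group \<open>V\<close> is closed, hence contained in a closed
  subgroup of index two, which would contain \<open>J\<close>.
\<close>

lemma generates_V:
  assumes J: "J \<subseteq> carrier G" and miss: "\<And>M. index_two G M \<Longrightarrow> closedin T M \<Longrightarrow> \<exists>x\<in>J. x \<notin> M"
    and fin: "finite (carrier V)" and U: "subgroup U V" "(\<lambda>x. G2 #> x) ` J \<subseteq> U"
  shows "U = carrier V"
proof (rule ccontr)
  assume ne: "U \<noteq> carrier V"
  have UV: "U \<subseteq> carrier V" using U(1) subgroup.subset by blast
  let ?U = "{x \<in> carrier G. G2 #> x \<in> U}"
  have "closedin T ?U" by (rule closedin_finite_cosets[OF G2_normal G2_closed])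
     (use UV fin finite_subset in auto)
  moreover have "?U \<noteq> carrier G" using ne UV by (auto simp: carrier_FactGroup)
  moreover have "subgroup ?U G" by (rule subgroup_preimage[OF G2_normal U(1)])
  ultimately obtain M where "index_two G M" "closedin T M" "?U \<subseteq> M"
    using closed_subgroup_index_two by blast
  thus False using miss U(2) J by blast
qed

text \<open>
  Frattini argument: a proper closed subgroup lies in a closed subgroup of index two, which contains
  \<open>G2\<close> and therefore has proper image in \<open>V\<close>.
\<close>

lemma frattini:
  assumes H: "subgroup H G" "closedin T H" and onto: "\<And>U. subgroup U V \<Longrightarrow> (\<lambda>x. G2 #> x) ` H \<subseteq> U \<Longrightarrow> U = carrier V"
  shows "H = carrier G"
proof (rule ccontr)
  assume "H \<noteq> carrier G"
  then obtain M where M: "index_two G M" "closedin T M" "H \<subseteq> M" using closed_subgroup_index_two H by blast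
  have sM: "subgroup M G" "M \<noteq> carrier G" using M by (auto simp: index_two_def)
  have "(\<lambda>x. G2 #> x) ` M = carrier V"
    by (rule onto) (use subgroup_image[OF G2_normal sM(1)] M(3) in auto)
  moreover have "x \<in> M" if x: "x \<in> carrier G" "G2 #> x \<in> (\<lambda>x. G2 #> x) ` M" for x
  proof -
    obtain m where m: "m \<in> M" "G2 #> x = G2 #> m" using x by blast
    have "x \<in> G2 #> m" using rcos_self[OF x(1) G2_subgroup] m by simp
    then obtain z where "z \<in> G2" "x = z \<otimes> m" by (auto simp: r_coset_def)
    thus ?thesis using closed_index_two_G2[OF M(1,2)] m by (auto intro: subgroup.m_closed[OF sM(1)])
  qed
  moreover have "M \<subseteq> carrier G" using sM subgroup.subset by blast
  ultimately have "M = carrier G" by (auto simp: carrier_FactGroup)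
  thus False using sM by blast
qed

abbreviation Q where "Q \<equiv> G Mod B"

text \<open>
  The central elements of order at most two in \<open>G / B\<close>.  Collecting them into one elementary abelian
  group gives a place where products of commutators can be formed before it is known that the image
  of \<open>G2\<close> is elementary abelian.
\<close>

definition E where
  "E = Q\<lparr>carrier := {C \<in> carrier Q. C <#> C = B \<and> (\<forall>C'\<in>carrier Q. C <#> C' = C' <#> C)}\<rparr>"

lemma rho_mult: "a \<in> carrier G \<Longrightarrow> b \<in> carrier G \<Longrightarrow> (B #> a) <#> (B #> b) = B #> (a \<otimes> b)"
  using normal.rcos_sum[OF B_normal] by simp

lemma rho_one: "a \<in> carrier G \<Longrightarrow> B #> a = B \<longleftrightarrow> a \<in> B"
  using coset_join1 coset_join2 B_subgroup subgroup.subset by metis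

lemma rho_absorb: "b \<in> B \<Longrightarrow> a \<in> carrier G \<Longrightarrow> B #> (b \<otimes> a) = B #> a"
  using coset_mult_assoc[of B b a] coset_join2[of b B] subgroup.subset[OF B_subgroup] B_subgroup by auto

lemma Q_group: "group Q" using normal.factorgroup_is_group[OF B_normal] .

lemma rho_in_E:
  assumes "z \<in> carrier G"
  shows "B #> z \<in> carrier E \<longleftrightarrow> z \<otimes> z \<in> B \<and> (\<forall>g\<in>carrier G. B #> (z \<otimes> g) = B #> (g \<otimes> z))"
  using assms rho_one[of "z \<otimes> z"] unfolding E_def by (auto simp: carrier_FactGroup rho_mult)

lemma rho_G2_central:
  assumes "z \<in> G2" "g \<in> carrier G"
  shows "B #> (z \<otimes> g) = B #> (g \<otimes> z)"
proof -
  have zG: "z \<in> carrier G" using assms G2_sub by blast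
  have "commut (inv g) (inv z) \<in> B" using commut_in_B assms subgroup.m_inv_closed[OF G2_subgroup] by blast
  hence "B #> (commut (inv g) (inv z) \<otimes> (z \<otimes> g)) = B #> (z \<otimes> g)"
    by (rule rho_absorb) (use zG assms in simp)
  moreover have "commut (inv g) (inv z) \<otimes> (z \<otimes> g) = g \<otimes> z" using zG assms by (simp add: m_assoc)
  ultimately show ?thesis by simp
qed

lemma E_elementary: "elementary_abelian_2_group E"
proof -
  interpret Q: group Q by (rule Q_group)
  have memE: "C \<in> carrier E \<longleftrightarrow> C \<in> carrier Q \<and> C <#> C = B \<and> (\<forall>C'\<in>carrier Q. C <#> C' = C' <#> C)" for C
    by (simp add: E_def)
  have "subgroup (carrier E) Q"
  proof (rule Q.subgroupI)
    show "carrier E \<subseteq> carrier Q" by (auto simp: E_def)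
    have "B \<in> carrier E" using rho_in_E[of \<one>] subgroup.one_closed[OF B_subgroup] rho_one[of \<one>] by simp
    thus "carrier E \<noteq> {}" by blast
    fix a assume a: "a \<in> carrier E"
    have "inv\<^bsub>Q\<^esub> a = a" using a by (intro Q.inv_equality) (auto simp: E_def)
    thus "inv\<^bsub>Q\<^esub> a \<in> carrier E" using a by simp
    fix b assume b: "b \<in> carrier E"
    obtain x where x: "x \<in> carrier G" "a = B #> x" using a by (auto simp: E_def carrier_FactGroup)
    obtain y where y: "y \<in> carrier G" "b = B #> y" using b by (auto simp: E_def carrier_FactGroup)
    have abQ: "a \<in> carrier Q" "b \<in> carrier Q" using a b by (auto simp: E_def)
    have ca: "a <#> c = c <#> a" "b <#> c = c <#> b" if "c \<in> carrier Q" for c using a b that by (auto simp: E_def)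
    have sq: "a <#> a = B" "b <#> b = B" using a b by (auto simp: E_def)
    note as = Q.m_assoc[unfolded mult_FactGroup]
    note cl = Q.m_closed[unfolded mult_FactGroup]
    have "(a <#> b) <#> (a <#> b) = (a <#> a) <#> (b <#> b)"
      using abQ ca as cl by metis
    hence "(a <#> b) <#> (a <#> b) = B" using sq Q.l_one[of B] Q.one_closed by simp
    moreover have "(a <#> b) <#> c = c <#> (a <#> b)" if "c \<in> carrier Q" for c
      using abQ ca as cl that by metis
    ultimately have "a <#> b \<in> carrier E" using cl[OF abQ] memE[of "a <#> b"] by blast
    thus "a \<otimes>\<^bsub>Q\<^esub> b \<in> carrier E" by simp
  qed
  from Q.subgroup_imp_group[OF this] interpret E: group E by (simp add: E_def)
  show ?thesis by (rule E.elementary_abelianI) (auto simp: E_def)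
qed

lemma E_mult [simp]: "monoid.mult E = set_mult G" and E_one [simp]: "one E = B"
  by (simp_all add: E_def)

lemma rho_conj:
  assumes "z \<in> carrier G" "B #> z \<in> carrier E" "h \<in> carrier G"
  shows "B #> (inv h \<otimes> z \<otimes> h) = B #> z"
proof -
  have "B #> (z \<otimes> h) = B #> (h \<otimes> z)" using assms rho_in_E by blast
  hence "(B #> inv h) <#> (B #> (z \<otimes> h)) = (B #> inv h) <#> (B #> (h \<otimes> z))" by simp
  thus ?thesis using assms by (simp add: rho_mult m_assoc)
qed

text \<open>
  Commutators with a fixed element are multiplicative modulo \<open>B\<close> once they are central.
\<close>

lemma rho_commut_mult:
  assumes "g \<in> carrier G" "h \<in> carrier G" "y \<in> carrier G" "B #> commut g y \<in> carrier E"
  shows "B #> commut (g \<otimes> h) y = (B #> commut g y) <#> (B #> commut h y)"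
proof -
  have "commut (g \<otimes> h) y = (inv h \<otimes> commut g y \<otimes> h) \<otimes> commut h y"
    using assms by (simp add: m_assoc inv_mult_group)
  hence "B #> commut (g \<otimes> h) y = (B #> (inv h \<otimes> commut g y \<otimes> h)) <#> (B #> commut h y)"
    using assms by (simp add: rho_mult)
  thus ?thesis using rho_conj[of "commut g y" h] assms by simp
qed

text \<open>
  Let \<open>P\<close> be the preimage of the span of the commutators of the generators.  It is closed, since the span is
  finite.  The elements whose commutators with a given set lie in \<open>P\<close>, and those whose square lies in \<open>P\<close>,
  form closed subgroups; as the generators belong to them they are everything, so \<open>G2\<close> is
  contained in \<open>P\<close>.
\<close>

lemma rho_G2:
  fixes f :: "nat \<Rightarrow> 'a"
  assumes f: "\<And>i. i < n \<Longrightarrow> f i \<in> carrier G" "\<And>i. i < n \<Longrightarrow> f i \<otimes> f i = \<one>"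
    and gen: "\<And>H. subgroup H G \<Longrightarrow> closedin T H \<Longrightarrow> f ` {..<n} \<subseteq> H \<Longrightarrow> H = carrier G"
  defines "c \<equiv> \<lambda>(i, j). B #> commut (f i) (f j)"
    and "I \<equiv> {(i, j). i < j \<and> j < n}"
  shows "c ` I \<subseteq> carrier E" and "(\<lambda>z. B #> z) ` G2 = finprod E (\<lambda>v. v) ` Pow (c ` I)"
proof -
  interpret E: elementary_abelian_2_group E by (rule E_elementary)
  have cE: "B #> commut (f i) (f j) \<in> carrier E" if ij: "i < n" "j < n" for i j
  proof -
    let ?x = "f i" and ?y = "f j"
    have xy: "?x \<in> carrier G" "?y \<in> carrier G" "?x \<otimes> ?x = \<one>" "?y \<otimes> ?y = \<one>" using f ij by auto
    have ii: "inv ?x = ?x" "inv ?y = ?y" using xy inv_equality by auto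
    have z: "commut ?x ?y \<in> G2" using commut_in_G2 xy by blast
    have "?x \<otimes> (?x \<otimes> a) = a" "?y \<otimes> (?y \<otimes> a) = a" if "a \<in> carrier G" for a using that xy by (simp_all flip: m_assoc)
    hence *: "commut ?x ?y \<otimes> (inv ?x \<otimes> commut ?x ?y \<otimes> ?x) = \<one>"
      using xy ii by (simp add: m_assoc)
    have "commut ?x ?y \<otimes> commut ?x ?y \<in> B"
    proof -
      have "B #> (?x \<otimes> commut ?x ?y) = B #> (commut ?x ?y \<otimes> ?x)" using rho_G2_central[OF z xy(1)] by simp
      hence "(B #> inv ?x) <#> (B #> (?x \<otimes> commut ?x ?y)) = (B #> inv ?x) <#> (B #> (commut ?x ?y \<otimes> ?x))" by simp
      hence "B #> commut ?x ?y = B #> (inv ?x \<otimes> commut ?x ?y \<otimes> ?x)"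
        using xy(1,2) by (simp add: rho_mult m_assoc)
      hence "(B #> commut ?x ?y) <#> (B #> commut ?x ?y) = (B #> commut ?x ?y) <#> (B #> (inv ?x \<otimes> commut ?x ?y \<otimes> ?x))" by simp
      hence "B #> (commut ?x ?y \<otimes> commut ?x ?y) = B #> (commut ?x ?y \<otimes> (inv ?x \<otimes> commut ?x ?y \<otimes> ?x))"
        using xy(1,2) by (simp add: rho_mult)
      hence "B #> (commut ?x ?y \<otimes> commut ?x ?y) = B #> \<one>" unfolding * .
      thus ?thesis using rho_one xy(1,2) B_subgroup subgroup.one_closed by (metis m_closed inv_closed one_closed)
    qed
    thus ?thesis using rho_in_E[of "commut ?x ?y"] xy rho_G2_central[OF z] by simp
  qed
  show cI: "c ` I \<subseteq> carrier E" using cE by (auto simp: c_def I_def)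
  have finI: "finite I" by (rule finite_subset[of _ "{..<n} \<times> {..<n}"]) (auto simp: I_def)
  define D where "D = E.sprod ` Pow (c ` I)"
  have sD: "subgroup D E" unfolding D_def by (rule E.subgroup_span) (use finI cI in auto)
  have DE: "D \<subseteq> carrier E" using sD subgroup.subset by blast
  have finD: "finite D" using finI by (simp add: D_def)
  have Dm: "a <#> b \<in> D" if "a \<in> D" "b \<in> D" for a b using subgroup.m_closed[OF sD] that by simp
  have DQ: "D \<subseteq> carrier Q" using DE by (auto simp: E_def)
  have D1: "B \<in> D" using subgroup.one_closed[OF sD] by simp
  define P where "P = {x \<in> carrier G. B #> x \<in> D}"
  have Pc: "closedin T P" unfolding P_def by (rule closedin_finite_cosets[OF B_normal B_closed finD DQ])
  have Pm: "a \<otimes> b \<in> P" if "a \<in> P" "b \<in> P" for a b using Dm that by (auto simp: P_def simp flip: rho_mult)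
  have P1: "\<one> \<in> P" using D1 rho_one[of \<one>] subgroup.one_closed[OF B_subgroup] by (simp add: P_def)
  have rho_inv: "B #> inv a = B #> a" if a: "a \<in> carrier G" "B #> a \<in> carrier E" for a
  proof -
    have "(B #> a) <#> (B #> a) = B" using a by (auto simp: E_def)
    hence "(B #> inv a) <#> ((B #> a) <#> (B #> a)) = (B #> inv a) <#> B" by simp
    moreover have "B = B #> \<one>" using rho_one[of \<one>] subgroup.one_closed[OF B_subgroup] by simp
    ultimately show ?thesis using a(1) by (metis rho_mult inv_closed m_closed r_one one_closed inv_cancel(1))
  qed
  have Pi: "inv a \<in> P" if "a \<in> P" for a using rho_inv that DE by (auto simp: P_def)
  have PG: "P \<subseteq> carrier G" by (auto simp: P_def)
  have sP: "subgroup P G" by (rule subgroupI) (use P1 Pm Pi PG in auto)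
  have Pconj: "inv h \<otimes> a \<otimes> h \<in> P" if "a \<in> P" "h \<in> carrier G" for a h
    using that rho_conj DE by (auto simp: P_def)
  have Pconj': "h \<otimes> a \<otimes> inv h \<in> P" if "a \<in> P" "h \<in> carrier G" for a h
    using Pconj[of a "inv h"] that by simp
  have comm_sub: "subgroup {g \<in> carrier G. \<forall>y\<in>A. commut g y \<in> P} G" if A: "A \<subseteq> carrier G" for A
  proof (rule subgroupI)
    have "commut \<one> y = \<one>" if "y \<in> A" for y using that A by (simp add: subset_iff)
    hence "\<one> \<in> {g \<in> carrier G. \<forall>y\<in>A. commut g y \<in> P}" using P1 by simp
    thus "{g \<in> carrier G. \<forall>y\<in>A. commut g y \<in> P} \<noteq> {}" by blast
    fix a assume a: "a \<in> {g \<in> carrier G. \<forall>y\<in>A. commut g y \<in> P}"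
    have "commut (inv a) y \<in> P" if y: "y \<in> A" for y
    proof -
      have "a \<otimes> inv (commut a y) \<otimes> inv a \<in> P" using a y Pi Pconj' by blast
      also have "a \<otimes> inv (commut a y) \<otimes> inv a = commut (inv a) y"
        using a y A by (simp add: subset_iff m_assoc inv_mult_group)
      finally show ?thesis .
    qed
    thus "inv a \<in> {g \<in> carrier G. \<forall>y\<in>A. commut g y \<in> P}" using a by simp
    fix b assume b: "b \<in> {g \<in> carrier G. \<forall>y\<in>A. commut g y \<in> P}"
    have "commut (a \<otimes> b) y \<in> P" if y: "y \<in> A" for y
    proof -
      have "(inv b \<otimes> commut a y \<otimes> b) \<otimes> commut b y \<in> P" using a b y Pm Pconj by blast
      also have "(inv b \<otimes> commut a y \<otimes> b) \<otimes> commut b y = commut (a \<otimes> b) y"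
        using a b y A by (simp add: subset_iff m_assoc inv_mult_group)
      finally show ?thesis .
    qed
    thus "a \<otimes> b \<in> {g \<in> carrier G. \<forall>y\<in>A. commut g y \<in> P}" using a b by simp
  qed auto
  have comm_closed: "closedin T {g \<in> carrier G. \<forall>y\<in>A. commut g y \<in> P}" if A: "A \<subseteq> carrier G" for A
  proof (cases "A = {}")
    case True thus ?thesis using topspace_T closedin_topspace[of T] by simp
  next
    case False
    have "closedin T {g \<in> carrier G. commut g y \<in> P}" if y: "y \<in> A" for y
    proof (rule closedin_preimage[OF Pc])
      fix K g h assume K: "K \<in> \<K>" "g \<in> carrier G" "h \<in> carrier G" "congr K g h"
      show "congr K (commut g y) (commut h y)"
        using K A y by (intro congr_mult congr_inv K_normal congr_refl) auto
    qed (use A y in auto)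
    hence "closedin T (\<Inter>y\<in>A. {g \<in> carrier G. commut g y \<in> P})" using False by (intro closedin_INT) auto
    moreover have "(\<Inter>y\<in>A. {g \<in> carrier G. commut g y \<in> P}) = {g \<in> carrier G. \<forall>y\<in>A. commut g y \<in> P}"
      using False by auto
    ultimately show ?thesis by simp
  qed
  have commP_inv: "commut y x \<in> P" if "commut x y \<in> P" "x \<in> carrier G" "y \<in> carrier G" for x y
    using Pi[OF that(1)] that(2,3) by (simp add: inv_mult_group m_assoc)
  have base: "commut (f i) (f j) \<in> P" if ij: "i < n" "j < n" for i j
  proof -
    have *: "commut (f i) (f j) \<in> P" if "i < j" "j < n" for i j
    proof -
      have "c (i, j) \<in> D" unfolding D_def by (rule E.sprod_sub_span) (use that cI in \<open>auto simp: I_def\<close>)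
      thus ?thesis using that f by (simp add: c_def P_def)
    qed
    consider "i < j" | "i = j" | "j < i" by linarith
    thus ?thesis
    proof cases
      case 2 
      have "commut (f j) (f j) = \<one>" using f ij by (simp add: m_assoc)
      thus ?thesis using 2 P1 by simp
    qed (use * commP_inv f ij in auto)
  qed
  have "{g \<in> carrier G. \<forall>y\<in>f ` {..<n}. commut g y \<in> P} = carrier G"
    by (rule gen[OF comm_sub comm_closed]) (use f base in auto)
  hence s1: "commut g (f j) \<in> P" if "g \<in> carrier G" "j < n" for g j using that by blast
  have "{g \<in> carrier G. \<forall>y\<in>carrier G. commut g y \<in> P} = carrier G"
    by (rule gen[OF comm_sub comm_closed]) (use f s1 commP_inv in auto)
  hence s2: "commut g h \<in> P" if "g \<in> carrier G" "h \<in> carrier G" for g h using that by blast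
  have "{g \<in> carrier G. g \<otimes> g \<in> P} = carrier G"
  proof (rule gen)
    show "closedin T {g \<in> carrier G. g \<otimes> g \<in> P}"
      by (rule closedin_preimage[OF Pc]) (auto intro!: congr_mult K_normal)
    show "f ` {..<n} \<subseteq> {g \<in> carrier G. g \<otimes> g \<in> P}" using f P1 by auto
    show "subgroup {g \<in> carrier G. g \<otimes> g \<in> P} G"
    proof (rule subgroupI)
      have "\<one> \<in> {g \<in> carrier G. g \<otimes> g \<in> P}" using P1 by simp
      thus "{g \<in> carrier G. g \<otimes> g \<in> P} \<noteq> {}" by blast
      fix a assume a: "a \<in> {g \<in> carrier G. g \<otimes> g \<in> P}"
      have "inv (a \<otimes> a) \<in> P" using a Pi by blast
      thus "inv a \<in> {g \<in> carrier G. g \<otimes> g \<in> P}" using a by (simp add: inv_mult_group)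
      fix b assume b: "b \<in> {g \<in> carrier G. g \<otimes> g \<in> P}"
      have "(a \<otimes> a) \<otimes> commut a (inv b) \<otimes> (b \<otimes> b) \<in> P"
        by (rule Pm[OF Pm]) (use a b s2[of a "inv b"] in auto)
      also have "(a \<otimes> a) \<otimes> commut a (inv b) \<otimes> (b \<otimes> b) = (a \<otimes> b) \<otimes> (a \<otimes> b)"
        using a b by (simp add: m_assoc)
      finally show "a \<otimes> b \<in> {g \<in> carrier G. g \<otimes> g \<in> P}" using a b by simp
    qed auto
  qed
  hence "G2 \<subseteq> P" unfolding G2_def closed_square_def by (intro csg_least[OF sP Pc]) blast
  hence "(\<lambda>z. B #> z) ` G2 \<subseteq> D" by (auto simp: P_def)
  moreover have "D \<subseteq> (\<lambda>z. B #> z) ` G2"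
  proof -
    have img: "subgroup ((\<lambda>z. B #> z) ` G2) Q" by (rule subgroup_image[OF B_normal G2_subgroup])
    have "E.sprod S \<in> (\<lambda>z. B #> z) ` G2" if "S \<subseteq> c ` I" for S
    proof -
      have "finite S" using that finI finite_subset by blast
      thus ?thesis using that
      proof (induction S)
        case empty thus ?case using subgroup.one_closed[OF img] by simp
      next
        case (insert s S)
        have "s \<in> (\<lambda>z. B #> z) ` G2" using insert commut_in_G2 f by (auto simp: c_def I_def)
        moreover have "E.sprod (insert s S) = s <#> E.sprod S"
          using E.sprod_insert[of S s] insert.hyps subset_trans[OF insert.prems cI] by simp
        ultimately show ?case using insert subgroup.m_closed[OF img] by simp
      qed
    qed
    thus ?thesis by (auto simp: D_def)
  qed
  ultimately show "(\<lambda>z. B #> z) ` G2 = E.sprod ` Pow (c ` I)" unfolding D_def by blast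
qed

end

context pro_2_topology
begin

lemma W_elementary:
  assumes WE: "(\<lambda>z. B #> z) ` G2 \<subseteq> carrier E"
  shows "comm_group (G\<lparr>carrier := G2\<rparr> Mod B)" "carrier (G\<lparr>carrier := G2\<rparr> Mod B) = (\<lambda>z. B #> z) ` G2"
    "zassenhaus G T (2 + 1) = B"
proof -
  interpret E: elementary_abelian_2_group E by (rule E_elementary)
  show c: "carrier (G\<lparr>carrier := G2\<rparr> Mod B) = (\<lambda>z. B #> z) ` G2"
    by (auto simp: carrier_FactGroup)
  have sub: "subgroup ((\<lambda>z. B #> z) ` G2) E"
  proof (rule E.subgroupI)
    show "(\<lambda>z. B #> z) ` G2 \<noteq> {}" using subgroup.one_closed[OF G2_subgroup] by blast
    fix a assume a: "a \<in> (\<lambda>z. B #> z) ` G2"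
    show "inv\<^bsub>E\<^esub> a \<in> (\<lambda>z. B #> z) ` G2" using a WE E.inv_self by (metis subsetD)
    fix b assume b: "b \<in> (\<lambda>z. B #> z) ` G2"
    obtain x y where xy: "x \<in> G2" "a = B #> x" "y \<in> G2" "b = B #> y" using a b by blast
    have "a <#> b = B #> (x \<otimes> y)" using xy G2_sub rho_mult by (simp add: subset_iff)
    thus "a \<otimes>\<^bsub>E\<^esub> b \<in> (\<lambda>z. B #> z) ` G2" using xy subgroup.m_closed[OF G2_subgroup] by auto
  qed (rule WE)
  have eq: "G\<lparr>carrier := G2\<rparr> Mod B = E\<lparr>carrier := (\<lambda>z. B #> z) ` G2\<rparr>"
    using c by (simp add: E_def FactGroup_def set_mult_def fun_eq_iff)
  show "comm_group (G\<lparr>carrier := G2\<rparr> Mod B)"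
    unfolding eq
  proof (rule group.group_comm_groupI)
    show "group (E\<lparr>carrier := (\<lambda>z. B #> z) ` G2\<rparr>)" by (rule E.subgroup_imp_group[OF sub])
  qed (use E.m_comm WE in \<open>auto simp: image_subset_iff\<close>)
  show "zassenhaus G T (2 + 1) = B"
  proof (rule zassenhaus_3)
    fix z assume z: "z \<in> G2"
    hence "B #> z \<in> carrier E" using WE by blast
    thus "z \<otimes> z \<in> B" using rho_in_E z G2_sub by blast
  qed
qed

lemma finprod_insert_mult:
  assumes "comm_group C" "finite S" "s \<notin> S" "h \<in> insert s S \<rightarrow> carrier C"
  shows "finprod C h (insert s S) = finprod C h S \<otimes>\<^bsub>C\<^esub> h s"
proof -
  interpret C: comm_group C by fact
  have "finprod C h (insert s S) = h s \<otimes>\<^bsub>C\<^esub> finprod C h S"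
    using assms by (intro C.finprod_insert) auto
  thus ?thesis using assms by (subst C.m_comm) (auto intro!: C.finprod_closed)
qed

text \<open>
  From \<open>(w b)\<^sup>2 = w\<^sup>2 [w, b]\<close> for an involution \<open>b\<close>, by induction on the largest index.  The formula for
  commutators with the generators is carried along because it evaluates \<open>[w, b]\<close>.
\<close>

lemma square_of_product:
  fixes f :: "nat \<Rightarrow> 'a"
  assumes f: "\<And>i. i < n \<Longrightarrow> f i \<in> carrier G" "\<And>i. i < n \<Longrightarrow> f i \<otimes> f i = \<one>"
    and cE: "\<And>i j. i < n \<Longrightarrow> j < n \<Longrightarrow> B #> commut (f i) (f j) \<in> carrier E"
    and S: "finite S" "S \<subseteq> {..<n}"
  shows "\<exists>w\<in>carrier G. G2 #> w = finprod V (\<lambda>i. G2 #> f i) S \<and>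
    B #> (w \<otimes> w) = finprod E (\<lambda>(i, j). B #> commut (f i) (f j)) {(i, j). i \<in> S \<and> j \<in> S \<and> i < j} \<and>
    (\<forall>j<n. B #> commut w (f j) = finprod E (\<lambda>i. B #> commut (f i) (f j)) S)"
  using S
proof (induction rule: finite_linorder_max_induct)
  interpret E: elementary_abelian_2_group E by (rule E_elementary)
  interpret V: elementary_abelian_2_group V by (rule V_elementary)
  case empty
  have "commut \<one> (f j) = \<one>" if "j < n" for j using f that by simp
  moreover have "B #> \<one> = B" "G2 #> \<one> = G2"
    using subgroup.one_closed[OF B_subgroup] rho_one[of \<one>] subgroup.subset[OF G2_subgroup] by auto
  ultimately show ?case by (intro bexI[of _ \<one>]) (simp_all add: E.finprod_empty V.finprod_empty)
next
  interpret E: elementary_abelian_2_group E by (rule E_elementary)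
  interpret V: elementary_abelian_2_group V by (rule V_elementary)
  case (insert b S)
  have b: "b < n" "b \<notin> S" and Sn: "S \<subseteq> {..<n}" using insert by auto
  from insert.IH[OF Sn] obtain w where w: "w \<in> carrier G" "G2 #> w = finprod V (\<lambda>i. G2 #> f i) S"
    "B #> (w \<otimes> w) = finprod E (\<lambda>(i, j). B #> commut (f i) (f j)) {(i, j). i \<in> S \<and> j \<in> S \<and> i < j}"
    "\<And>j. j < n \<Longrightarrow> B #> commut w (f j) = finprod E (\<lambda>i. B #> commut (f i) (f j)) S" by blast
  have fb: "f b \<in> carrier G" "f b \<otimes> f b = \<one>" "inv (f b) = f b" using f b inv_equality by auto
  have mV: "G2 #> f i \<in> carrier V" if "i < n" for i using f that by (auto simp: carrier_FactGroup)
  have wE: "B #> commut w (f j) \<in> carrier E" if "j < n" for j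
    unfolding w(4)[OF that] using cE that Sn by (intro E.finprod_closed) auto
  show ?case
  proof (intro bexI[of _ "w \<otimes> f b"] conjI allI impI)
    show "w \<otimes> f b \<in> carrier G" using w fb by simp
    have "finprod V (\<lambda>i. G2 #> f i) (insert b S) = finprod V (\<lambda>i. G2 #> f i) S \<otimes>\<^bsub>V\<^esub> (G2 #> f b)"
      by (rule finprod_insert_mult) (use V.comm_group_axioms insert.hyps b Sn mV in auto)
    also have "\<dots> = G2 #> (w \<otimes> f b)" unfolding w(2)[symmetric]
      using normal.rcos_sum[OF G2_normal w(1) fb(1)] by simp
    finally show "G2 #> (w \<otimes> f b) = finprod V (\<lambda>i. G2 #> f i) (insert b S)" by simp
    show "B #> commut (w \<otimes> f b) (f j) = finprod E (\<lambda>i. B #> commut (f i) (f j)) (insert b S)" if j: "j < n" for j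
    proof -
      have "finprod E (\<lambda>i. B #> commut (f i) (f j)) (insert b S) = finprod E (\<lambda>i. B #> commut (f i) (f j)) S \<otimes>\<^bsub>E\<^esub> (B #> commut (f b) (f j))"
        by (rule finprod_insert_mult) (use E.comm_group_axioms insert.hyps b Sn cE j in auto)
      also have "\<dots> = B #> commut (w \<otimes> f b) (f j)"
        unfolding w(4)[OF j, symmetric] E_mult using rho_commut_mult[OF w(1) fb(1) _ wE[OF j]] f j by simp
      finally show ?thesis by simp
    qed
    let ?c = "\<lambda>(i, j). B #> commut (f i) (f j)"
    let ?I = "{(i, j). i \<in> S \<and> j \<in> S \<and> i < j}"
    have finI: "finite ?I" by (rule finite_subset[of _ "S \<times> S"]) (use insert in auto)
    have I: "{(i, j). i \<in> insert b S \<and> j \<in> insert b S \<and> i < j} = ?I \<union> (\<lambda>i. (i, b)) ` S"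
      using insert.hyps(2) by (auto dest: order.asym)
    have sq: "(w \<otimes> f b) \<otimes> (w \<otimes> f b) = (w \<otimes> w) \<otimes> commut w (f b)"
      using w(1) fb by (simp add: m_assoc)
    have "finprod E ?c (?I \<union> (\<lambda>i. (i, b)) ` S) = finprod E ?c ?I \<otimes>\<^bsub>E\<^esub> finprod E ?c ((\<lambda>i. (i, b)) ` S)"
      by (rule E.finprod_Un_disjoint) (use finI insert.hyps b Sn cE in auto)
    also have "finprod E ?c ((\<lambda>i. (i, b)) ` S) = finprod E (\<lambda>i. ?c (i, b)) S"
      by (rule E.finprod_reindex) (use b Sn cE in \<open>auto simp: inj_on_def\<close>)
    also have "finprod E (\<lambda>i. ?c (i, b)) S = B #> commut w (f b)" using w(4)[OF b(1)] by simp
    finally show "B #> (w \<otimes> f b \<otimes> (w \<otimes> f b)) = finprod E ?c {(i, j). i \<in> insert b S \<and> j \<in> insert b S \<and> i < j}"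
      unfolding I sq using rho_mult[of "w \<otimes> w" "commut w (f b)"] w(1,3) fb(1) by simp
  qed
qed

text \<open>
  The two dimensions are attained only if the commutators of a basis \<open>Y\<close> taken from \<open>J\<close> are independent
  modulo the third term.  An element of \<open>J\<close> is congruent to a product of members of \<open>Y\<close>, and being an
  involution it makes the product of their pairwise commutators trivial; so only one member of \<open>Y\<close>
  occurs.
\<close>

theorem involutions_basis:
  assumes J: "J \<subseteq> carrier G" "\<And>x. x \<in> J \<Longrightarrow> x \<otimes> x = \<one>"
    and miss: "\<And>M. index_two G M \<Longrightarrow> closedin T M \<Longrightarrow> \<exists>x\<in>J. x \<notin> M"
    and nontriv: "\<And>x. x \<in> J \<Longrightarrow> \<exists>M. index_two G M \<and> closedin T M \<and> x \<notin> M"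
    and sep: "\<And>x y. x \<in> J \<Longrightarrow> y \<in> J \<Longrightarrow> x \<noteq> y \<Longrightarrow> \<exists>M. index_two G M \<and> closedin T M \<and> (x \<in> M) \<noteq> (y \<in> M)"
    and c1: "zassenhaus_dim G T 1 = enat (d + 1)"
    and c2: "zassenhaus_dim G T 2 = enat (d * (d + 1) div 2)"
  shows "finite J \<and> card J = d + 1 \<and> (\<forall>x\<in>J. \<exists>M. index_two G M \<and> closedin T M \<and> J - {x} \<subseteq> M)"
proof -
  interpret E: elementary_abelian_2_group E by (rule E_elementary)
  interpret V: elementary_abelian_2_group V by (rule V_elementary)
  let ?\<pi> = "\<lambda>x. G2 #> x"
  have "F2_dim V = enat (d + 1)"
    using c1 zassenhaus_1 zassenhaus_2 by (simp add: zassenhaus_dim_def numeral_2_eq_2)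
  hence V: "finite (carrier V)" "card (carrier V) = 2 ^ (d + 1)"
    using F2_dim_card[OF V.comm_group_axioms] by auto
  have JV: "?\<pi> ` J \<subseteq> carrier V" using J(1) by (auto simp: carrier_FactGroup)
  have same: "x \<in> M \<longleftrightarrow> y \<in> M" if xy: "x \<in> carrier G" "y \<in> carrier G" "?\<pi> x = ?\<pi> y" and M: "index_two G M" "closedin T M" for x y M
  proof -
    have sM: "subgroup M G" using M by (simp add: index_two_def)
    have *: "b \<in> M" if ab: "a \<in> carrier G" "b \<in> carrier G" "?\<pi> a = ?\<pi> b" "a \<in> M" for a b
    proof -
      have "b \<in> G2 #> a" using rcos_self[OF ab(2) G2_subgroup] ab(3) by simp
      then obtain z where "z \<in> G2" "b = z \<otimes> a" by (auto simp: r_coset_def)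
      thus ?thesis using closed_index_two_G2[OF M] ab(4) by (auto intro: subgroup.m_closed[OF sM])
    qed
    show ?thesis using *[of x y] *[of y x] xy by auto
  qed
  have injJ: "inj_on ?\<pi> J"
  proof (rule inj_onI, rule ccontr)
    fix x y assume xy: "x \<in> J" "y \<in> J" "?\<pi> x = ?\<pi> y" "x \<noteq> y"
    show False using sep[OF xy(1,2,4)] same[OF _ _ xy(3)] xy J(1) by blast
  qed
  have genV: "U = carrier V" if "subgroup U V" "?\<pi> ` J \<subseteq> U" for U
    using generates_V[OF J(1) miss V(1)] that by blast
  obtain Y where Y: "Y \<subseteq> ?\<pi> ` J" "V.indep Y" "V.sprod ` Pow Y = carrier V"
    using V.basis_from_generators[OF V(1) JV genV] by metis
  have finY: "finite Y" using Y by (simp add: V.indep_def)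
  have "2 ^ (d + 1) = (2::nat) ^ card Y" using V.card_indep[OF Y(2,3)] V(2) by simp
  hence cardY: "card Y = d + 1" using power_inject_exp[of "2::nat" "d + 1" "card Y"] by linarith
  define n where "n = d + 1"
  obtain h where h: "bij_betw h {..<n} Y"
    using finY cardY by (metis ex_bij_betw_nat_finite lessThan_atLeast0 n_def)
  define f where "f i = (SOME x. x \<in> J \<and> ?\<pi> x = h i)" for i
  have fJ: "f i \<in> J \<and> ?\<pi> (f i) = h i" if "i < n" for i
  proof -
    have "h i \<in> ?\<pi> ` J" using h Y(1) that by (auto simp: bij_betw_def)
    then obtain x where "x \<in> J \<and> ?\<pi> x = h i" by auto
    thus ?thesis unfolding f_def by (rule someI)
  qed
  have f: "f i \<in> carrier G" "f i \<otimes> f i = \<one>" if "i < n" for i using fJ[OF that] J by auto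
  have gen: "H = carrier G" if H: "subgroup H G" "closedin T H" "f ` {..<n} \<subseteq> H" for H
  proof (rule frattini[OF H(1,2)])
    fix U assume U: "subgroup U V" "?\<pi> ` H \<subseteq> U"
    have "Y \<subseteq> U"
    proof
      fix y assume "y \<in> Y"
      then obtain i where "i < n" "y = h i" using h by (auto simp: bij_betw_def)
      thus "y \<in> U" using fJ[of i] H(3) U(2) by auto
    qed
    have "V.sprod S \<in> U" if "S \<subseteq> Y" for S
    proof -
      have "finite S" using that finY finite_subset by blast
      thus ?thesis using that
      proof (induction S)
        case empty thus ?case using subgroup.one_closed[OF U(1)] by simp
      next
        case (insert s S)
        have "insert s S \<subseteq> carrier V" using insert.prems Y(2) by (auto simp: V.indep_def)
        hence "V.sprod (insert s S) = s \<otimes>\<^bsub>V\<^esub> V.sprod S" using V.sprod_insert insert.hyps by blast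
        thus ?case using insert \<open>Y \<subseteq> U\<close> subgroup.m_closed[OF U(1)] by auto
      qed
    qed
    hence "carrier V \<subseteq> U" using Y(3) by (metis PowD image_subsetI)
    thus "U = carrier V" using subgroup.subset[OF U(1)] by blast
  qed
  let ?c = "\<lambda>(i, j). B #> commut (f i) (f j)"
  define I where "I = {(i::nat, j). i < j \<and> j < n}"
  have cI: "?c ` I \<subseteq> carrier E" and W: "(\<lambda>z. B #> z) ` G2 = E.sprod ` Pow (?c ` I)"
    unfolding I_def by (rule rho_G2[OF f gen], assumption+)+
  have finI: "finite I" by (rule finite_subset[of _ "{..<n} \<times> {..<n}"]) (auto simp: I_def)
  have cardI: "card I = d * (d + 1) div 2"
  proof -
    have "I = (\<Union>j\<in>{..<n}. (\<lambda>i. (i, j)) ` {..<j})" by (auto simp: I_def)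
    also have "card \<dots> = (\<Sum>j<n. card ((\<lambda>i. (i, j)) ` {..<j}))"
      by (rule card_UN_disjoint) auto
    also have "\<dots> = (\<Sum>j<n. j)" by (intro sum.cong refl) (simp add: card_image inj_on_def)
    also have "\<dots> = d * (d + 1) div 2"
      unfolding n_def using gauss_sum_nat[of d] by (simp add: lessThan_Suc_atMost atMost_atLeast0)
    finally show ?thesis .
  qed
  have WE: "(\<lambda>z. B #> z) ` G2 \<subseteq> carrier E"
  proof -
    have "E.sprod S \<in> carrier E" if "S \<subseteq> ?c ` I" for S
      by (rule E.sprod_closed) (rule subset_trans[OF that cI])
    thus ?thesis unfolding W by (simp add: image_subset_iff)
  qed
  note We = W_elementary[OF WE]
  have "F2_dim (G\<lparr>carrier := G2\<rparr> Mod B) = enat (d * (d + 1) div 2)"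
    using c2 We(3) zassenhaus_2 by (simp add: zassenhaus_dim_def)
  hence "card (E.sprod ` Pow (?c ` I)) = 2 ^ card I"
    using F2_dim_card[OF We(1)] We(2) W cardI by simp
  moreover have "card (E.sprod ` Pow (?c ` I)) \<le> card (Pow (?c ` I))" using finI by (intro card_image_le) simp
  moreover have "card (Pow (?c ` I)) = 2 ^ card (?c ` I)" using finI by (simp add: card_Pow)
  moreover have le: "card (?c ` I) \<le> card I" using finI by (rule card_image_le)
  moreover have "2 ^ card (?c ` I) \<le> (2::nat) ^ card I" using le by simp
  ultimately have eq: "card (E.sprod ` Pow (?c ` I)) = card (Pow (?c ` I))" "2 ^ card (?c ` I) = (2::nat) ^ card I"
    by linarith+
  have "card (?c ` I) = card I" using eq(2) power_inject_exp[of "2::nat"] by simp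
  hence injc: "inj_on ?c I" using finI eq_card_imp_inj_on by blast
  have "inj_on E.sprod (Pow (?c ` I))" using eq(1) finI by (intro eq_card_imp_inj_on) auto
  hence indc: "E.indep (?c ` I)" by (rule E.inj_indep) (use finI cI in auto)
  have cE: "B #> commut (f i) (f j) \<in> carrier E" if "i < n" "j < n" for i j
    using WE commut_in_G2[OF f(1)[OF that(1)] f(1)[OF that(2)]] by (simp add: image_subset_iff)
  have JY: "?\<pi> x \<in> Y" if x: "x \<in> J" for x
  proof -
    have xG: "x \<in> carrier G" using x J(1) by blast
    have "?\<pi> x \<in> carrier V" using JV x by blast
    then obtain S' where S': "S' \<subseteq> Y" "?\<pi> x = V.sprod S'" using Y(3) by (metis PowD imageE)
    define S where "S = {i. i < n \<and> h i \<in> S'}"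
    have S: "finite S" "S \<subseteq> {..<n}" by (auto simp: S_def)
    have hS: "h ` S = S'" using h S'(1) by (auto simp: S_def bij_betw_def image_iff)
    have "finprod V (\<lambda>i. ?\<pi> (f i)) S = finprod V h S"
    proof (rule V.finprod_cong')
      show "h \<in> S \<rightarrow> carrier V"
      proof
        fix i assume "i \<in> S"
        hence "?\<pi> (f i) = h i" "f i \<in> J" using fJ S(2) by auto
        thus "h i \<in> carrier V" using JV by (metis image_subset_iff)
      qed
    qed (use fJ S(2) in auto)
    also have "\<dots> = V.sprod S'" unfolding hS[symmetric]
    proof (rule V.finprod_reindex[symmetric])
      show "inj_on h S" using h S(2) by (meson bij_betw_def inj_on_subset)
      show "(\<lambda>v. v) \<in> h ` S \<rightarrow> carrier V" using hS S'(1) Y(2) by (auto simp: V.indep_def)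
    qed
    finally have prodS: "finprod V (\<lambda>i. ?\<pi> (f i)) S = ?\<pi> x" using S'(2) by simp
    obtain w where w: "w \<in> carrier G" "?\<pi> w = ?\<pi> x"
      "B #> (w \<otimes> w) = finprod E ?c {(i, j). i \<in> S \<and> j \<in> S \<and> i < j}"
      using square_of_product[of n f S, OF f cE S] prodS by auto
    let ?I = "{(i, j). i \<in> S \<and> j \<in> S \<and> i < j}"
    have II: "?I \<subseteq> I" using S(2) by (auto simp: I_def)
    have "x \<in> G2 #> w" using rcos_self[OF xG G2_subgroup] w(2) by simp
    then obtain z where z: "z \<in> G2" "x = z \<otimes> w" by (auto simp: r_coset_def)
    have zG: "z \<in> carrier G" using z G2_sub by blast
    have zE: "B #> z \<in> carrier E" using WE z by blast
    have "B #> \<one> = B #> (z \<otimes> (w \<otimes> z) \<otimes> w)"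
      using J(2)[OF x] z(2) zG w(1) by (simp add: m_assoc)
    also have "\<dots> = (B #> z) <#> (B #> (w \<otimes> z)) <#> (B #> w)" using zG w(1) by (simp add: rho_mult)
    also have "B #> (w \<otimes> z) = B #> (z \<otimes> w)" using rho_G2_central[OF z(1) w(1)] by simp
    also have "(B #> z) <#> (B #> (z \<otimes> w)) <#> (B #> w) = B #> ((z \<otimes> z) \<otimes> (w \<otimes> w))"
      using zG w(1) by (simp add: rho_mult m_assoc)
    also have "\<dots> = B #> (w \<otimes> w)" using zE rho_in_E[OF zG] w(1) by (intro rho_absorb) auto
    finally have "finprod E ?c ?I = B"
      using w(3) subgroup.one_closed[OF B_subgroup] rho_one[of \<one>] by simp
    moreover have "finprod E ?c ?I = E.sprod (?c ` ?I)"
      by (rule E.finprod_reindex[symmetric]) (use cI II injc inj_on_subset in blast)+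
    ultimately have "?c ` ?I = {}" using indc II unfolding E.indep_def by (metis (no_types, lifting) E_one image_mono)
    hence I0: "?I = {}" by blast
    have "card S \<le> 1"
    proof (rule ccontr)
      assume "\<not> card S \<le> 1"
      then obtain i j where "i \<in> S" "j \<in> S" "i \<noteq> j" using card_le_Suc0_iff_eq[OF S(1)] by auto
      hence "(i, j) \<in> ?I \<or> (j, i) \<in> ?I" using nat_neq_iff by simp
      thus False using I0 by blast
    qed
    moreover have "S \<noteq> {}"
    proof
      assume "S = {}"
      hence "?\<pi> x = ?\<pi> \<one>" using prodS subgroup.subset[OF G2_subgroup] by simp
      moreover obtain M where M: "index_two G M" "closedin T M" "x \<notin> M" using nontriv[OF x] by blast
      ultimately show False using same[OF xG one_closed _ M(1,2)] M subgroup.one_closed by (auto simp: index_two_def)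
    qed
    ultimately obtain i where i: "S = {i}" using S(1) by (metis One_nat_def card_0_eq card_1_singletonE le_Suc_eq le_zero_eq)
    hence "h i \<in> Y" using S(2) h by (auto simp: bij_betw_def)
    moreover have "?\<pi> x = h i"
    proof -
      have "?\<pi> (f i) = h i" "f i \<in> J" using fJ S(2) i by auto
      hence ii: "?\<pi> (f i) = h i" "?\<pi> (f i) \<in> carrier V" using JV by (metis, blast)
      have "finprod V (\<lambda>i. ?\<pi> (f i)) {i} = ?\<pi> (f i) \<otimes>\<^bsub>V\<^esub> finprod V (\<lambda>i. ?\<pi> (f i)) {}"
        using ii by (intro V.finprod_insert) auto
      also have "\<dots> = ?\<pi> (f i)" using ii V.r_one[of "?\<pi> (f i)"] by (simp del: mult_FactGroup one_FactGroup)
      finally show ?thesis using prodS i ii by simp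
    qed
    ultimately show ?thesis by simp
  qed
  hence bijJ: "bij_betw ?\<pi> J Y" using injJ Y(1) by (auto simp: bij_betw_def)
  have "finite J \<and> card J = d + 1"
    using bij_betw_finite[OF bijJ] bij_betw_same_card[OF bijJ] finY cardY by simp
  moreover have "\<exists>M. index_two G M \<and> closedin T M \<and> J - {x} \<subseteq> M" if x: "x \<in> J" for x
  proof -
    define U where "U = V.sprod ` Pow (Y - {?\<pi> x})"
    have YV: "Y \<subseteq> carrier V" using Y(2) by (simp add: V.indep_def)
    have U: "subgroup U V" unfolding U_def by (rule V.subgroup_span) (use finY YV in auto)
    have nU: "?\<pi> x \<notin> U"
    proof
      assume "?\<pi> x \<in> U"
      then obtain S where S: "S \<subseteq> Y - {?\<pi> x}" "?\<pi> x = V.sprod S" by (auto simp: U_def)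
      have "?\<pi> x \<in> carrier V" using JV x by blast
      hence "V.sprod {?\<pi> x} = ?\<pi> x" using V.sprod_insert[of "{}" "?\<pi> x"] V.r_one[of "?\<pi> x"]
        by (simp del: mult_FactGroup one_FactGroup)
      hence "S = {?\<pi> x}" using S JY[OF x] by (intro inj_onD[OF V.indep_inj[OF Y(2)]]) auto
      thus False using S(1) by blast
    qed
    let ?U = "{y \<in> carrier G. ?\<pi> y \<in> U}"
    have "closedin T ?U" by (rule closedin_finite_cosets[OF G2_normal G2_closed])
       (use subgroup.subset[OF U] V(1) finite_subset in auto)
    moreover have "subgroup ?U G" by (rule subgroup_preimage[OF G2_normal U])
    moreover have "?U \<noteq> carrier G" using nU x J(1) by blast
    ultimately obtain M where M: "index_two G M" "closedin T M" "?U \<subseteq> M"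
      using closed_subgroup_index_two by blast
    have "J - {x} \<subseteq> ?U"
    proof
      fix y assume y: "y \<in> J - {x}"
      hence "?\<pi> y \<in> Y - {?\<pi> x}" using JY inj_onD[OF injJ] x by auto
      hence "?\<pi> y \<in> U" unfolding U_def using YV by (intro V.sprod_sub_span) auto
      thus "y \<in> ?U" using y J(1) by blast
    qed
    thus ?thesis using M by blast
  qed
  ultimately show ?thesis by blast
qed

end

section \<open>Subfields and square roots\<close>

locale subfield_of =
  fixes E :: "'k::field set"
  assumes one: "1 \<in> E" and add: "x \<in> E \<Longrightarrow> y \<in> E \<Longrightarrow> x + y \<in> E"
    and neg: "x \<in> E \<Longrightarrow> - x \<in> E" and mult: "x \<in> E \<Longrightarrow> y \<in> E \<Longrightarrow> x * y \<in> E"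
    and inv: "x \<in> E \<Longrightarrow> inverse x \<in> E"
begin

lemma zero: "0 \<in> E" using add[OF one neg[OF one]] by simp
lemma diff: "x \<in> E \<Longrightarrow> y \<in> E \<Longrightarrow> x - y \<in> E" using add[OF _ neg, of x y] by simp
lemma div: "x \<in> E \<Longrightarrow> y \<in> E \<Longrightarrow> x / y \<in> E" using mult[OF _ inv, of x y] by (simp add: divide_inverse)
lemma two: "2 \<in> E" using add[OF one one] by simp
lemma sum: "(\<And>i. i \<in> I \<Longrightarrow> f i \<in> E) \<Longrightarrow> sum f I \<in> E"
  by (induction I rule: infinite_finite_induct) (auto intro: zero add)
lemma power: "x \<in> E \<Longrightarrow> x ^ n \<in> E" by (induction n) (auto intro: one mult)

lemmas closed = zero one add neg mult inv diff div two power

end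

lemma subfield_UNIV: "subfield_of UNIV" by unfold_locales auto

lemma subfield_Inter: "(\<And>E. E \<in> S \<Longrightarrow> subfield_of E) \<Longrightarrow> subfield_of (\<Inter>S)"
  by unfold_locales (auto simp: subfield_of_def)

lemma subfield_chain_Union:
  assumes "C \<noteq> {}" "\<And>E. E \<in> C \<Longrightarrow> subfield_of E" "\<And>E E'. E \<in> C \<Longrightarrow> E' \<in> C \<Longrightarrow> E \<subseteq> E' \<or> E' \<subseteq> E"
  shows "subfield_of (\<Union>C)"
proof unfold_locales
  have two: "\<exists>E\<in>C. x \<in> E \<and> y \<in> E" if "x \<in> \<Union>C" "y \<in> \<Union>C" for x y
    using that assms(3) by (meson UnionE subsetD)
  show "1 \<in> \<Union>C" using assms(1,2) subfield_of.one by blast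
  show "- x \<in> \<Union>C" if "x \<in> \<Union>C" for x using that assms(2) subfield_of.neg by blast
  show "inverse x \<in> \<Union>C" if "x \<in> \<Union>C" for x using that assms(2) subfield_of.inv by blast
  show "x + y \<in> \<Union>C" if "x \<in> \<Union>C" "y \<in> \<Union>C" for x y
    using two[OF that] assms(2) subfield_of.add by blast
  show "x * y \<in> \<Union>C" if "x \<in> \<Union>C" "y \<in> \<Union>C" for x y
    using two[OF that] assms(2) subfield_of.mult by blast
qed

lemma (in subfield_of) anisotropic:
  assumes real: "\<forall>x\<in>E. x * x \<noteq> - 1" and xy: "x \<in> E" "y \<in> E" "x * x + y * y = 0"
  shows "x = 0 \<and> y = 0"
proof (rule ccontr)
  assume "\<not> ?thesis"
  hence "y \<noteq> 0" using xy by auto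
  moreover have "x * x = - (y * y)" using xy(3) by (simp add: eq_neg_iff_add_eq_0)
  ultimately have "(x / y) * (x / y) = - 1" by simp
  thus False using real div[OF xy(1,2)] by blast
qed

lemma square_eq_cases: "x * x = y * y \<Longrightarrow> x = y \<or> x = - y" for x y :: "'k::field"
  using square_eq_iff by blast

definition adjoin :: "'k::field set \<Rightarrow> 'k \<Rightarrow> 'k set" where
  "adjoin R s = {x + y * s | x y. x \<in> R \<and> y \<in> R}"

context subfield_of
begin

lemma adjoin_unique:
  assumes "s \<notin> E" "x \<in> E" "y \<in> E" "x + y * s = 0" shows "x = 0 \<and> y = 0"
proof (rule ccontr)
  assume n: "\<not> ?thesis"
  have "y \<noteq> 0" using n assms by auto
  moreover have "y * s = - x" using assms(4) by (simp add: add_eq_0_iff)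
  ultimately have "s = - x / y" by (simp add: field_simps)
  thus False using assms closed by metis
qed

lemma adjoin_norm:
  assumes "s \<notin> E" "x \<in> E" "y \<in> E" "x + y * s \<noteq> 0" shows "x * x - s * s * (y * y) \<noteq> 0"
proof
  assume "x * x - s * s * (y * y) = 0"
  hence "x * x = (y * s) * (y * s)" by (simp add: algebra_simps)
  hence "x = y * s \<or> x = - (y * s)" by (rule square_eq_cases)
  hence "x + (- y) * s = 0 \<or> x + y * s = 0" by auto
  thus False using adjoin_unique[of s x "- y"] adjoin_unique[of s x y] assms neg by force
qed

lemma adjoin_subfield:
  assumes "s \<notin> E" "s * s \<in> E" shows "subfield_of (adjoin E s)"
proof unfold_locales
  show "1 \<in> adjoin E s" unfolding adjoin_def using one zero by force
  show "a + b \<in> adjoin E s" if ab: "a \<in> adjoin E s" "b \<in> adjoin E s" for a b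
  proof -
    obtain x y u v where h: "a = x + y * s" "x \<in> E" "y \<in> E" "b = u + v * s" "u \<in> E" "v \<in> E"
      using ab unfolding adjoin_def by blast
    have "a + b = (x + u) + (y + v) * s" using h by (simp add: algebra_simps)
    thus ?thesis unfolding adjoin_def using h add by blast
  qed
  show "a * b \<in> adjoin E s" if ab: "a \<in> adjoin E s" "b \<in> adjoin E s" for a b
  proof -
    obtain x y u v where h: "a = x + y * s" "x \<in> E" "y \<in> E" "b = u + v * s" "u \<in> E" "v \<in> E"
      using ab unfolding adjoin_def by blast
    have "a * b = (x * u + y * v * (s * s)) + (x * v + y * u) * s" using h by (simp add: algebra_simps)
    moreover have "x * u + y * v * (s * s) \<in> E" "x * v + y * u \<in> E" using h assms by (auto intro!: add mult)
    ultimately show ?thesis unfolding adjoin_def by blast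
  qed
  show "- a \<in> adjoin E s" if a: "a \<in> adjoin E s" for a
  proof -
    obtain x y where h: "a = x + y * s" "x \<in> E" "y \<in> E" using a unfolding adjoin_def by blast
    have "- a = (- x) + (- y) * s" using h by (simp add: algebra_simps)
    thus ?thesis unfolding adjoin_def using h neg by blast
  qed
  show "inverse a \<in> adjoin E s" if a: "a \<in> adjoin E s" for a
  proof (cases "a = 0")
    case True thus ?thesis using a by simp
  next
    case False
    obtain x y where h: "a = x + y * s" "x \<in> E" "y \<in> E" using a unfolding adjoin_def by blast
    let ?N = "x * x - s * s * (y * y)"
    have N: "?N \<noteq> 0" using adjoin_norm[OF assms(1)] h False by blast
    have "a * (x / ?N + (- y / ?N) * s) = ?N / ?N"
    proof -
      have "a * (x * inverse ?N + (- y * inverse ?N) * s) = ?N * inverse ?N" unfolding h(1) by (simp add: algebra_simps)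
      thus ?thesis by (simp only: divide_inverse)
    qed
    hence "inverse a = x / ?N + (- y / ?N) * s" using N by (simp add: inverse_unique)
    moreover have "?N \<in> E" by (rule diff[OF mult[OF h(2) h(2)] mult[OF assms(2) mult[OF h(3) h(3)]]])
    ultimately show ?thesis unfolding adjoin_def using h div neg by blast
  qed
qed

lemma sub_adjoin: "E \<subseteq> adjoin E s" "s \<in> adjoin E s"
  unfolding adjoin_def using zero one by force+

end

section \<open>The quadratic closure\<close>

text \<open>
  Homomorphisms between subfields are handled as graphs, that is, as subfields of the product ring that
  are single-valued.  Ordered by inclusion they suit Zorn's lemma, and a single-valued graph is
  automatically injective.
\<close>

definition hom_graph :: "('k::field \<times> 'k) set \<Rightarrow> bool" where
  "hom_graph A \<longleftrightarrow> (1, 1) \<in> A \<and>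
     (\<forall>a b c d. (a, b) \<in> A \<longrightarrow> (c, d) \<in> A \<longrightarrow> (a + c, b + d) \<in> A \<and> (a * c, b * d) \<in> A) \<and>
     (\<forall>a b. (a, b) \<in> A \<longrightarrow> (- a, - b) \<in> A \<and> (inverse a, inverse b) \<in> A) \<and>
     (\<forall>b. (0, b) \<in> A \<longrightarrow> b = 0)"

lemma hom_graphD:
  assumes "hom_graph A"
  shows "(1, 1) \<in> A" "(0, 0) \<in> A"
    "(a, b) \<in> A \<Longrightarrow> (c, d) \<in> A \<Longrightarrow> (a + c, b + d) \<in> A" "(a, b) \<in> A \<Longrightarrow> (c, d) \<in> A \<Longrightarrow> (a * c, b * d) \<in> A"
    "(a, b) \<in> A \<Longrightarrow> (- a, - b) \<in> A" "(a, b) \<in> A \<Longrightarrow> (inverse a, inverse b) \<in> A"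
    "(a, b) \<in> A \<Longrightarrow> (c, d) \<in> A \<Longrightarrow> (a - c, b - d) \<in> A"
    "(a, b) \<in> A \<Longrightarrow> (a, c) \<in> A \<Longrightarrow> b = c" "(a, b) \<in> A \<Longrightarrow> (c, b) \<in> A \<Longrightarrow> a = c"
proof -
  have 1: "(1, 1) \<in> A" and p: "\<And>a b c d. (a, b) \<in> A \<Longrightarrow> (c, d) \<in> A \<Longrightarrow> (a + c, b + d) \<in> A"
    and t: "\<And>a b c d. (a, b) \<in> A \<Longrightarrow> (c, d) \<in> A \<Longrightarrow> (a * c, b * d) \<in> A"
    and n: "\<And>a b. (a, b) \<in> A \<Longrightarrow> (- a, - b) \<in> A" and i: "\<And>a b. (a, b) \<in> A \<Longrightarrow> (inverse a, inverse b) \<in> A"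
    and z: "\<And>b. (0, b) \<in> A \<Longrightarrow> b = 0"
    using assms unfolding hom_graph_def by blast+
  have m: "(a - c, b - d) \<in> A" if "(a, b) \<in> A" "(c, d) \<in> A" for a b c d using p[OF that(1) n[OF that(2)]] by simp
  show "(1, 1) \<in> A" "(0, 0) \<in> A" using 1 m[OF 1 1] by auto
  show "(a, b) \<in> A \<Longrightarrow> (c, d) \<in> A \<Longrightarrow> (a + c, b + d) \<in> A" "(a, b) \<in> A \<Longrightarrow> (c, d) \<in> A \<Longrightarrow> (a * c, b * d) \<in> A"
    "(a, b) \<in> A \<Longrightarrow> (- a, - b) \<in> A" "(a, b) \<in> A \<Longrightarrow> (inverse a, inverse b) \<in> A"
    "(a, b) \<in> A \<Longrightarrow> (c, d) \<in> A \<Longrightarrow> (a - c, b - d) \<in> A" by (fact p t n i m)+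
  show "b = c" if "(a, b) \<in> A" "(a, c) \<in> A" using z[of "b - c"] m[OF that] by simp
  show "a = c" if ac: "(a, b) \<in> A" "(c, b) \<in> A"
  proof (rule ccontr)
    assume "a \<noteq> c"
    have "(a - c, 0) \<in> A" using m[OF ac] by simp
    from t[OF this i[OF this]] have "(1, 0) \<in> A" using \<open>a \<noteq> c\<close> by simp
    from m[OF 1 this] have "(0, 1) \<in> A" by simp
    thus False using z by force
  qed
qed

lemma hom_graph_subfields:
  assumes "hom_graph A" shows "subfield_of (Domain A)" "subfield_of (Range A)"
proof -
  note D = hom_graphD[OF assms]
  show "subfield_of (Domain A)"
    by unfold_locales (auto intro: D(1) D(3) D(4) D(5) D(6) Domain.intros)
  show "subfield_of (Range A)"
    by unfold_locales (auto intro: D(1) D(3) D(4) D(5) D(6) Range.intros)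
qed

lemma hom_graph_Id: "subfield_of T \<Longrightarrow> hom_graph (Id_on T)"
  unfolding hom_graph_def by (auto intro: subfield_of.closed)

definition adjoin_graph :: "('k::field \<times> 'k) set \<Rightarrow> 'k \<Rightarrow> 'k \<Rightarrow> ('k \<times> 'k) set" where
  "adjoin_graph A s s' = {(x + y * s, x' + y' * s') | x x' y y'. (x, x') \<in> A \<and> (y, y') \<in> A}"

lemma hom_graph_adjoin:
  assumes A: "hom_graph A" and s: "(s * s, s' * s') \<in> A" "s \<notin> Domain A"
  shows "hom_graph (adjoin_graph A s s')" "A \<subseteq> adjoin_graph A s s'" "(s, s') \<in> adjoin_graph A s s'"
proof -
  note D = hom_graphD[OF A]
  interpret D: subfield_of "Domain A" using hom_graph_subfields A by blast
  have I: "(x + y * s, x' + y' * s') \<in> adjoin_graph A s s'" if "(x, x') \<in> A" "(y, y') \<in> A" for x x' y y'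
    unfolding adjoin_graph_def using that by blast
  have Iff: "(a, b) \<in> adjoin_graph A s s' \<longleftrightarrow> (\<exists>x x' y y'. a = x + y * s \<and> b = x' + y' * s' \<and> (x, x') \<in> A \<and> (y, y') \<in> A)" for a b
    unfolding adjoin_graph_def by blast
  have z: "x = 0 \<and> y = 0 \<and> x' = 0 \<and> y' = 0" if h: "(x, x') \<in> A" "(y, y') \<in> A" "x + y * s = 0" for x y x' y'
  proof -
    have "x = 0 \<and> y = 0" using D.adjoin_unique[OF s(2)] h by blast
    thus ?thesis using h D(2) D(8) by blast
  qed
  show "A \<subseteq> adjoin_graph A s s'"
  proof
    fix p assume "p \<in> A"
    thus "p \<in> adjoin_graph A s s'" using I[OF _ D(2), of "fst p" "snd p"] by simp
  qed
  show "(s, s') \<in> adjoin_graph A s s'" using I[OF D(2) D(1)] by simp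
  show "hom_graph (adjoin_graph A s s')" unfolding hom_graph_def
  proof (intro conjI allI impI)
    show "(1, 1) \<in> adjoin_graph A s s'" using I[OF D(1) D(2)] by simp
    show "b = 0" if "(0, b) \<in> adjoin_graph A s s'" for b using that z unfolding Iff by fastforce
  next
    fix a b c d assume ab: "(a, b) \<in> adjoin_graph A s s'" and cd: "(c, d) \<in> adjoin_graph A s s'"
    obtain x x' y y' where h: "a = x + y * s" "b = x' + y' * s'" "(x, x') \<in> A" "(y, y') \<in> A" using ab unfolding Iff by blast
    obtain u u' v v' where g: "c = u + v * s" "d = u' + v' * s'" "(u, u') \<in> A" "(v, v') \<in> A" using cd unfolding Iff by blast
    have "((x + u) + (y + v) * s, (x' + u') + (y' + v') * s') \<in> adjoin_graph A s s'" using h g by (intro I D(3))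
    thus "(a + c, b + d) \<in> adjoin_graph A s s'" using h g by (simp add: algebra_simps)
    have "((x * u + y * v * (s * s)) + (x * v + y * u) * s, (x' * u' + y' * v' * (s' * s')) + (x' * v' + y' * u') * s') \<in> adjoin_graph A s s'"
      by (rule I[OF D(3)[OF D(4)[OF h(3) g(3)] D(4)[OF D(4)[OF h(4) g(4)] s(1)]]
            D(3)[OF D(4)[OF h(3) g(4)] D(4)[OF h(4) g(3)]]])
    thus "(a * c, b * d) \<in> adjoin_graph A s s'" using h g by (simp add: algebra_simps)
  next
    fix a b assume ab: "(a, b) \<in> adjoin_graph A s s'"
    obtain x x' y y' where h: "a = x + y * s" "b = x' + y' * s'" "(x, x') \<in> A" "(y, y') \<in> A" using ab unfolding Iff by blast
    have "((- x) + (- y) * s, (- x') + (- y') * s') \<in> adjoin_graph A s s'" using h by (intro I D(5))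
    thus "(- a, - b) \<in> adjoin_graph A s s'" using h by (simp add: algebra_simps)
    show "(inverse a, inverse b) \<in> adjoin_graph A s s'"
    proof (cases "a = 0")
      case True
      hence "b = 0" using z[OF h(3,4)] h by auto
      thus ?thesis using True I[OF D(2) D(2)] by simp
    next
      case False
      let ?N = "x * x - s * s * (y * y)" and ?N' = "x' * x' - s' * s' * (y' * y')"
      have N: "?N \<noteq> 0" using D.adjoin_norm[OF s(2)] h False by blast
      have NN: "(?N, ?N') \<in> A" using D(7)[OF D(4)[OF h(3) h(3)] D(4)[OF s(1) D(4)[OF h(4) h(4)]]] .
      have N': "?N' \<noteq> 0" using NN N D(2) D(9) by metis
      have 1: "a * (x * inverse ?N + (- y * inverse ?N) * s) = ?N * inverse ?N" unfolding h(1) by (simp add: algebra_simps)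
      have 2: "b * (x' * inverse ?N' + (- y' * inverse ?N') * s') = ?N' * inverse ?N'" unfolding h(2) by (simp add: algebra_simps)
      have "inverse a = x * inverse ?N + (- y * inverse ?N) * s" using 1 N by (simp add: inverse_unique)
      moreover have "inverse b = x' * inverse ?N' + (- y' * inverse ?N') * s'" using 2 N' by (simp add: inverse_unique)
      moreover have "(x * inverse ?N + (- y * inverse ?N) * s, x' * inverse ?N' + (- y' * inverse ?N') * s') \<in> adjoin_graph A s s'"
        using h NN by (intro I D(4) D(5) D(6))
      ultimately show ?thesis by simp
    qed
  qed
qed

lemma hom_graph_chain_Union:
  assumes "C \<noteq> {}" "\<And>A. A \<in> C \<Longrightarrow> hom_graph A" "\<And>A A'. A \<in> C \<Longrightarrow> A' \<in> C \<Longrightarrow> A \<subseteq> A' \<or> A' \<subseteq> A"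
  shows "hom_graph (\<Union>C)"
proof -
  have two: "\<exists>A\<in>C. p \<in> A \<and> q \<in> A" if "p \<in> \<Union>C" "q \<in> \<Union>C" for p q
    using that assms(3) by (meson UnionE subsetD)
  show ?thesis unfolding hom_graph_def
  proof (intro conjI allI impI)
    show "(1, 1) \<in> \<Union>C" using assms(1,2) hom_graphD(1) by blast
    fix a b assume ab: "(a, b) \<in> \<Union>C"
    show "(- a, - b) \<in> \<Union>C" "(inverse a, inverse b) \<in> \<Union>C" using ab assms(2) hom_graphD(5,6) by blast+
    fix c d assume cd: "(c, d) \<in> \<Union>C"
    show "(a + c, b + d) \<in> \<Union>C" "(a * c, b * d) \<in> \<Union>C"
      using two[OF ab cd] assms(2) hom_graphD(3,4) by blast+
  next
    show "b = 0" if "(0, b) \<in> \<Union>C" for b using that assms(2) hom_graphD(2,8) by blast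
  qed
qed

text \<open>
  Only the values on \<open>E\<close> matter; functions are normalised outside \<open>E\<close> when the Galois group is formed.
\<close>

definition is_aut :: "'k::field set \<Rightarrow> 'k set \<Rightarrow> ('k \<Rightarrow> 'k) \<Rightarrow> bool" where
  "is_aut F E \<sigma> \<longleftrightarrow> bij_betw \<sigma> E E \<and> (\<forall>x\<in>E. \<forall>y\<in>E. \<sigma> (x + y) = \<sigma> x + \<sigma> y \<and> \<sigma> (x * y) = \<sigma> x * \<sigma> y) \<and> (\<forall>c\<in>F. \<sigma> c = c)"

locale quadratically_closed_over = F: subfield_of F for F :: "'k::field set" +
  assumes two_nz: "(2::'k) \<noteq> 0" and ex_sqrt: "\<And>x::'k. \<exists>y. y * y = x"
begin

definition Q :: "'k set" where
  "Q = \<Inter>{E. subfield_of E \<and> F \<subseteq> E \<and> (\<forall>x. x * x \<in> E \<longrightarrow> x \<in> E)}"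

sublocale Q: subfield_of Q
  unfolding Q_def by (rule subfield_Inter) auto

lemma F_sub_Q: "F \<subseteq> Q" unfolding Q_def by blast

lemma Q_sqrt: "x * x \<in> Q \<Longrightarrow> x \<in> Q" unfolding Q_def by blast

lemma Q_least: "subfield_of E \<Longrightarrow> F \<subseteq> E \<Longrightarrow> (\<And>x. x * x \<in> E \<Longrightarrow> x \<in> E) \<Longrightarrow> Q \<subseteq> E"
  unfolding Q_def by blast

text \<open>
  A maximal extension has a domain and a range closed under square roots, hence both are all of \<open>Q\<close>.
\<close>

lemma extend_to_aut:
  assumes A: "hom_graph A" "A \<subseteq> Q \<times> Q" "Id_on F \<subseteq> A"
  obtains \<sigma> where "is_aut F Q \<sigma>" "\<And>a b. (a, b) \<in> A \<Longrightarrow> \<sigma> a = b"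
proof -
  let ?S = "{M. hom_graph M \<and> A \<subseteq> M \<and> M \<subseteq> Q \<times> Q}"
  have "\<exists>M\<in>?S. \<forall>M'\<in>?S. M \<subseteq> M' \<longrightarrow> M' = M"
  proof (rule subset_Zorn_nonempty)
    show "?S \<noteq> {}" using A by blast
    fix C assume C: "C \<noteq> {}" "subset.chain ?S C"
    have "hom_graph (\<Union>C)" by (rule hom_graph_chain_Union) (use C in \<open>auto simp: subset_chain_def\<close>)
    moreover have "A \<subseteq> \<Union>C" "\<Union>C \<subseteq> Q \<times> Q" using C unfolding subset_chain_def by blast+
    ultimately show "\<Union>C \<in> ?S" by blast
  qed
  then obtain M where MS: "M \<in> ?S" and max: "\<forall>M'\<in>?S. M \<subseteq> M' \<longrightarrow> M' = M" by (rule bexE)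
  have M: "hom_graph M" "A \<subseteq> M" "M \<subseteq> Q \<times> Q" using MS by simp_all
  note D = hom_graphD[OF M(1)]
  have dom_sqrt: "s \<in> Domain M" if s: "s * s \<in> Domain M" for s
  proof (rule ccontr)
    assume ns: "s \<notin> Domain M"
    obtain c where c: "(s * s, c) \<in> M" using s by blast
    obtain s' where s': "s' * s' = c" using ex_sqrt by blast
    have sQ: "s \<in> Q" "s' \<in> Q" using c s' M(3) Q_sqrt[of s] Q_sqrt[of s'] by auto
    let ?M = "adjoin_graph M s s'"
    have M': "hom_graph ?M" "M \<subseteq> ?M" "(s, s') \<in> ?M" using hom_graph_adjoin[OF M(1) _ ns, of s'] c s' by auto
    have "?M \<subseteq> Q \<times> Q" unfolding adjoin_graph_def using M(3) sQ by (auto intro!: Q.add Q.mult)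
    hence "?M \<in> ?S" using M' M(2) by simp
    hence "?M = M" using max M'(2) by blast
    thus False using M'(3) ns by blast
  qed
  have Dom: "Domain M = Q"
  proof
    show "Domain M \<subseteq> Q" using M by blast
    show "Q \<subseteq> Domain M" by (rule Q_least[OF hom_graph_subfields(1)[OF M(1)] _ dom_sqrt]) (use A M in auto)
  qed
  have Ran: "Range M = Q"
  proof
    show "Range M \<subseteq> Q" using M by blast
    show "Q \<subseteq> Range M"
    proof (rule Q_least[OF hom_graph_subfields(2)[OF M(1)]])
      show "F \<subseteq> Range M" using A M by auto
      fix s assume "s * s \<in> Range M"
      then obtain c where c: "(c, s * s) \<in> M" by blast
      obtain r where r: "r * r = c" using ex_sqrt by blast
      hence "r \<in> Q" using c M Q_sqrt[of r] by auto
      then obtain t where t: "(r, t) \<in> M" using Dom by blast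
      have "(c, t * t) \<in> M" using D(4)[OF t t] r by simp
      hence "t * t = s * s" using c D(8) by blast
      hence "t = s \<or> t = - s" by (rule square_eq_cases)
      moreover have "- t \<in> Range M" using D(5)[OF t] by blast
      ultimately show "s \<in> Range M" using t by auto
    qed
  qed
  define \<sigma> where "\<sigma> x = (THE y. (x, y) \<in> M)" for x
  have \<sigma>: "\<sigma> x = y" if "(x, y) \<in> M" for x y unfolding \<sigma>_def using that D(8) by blast
  have \<sigma>M: "(x, \<sigma> x) \<in> M" if "x \<in> Q" for x using that Dom \<sigma> by blast
  show ?thesis
  proof
    show "\<sigma> a = b" if "(a, b) \<in> A" for a b using that M \<sigma> by blast
    show "is_aut F Q \<sigma>" unfolding is_aut_def
    proof (intro conjI ballI)
      show "bij_betw \<sigma> Q Q"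
      proof (rule bij_betwI')
        show "(\<sigma> x = \<sigma> y) = (x = y)" if "x \<in> Q" "y \<in> Q" for x y using \<sigma>M[OF that(1)] \<sigma>M[OF that(2)] D(9) by metis
        show "\<sigma> x \<in> Q" if "x \<in> Q" for x using \<sigma>M[OF that] M by blast
        show "\<exists>x\<in>Q. y = \<sigma> x" if "y \<in> Q" for y using that Ran Dom \<sigma> by blast
      qed
      show "\<sigma> (x + y) = \<sigma> x + \<sigma> y" "\<sigma> (x * y) = \<sigma> x * \<sigma> y" if "x \<in> Q" "y \<in> Q" for x y
        using \<sigma>[OF D(3)[OF \<sigma>M \<sigma>M]] \<sigma>[OF D(4)[OF \<sigma>M \<sigma>M]] that by auto
      show "\<sigma> c = c" if "c \<in> F" for c using that A M \<sigma> by blast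
    qed
  qed
qed

text \<open>
  Choose \<open>T\<close> maximal among the subfields of \<open>Q\<close> omitting \<open>x\<close>.  Then \<open>x\<close> lies in every quadratic extension of
  \<open>T\<close> inside \<open>Q\<close>, and the conjugation of one of them moves it.
\<close>

lemma moved_by_aut:
  assumes x: "x \<in> Q" "x \<notin> F"
  obtains \<sigma> where "is_aut F Q \<sigma>" "\<sigma> x \<noteq> x"
proof -
  let ?S = "{T. subfield_of T \<and> F \<subseteq> T \<and> T \<subseteq> Q \<and> x \<notin> T}"
  have "\<exists>M\<in>?S. \<forall>M'\<in>?S. M \<subseteq> M' \<longrightarrow> M' = M"
  proof (rule subset_Zorn_nonempty)
    show "?S \<noteq> {}" using x F_sub_Q F.subfield_of_axioms by blast
    fix C assume C: "C \<noteq> {}" "subset.chain ?S C"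
    have "subfield_of (\<Union>C)" by (rule subfield_chain_Union) (use C in \<open>auto simp: subset_chain_def\<close>)
    moreover have "F \<subseteq> \<Union>C" "\<Union>C \<subseteq> Q" "x \<notin> \<Union>C" using C unfolding subset_chain_def by blast+
    ultimately show "\<Union>C \<in> ?S" by blast
  qed
  then obtain T where TS: "T \<in> ?S" and max: "\<forall>M'\<in>?S. T \<subseteq> M' \<longrightarrow> M' = T" by (rule bexE)
  have T: "subfield_of T" "F \<subseteq> T" "T \<subseteq> Q" "x \<notin> T" using TS by simp_all
  interpret T: subfield_of T by fact
  have "\<exists>s. s * s \<in> T \<and> s \<notin> T" using Q_least[OF T(1,2)] T(4) x(1) by blast
  then obtain s where s: "s * s \<in> T" "s \<notin> T" by blast
  have sQ: "s \<in> Q" using s T Q_sqrt[of s] by auto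
  have "x \<in> adjoin T s"
  proof (rule ccontr)
    assume n: "x \<notin> adjoin T s"
    have "adjoin T s \<subseteq> Q" unfolding adjoin_def using T(3) sQ by (auto intro!: Q.add Q.mult)
    hence "adjoin T s \<in> ?S" using T.adjoin_subfield[OF s(2,1)] n T.sub_adjoin[of s] T(2) by auto
    hence "adjoin T s = T" using max T.sub_adjoin by blast
    thus False using s T.sub_adjoin by blast
  qed
  then obtain u v where uv: "x = u + v * s" "u \<in> T" "v \<in> T" unfolding adjoin_def by blast
  have sne: "s \<noteq> 0" using s T.zero by metis
  have v: "v \<noteq> 0" using uv T(4) by auto
  let ?A = "adjoin_graph (Id_on T) s (- s)"
  have A: "hom_graph ?A" "Id_on T \<subseteq> ?A"
    using hom_graph_adjoin[OF hom_graph_Id[OF T(1)], of s "- s"] s by auto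
  have "?A \<subseteq> Q \<times> Q" unfolding adjoin_graph_def using T(3) sQ
    by (auto intro!: Q.add Q.mult Q.neg Q.diff)
  moreover have "Id_on F \<subseteq> ?A" using A(2) T(2) by auto
  ultimately obtain \<sigma> where \<sigma>: "is_aut F Q \<sigma>" "\<And>a b. (a, b) \<in> ?A \<Longrightarrow> \<sigma> a = b"
    using extend_to_aut[OF A(1)] by metis
  have "(x, u + v * (- s)) \<in> ?A" unfolding adjoin_graph_def uv(1) using uv by blast
  hence "\<sigma> x = u - v * s" using \<sigma>(2) by fastforce
  moreover have "u - v * s \<noteq> u + v * s"
  proof
    assume "u - v * s = u + v * s"
    hence "2 * (v * s) = 0" by (simp add: algebra_simps)
    thus False using two_nz v sne by simp
  qed
  ultimately show ?thesis using that \<sigma>(1) uv(1) by metis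
qed

end

section \<open>Involutions from preorderings\<close>

inductive_set cone :: "'k::field set \<Rightarrow> 'k set \<Rightarrow> 'k set" for P R where
  base: "p \<in> P \<Longrightarrow> x \<in> R \<Longrightarrow> p * (x * x) \<in> cone P R"
| plus: "a \<in> cone P R \<Longrightarrow> b \<in> cone P R \<Longrightarrow> a + b \<in> cone P R"

lemma cone_mono: assumes "R \<subseteq> R'" shows "cone P R \<subseteq> cone P R'"
proof
  fix a assume "a \<in> cone P R" thus "a \<in> cone P R'"
    by induction (use assms in \<open>auto intro: cone.intros\<close>)
qed

lemma cone_chain_Union:
  assumes "C \<noteq> {}" "\<And>E E'. E \<in> C \<Longrightarrow> E' \<in> C \<Longrightarrow> E \<subseteq> E' \<or> E' \<subseteq> E" "a \<in> cone P (\<Union>C)"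
  shows "\<exists>E\<in>C. a \<in> cone P E"
  using assms(3)
proof induction
  case (base p x) thus ?case by (auto intro: cone.base)
next
  case (plus a b)
  then obtain E E' where E: "E \<in> C" "a \<in> cone P E" "E' \<in> C" "b \<in> cone P E'" by blast
  have "E \<subseteq> E' \<or> E' \<subseteq> E" using assms(2) E by blast
  thus ?case
  proof
    assume "E \<subseteq> E'" 
    hence "a \<in> cone P E'" using cone_mono E by blast
    thus ?thesis using E cone.plus by blast
  next
    assume "E' \<subseteq> E" 
    hence "b \<in> cone P E" using cone_mono E by blast
    thus ?thesis using E cone.plus by blast
  qed
qed

lemma cone_mult:
  assumes "subfield_of R" "\<And>p q. p \<in> P \<Longrightarrow> q \<in> P \<Longrightarrow> p * q \<in> P" "a \<in> cone P R" "b \<in> cone P R"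
  shows "a * b \<in> cone P R"
  using assms(3)
proof induction
  case (base p x)
  show ?case using assms(4)
  proof induction
    case (base q y)
    have "(p * q) * ((x * y) * (x * y)) \<in> cone P R"
      by (intro cone.base assms(2) subfield_of.mult[OF assms(1)]) (use base \<open>p \<in> P\<close> \<open>x \<in> R\<close> in auto)
    thus ?case by (simp add: ac_simps)
  next
    case (plus a b) thus ?case by (simp add: distrib_left cone.plus)
  qed
next
  case (plus a a') thus ?case by (simp add: distrib_right cone.plus)
qed

context quadratically_closed_over
begin

text \<open>
  Zorn's lemma is applied to the fields \<open>R\<close> in which \<open>-1\<close> is not a sum of terms \<open>p x\<^sup>2\<close> with \<open>p\<close> in \<open>P\<close>.
  If \<open>c\<close> has no square root in a maximal \<open>R\<close>, then \<open>-1 = A + c B\<close> with \<open>A\<close> and \<open>B\<close> in the cone, so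
  \<open>-c\<close> lies in the cone.  Applied to \<open>c\<close> and \<open>-c\<close> this shows that one of them is a square.
\<close>

lemma euclidean_hull:
  assumes P: "P \<subseteq> F" "\<And>p q. p \<in> P \<Longrightarrow> q \<in> P \<Longrightarrow> p * q \<in> P" "\<And>p q. p \<in> P \<Longrightarrow> q \<in> P \<Longrightarrow> p + q \<in> P"
    and sq: "\<And>x. x \<in> F \<Longrightarrow> x * x \<in> P" and m1: "- 1 \<notin> P"
  obtains R where "subfield_of R" "F \<subseteq> R" "R \<subseteq> Q" "\<And>p. p \<in> P \<Longrightarrow> \<exists>y\<in>R. p = y * y"
    "\<And>x. x \<in> R \<Longrightarrow> (\<exists>y\<in>R. x = y * y) \<or> (\<exists>y\<in>R. - x = y * y)"
    "\<And>x. x \<in> R \<Longrightarrow> x * x \<noteq> - 1" "\<And>x y. x \<in> R \<Longrightarrow> y \<in> R \<Longrightarrow> \<exists>z\<in>R. x * x + y * y = z * z"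
proof -
  let ?S = "{R. subfield_of R \<and> F \<subseteq> R \<and> R \<subseteq> Q \<and> - 1 \<notin> cone P R}"
  have "a \<in> P" if "a \<in> cone P F" for a
    using that by induction (use P sq in auto)
  hence FS: "F \<in> ?S" using m1 F_sub_Q F.subfield_of_axioms by auto
  have "\<exists>M\<in>?S. \<forall>M'\<in>?S. M \<subseteq> M' \<longrightarrow> M' = M"
  proof (rule subset_Zorn_nonempty)
    show "?S \<noteq> {}" using FS by blast
    fix C assume C: "C \<noteq> {}" "subset.chain ?S C"
    have "subfield_of (\<Union>C)" by (rule subfield_chain_Union) (use C in \<open>auto simp: subset_chain_def\<close>)
    moreover have "F \<subseteq> \<Union>C" "\<Union>C \<subseteq> Q" using C unfolding subset_chain_def by blast+
    moreover have "- 1 \<notin> cone P (\<Union>C)"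
    proof
      assume "- 1 \<in> cone P (\<Union>C)"
      from cone_chain_Union[OF C(1) _ this] obtain E where "E \<in> C" "- 1 \<in> cone P E"
        using C unfolding subset_chain_def by blast
      thus False using C unfolding subset_chain_def by blast
    qed
    ultimately show "\<Union>C \<in> ?S" by blast
  qed
  then obtain R where RS: "R \<in> ?S" and max: "\<forall>M'\<in>?S. R \<subseteq> M' \<longrightarrow> M' = R" by (rule bexE)
  have R: "subfield_of R" "F \<subseteq> R" "R \<subseteq> Q" "- 1 \<notin> cone P R" using RS by simp_all
  interpret R: subfield_of R by fact
  have P1: "1 \<in> P" using sq[OF F.one] by simp
  have sqc: "x * x \<in> cone P R" if "x \<in> R" for x using cone.base[OF P1 that] by simp
  have c1: "1 \<in> cone P R" using sqc[OF R.one] by simp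
  note cm = cone_mult[OF R(1) P(2)]
  have key: "- c \<in> cone P R" if c: "c \<in> R" "\<not> (\<exists>y\<in>R. c = y * y)" for c
  proof -
    obtain s where s: "s * s = c" using ex_sqrt by blast
    have sR: "s \<notin> R" using c s by blast
    have sQ: "s \<in> Q" using c s R Q_sqrt[of s] by auto
    let ?R = "adjoin R s"
    have "subfield_of ?R" using R.adjoin_subfield sR s c by simp
    moreover have "?R \<subseteq> Q" unfolding adjoin_def using R(3) sQ by (auto intro!: Q.add Q.mult)
    moreover have "R \<subseteq> ?R" "s \<in> ?R" using R.sub_adjoin by blast+
    ultimately have "- 1 \<in> cone P ?R" using max R(2) sR by blast
    moreover have "\<exists>A\<in>cone P R. \<exists>B\<in>cone P R. \<exists>D\<in>R. z = A + c * B + D * s" if "z \<in> cone P ?R" for z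
      using that
    proof induction
      case (base p a)
      then obtain x y where xy: "a = x + y * s" "x \<in> R" "y \<in> R" unfolding adjoin_def by blast
      have "p * (a * a) = p * (x * x) + (s * s) * (p * (y * y)) + (2 * p * x * y) * s"
        unfolding xy(1) by (simp add: algebra_simps)
      moreover have "2 * p * x * y \<in> R" using xy base P(1) R(2) by (auto intro!: R.mult R.two)
      ultimately show ?case using cone.base xy base s by blast
    next
      case (plus a b)
      then obtain A B D A' B' D' where h: "A \<in> cone P R" "B \<in> cone P R" "D \<in> R" "a = A + c * B + D * s"
        "A' \<in> cone P R" "B' \<in> cone P R" "D' \<in> R" "b = A' + c * B' + D' * s" by blast
      have "a + b = (A + A') + c * (B + B') + (D + D') * s" using h by (simp add: algebra_simps)
      thus ?case using h cone.plus R.add by blast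
    qed
    ultimately obtain A B D where h: "A \<in> cone P R" "B \<in> cone P R" "D \<in> R" "- 1 = A + c * B + D * s" by blast
    have cR: "z \<in> R" if "z \<in> cone P R" for z
      using that by induction (use P(1) R(2) in \<open>auto intro!: R.add R.mult\<close>)
    have "(A + c * B + 1) + D * s = (A + c * B + D * s) + 1" by (simp add: ac_simps)
    hence "(A + c * B + 1) + D * s = 0" unfolding h(4)[symmetric] by simp
    moreover have "A + c * B + 1 \<in> R" using h cR c by (intro R.add R.mult R.one) auto
    ultimately have e: "A + c * B + 1 = 0" using R.adjoin_unique[OF sR] h(3) by blast
    have B0: "B \<noteq> 0"
    proof
      assume "B = 0"
      hence "A = - 1" using e by (simp add: eq_neg_iff_add_eq_0)
      thus False using h R by metis
    qed
    have "- c * B = 1 + A" using e by (metis add.commute add.left_commute add_eq_0_iff mult_minus_left)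
    hence "- c = (1 + A) * B * (inverse B * inverse B)" using B0 by (simp add: field_simps)
    moreover have "(1 + A) * B * (inverse B * inverse B) \<in> cone P R"
      using h c1 cR by (intro cm sqc R.inv cone.plus) auto
    ultimately show ?thesis by simp
  qed
  have alt: "(\<exists>y\<in>R. x = y * y) \<or> (\<exists>y\<in>R. - x = y * y)" if x: "x \<in> R" for x
  proof (rule ccontr)
    assume n: "\<not> ?thesis"
    have "- x \<in> cone P R" "x \<in> cone P R" using key[of x] key[of "- x"] x n R.neg by auto
    hence "(- x) * x * (inverse x * inverse x) \<in> cone P R" using x by (intro cm sqc R.inv)
    moreover have "x \<noteq> 0" using n R.zero by force
    ultimately have "- 1 \<in> cone P R" by (simp add: field_simps)
    thus False using R by blast
  qed
  have pos: "\<exists>y\<in>R. a = y * y" if a: "a \<in> cone P R" "a \<in> R" for a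
  proof (rule ccontr)
    assume n: "\<not> ?thesis"
    then obtain y where y: "y \<in> R" "- a = y * y" using alt a by blast
    have "a \<noteq> 0" using n R.zero by force
    hence "y \<noteq> 0" using y by auto
    have "a * (inverse y * inverse y) \<in> cone P R" using a y by (intro cm sqc R.inv)
    also have "a = - (y * y)" unfolding y(2)[symmetric] by simp
    finally show False using R(4) \<open>y \<noteq> 0\<close> by (simp add: field_simps)
  qed
  show ?thesis
  proof (rule that[of R])
    show "\<exists>y\<in>R. p = y * y" if "p \<in> P" for p
      using pos[of p] cone.base[OF that R.one] that P(1) R(2) by auto
    show "x * x \<noteq> - 1" if "x \<in> R" for x using sqc[OF that] R(4) by auto
    show "\<exists>z\<in>R. x * x + y * y = z * z" if "x \<in> R" "y \<in> R" for x y
      using pos[OF cone.plus[OF sqc[OF that(1)] sqc[OF that(2)]]]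
        R.add[OF R.mult[OF that(1) that(1)] R.mult[OF that(2) that(2)]] by blast
  qed (use R alt in blast)+
qed

text \<open>
  Square roots in \<open>R(j)\<close> with \<open>j\<^sup>2 = -1\<close> are given by the formula for complex square roots, so \<open>R(j)\<close>
  contains \<open>Q\<close>, and \<open>\<sigma>\<close> is the conjugation.
\<close>

lemma involution:
  assumes P: "P \<subseteq> F" "\<And>p q. p \<in> P \<Longrightarrow> q \<in> P \<Longrightarrow> p * q \<in> P" "\<And>p q. p \<in> P \<Longrightarrow> q \<in> P \<Longrightarrow> p + q \<in> P"
    and sq: "\<And>x. x \<in> F \<Longrightarrow> x * x \<in> P" and m1: "- 1 \<notin> P"
  obtains \<sigma> R where "is_aut F Q \<sigma>" "\<And>x. x \<in> Q \<Longrightarrow> \<sigma> (\<sigma> x) = x"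
    "subfield_of R" "F \<subseteq> R" "R \<subseteq> Q" "\<And>x. x \<in> R \<Longrightarrow> \<sigma> x = x" "\<And>p. p \<in> P \<Longrightarrow> \<exists>y\<in>R. p = y * y"
    "\<And>x. x \<in> R \<Longrightarrow> (\<exists>y\<in>R. x = y * y) \<or> (\<exists>y\<in>R. - x = y * y)"
    "\<And>x. x \<in> R \<Longrightarrow> x * x \<noteq> - 1" "\<And>x y. x \<in> R \<Longrightarrow> y \<in> R \<Longrightarrow> \<exists>z\<in>R. x * x + y * y = z * z"
    "\<And>i. i * i = - 1 \<Longrightarrow> \<sigma> i = - i"
proof -
  obtain R where R: "subfield_of R" "F \<subseteq> R" "R \<subseteq> Q" "\<And>p. p \<in> P \<Longrightarrow> \<exists>y\<in>R. p = y * y"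
    "\<And>x. x \<in> R \<Longrightarrow> (\<exists>y\<in>R. x = y * y) \<or> (\<exists>y\<in>R. - x = y * y)"
    "\<And>x. x \<in> R \<Longrightarrow> x * x \<noteq> - 1" "\<And>x y. x \<in> R \<Longrightarrow> y \<in> R \<Longrightarrow> \<exists>z\<in>R. x * x + y * y = z * z"
    by (rule euclidean_hull[OF P sq m1], assumption+) (rule that, assumption+)
  interpret R: subfield_of R by fact
  obtain j :: 'k where j: "j * j = - 1" using ex_sqrt by blast
  have jR: "j \<notin> R" using R(6) j by blast
  have jQ: "j \<in> Q" using Q_sqrt[of j] j Q.neg[OF Q.one] by simp
  have jj: "j * j \<in> R" using j R.neg[OF R.one] by simp
  let ?A = "adjoin R j"
  have "Q \<subseteq> ?A"
  proof (rule Q_least[OF R.adjoin_subfield[OF jR jj]])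
    show "F \<subseteq> ?A" using R(2) R.sub_adjoin by blast
    fix z assume "z * z \<in> ?A"
    then obtain a b where ab: "z * z = a + b * j" "a \<in> R" "b \<in> R" unfolding adjoin_def by blast
    have "\<forall>x\<in>R. x * x \<noteq> - 1" using R(6) by blast
    note aniso = R.anisotropic[OF this]
    obtain q where q: "q \<in> R" "2 = q * q" using R(7)[OF R.one R.one] by auto
    have q0: "q \<noteq> 0" using q(2) two_nz by auto
    obtain r0 where r0: "r0 \<in> R" "a * a + b * b = r0 * r0" using R(7) ab by blast
    \<comment> \<open>the modulus \<open>t * t\<close> is chosen to be a square itself, that is, nonnegative\<close>
    have "\<exists>t\<in>R. (t * t) * (t * t) = a * a + b * b" using R(5)[OF r0(1)] r0(2) by (metis minus_mult_minus)
    then obtain t where t: "t \<in> R" "(t * t) * (t * t) = a * a + b * b" by blast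
    have half: "\<exists>x\<in>R. x * x = (t * t + a) / 2" if a: "a \<in> R" "(t * t) * (t * t) = a * a + b * b" for a
    proof -
      have "\<exists>u\<in>R. t * t + a = u * u"
      proof (rule ccontr)
        assume n: "\<not> ?thesis"
        have "t * t + a \<in> R" using t a by (intro R.add R.mult)
        then obtain u where u: "u \<in> R" "- (t * t + a) = u * u" using R(5) n by blast
        have u0: "u \<noteq> 0" using n u R.zero by force
        have "(t * t - a) * (u * u) = - (b * b)" unfolding u(2)[symmetric] using a(2) by (simp add: algebra_simps)
        hence ta: "t * t - a = - (b / u * (b / u))" using u0 by (simp add: field_simps)
        have "(q * t) * (q * t) = (t * t + a) + (t * t - a)" using q(2)[symmetric] by (simp add: algebra_simps)
        also have "\<dots> = - (u * u + b / u * (b / u))" using u(2) ta by (metis minus_add_distrib minus_minus)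
        finally have e: "(q * t) * (q * t) + (u * u + b / u * (b / u)) = 0" by simp
        have bu: "b / u \<in> R" using ab u R.div by blast
        obtain w where w: "w \<in> R" "u * u + b / u * (b / u) = w * w" using R(7)[OF u(1) bu] by blast
        have "w = 0" using aniso[OF R.mult[OF q(1) t(1)] w(1)] e w(2) by simp
        hence "u = 0" using aniso[OF u(1) bu] w(2) by simp
        thus False using u0 by blast
      qed
      then obtain u where u: "u \<in> R" "t * t + a = u * u" by blast
      have "(u / q) * (u / q) = (t * t + a) / 2" using u(2) q q0 by simp
      thus ?thesis using R.div[OF u(1) q(1)] by blast
    qed
    obtain x where x: "x \<in> R" "x * x = (t * t + a) / 2" using half[OF ab(2) t(2)] by blast
    obtain y0 where y0: "y0 \<in> R" "y0 * y0 = (t * t - a) / 2" using half[of "- a"] R.neg[OF ab(2)] t(2) by auto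
    have "(2 * x * y0) * (2 * x * y0) = (2 * (x * x)) * (2 * (y0 * y0))" by (simp add: algebra_simps)
    also have "\<dots> = (t * t + a) * (t * t - a)" 
    proof -
      have "2 * (x * x) = t * t + a" "2 * (y0 * y0) = t * t - a" unfolding x(2) y0(2) using two_nz by simp_all
      thus ?thesis by (simp only:)
    qed
    also have "\<dots> = b * b" using t(2) by (simp add: algebra_simps)
    finally have "2 * x * y0 = b \<or> 2 * x * y0 = - b" by (rule square_eq_cases)
    then obtain y where y: "y \<in> R" "y * y = (t * t - a) / 2" "2 * x * y = b"
    proof
      assume "2 * x * y0 = b" thus ?thesis using that y0 by blast
    next
      assume "2 * x * y0 = - b" thus ?thesis using that[of "- y0"] y0 R.neg by auto
    qed
    have "(x + y * j) * (x + y * j) = x * x + y * y * (j * j) + 2 * x * y * j" by (simp add: algebra_simps)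
    also have "\<dots> = (t * t + a) / 2 - (t * t - a) / 2 + b * j" unfolding j x(2) y(2) y(3) by simp
    also have "(t * t + a) / 2 - (t * t - a) / 2 = a"
    proof -
      have "(t * t + a) - (t * t - a) = 2 * a" by simp
      thus ?thesis using two_nz nonzero_mult_div_cancel_left by (metis diff_divide_distrib)
    qed
    finally have "z * z = (x + y * j) * (x + y * j)" using ab by simp
    hence "z = x + y * j \<or> z = - (x + y * j)" by (rule square_eq_cases)
    moreover have "- (x + y * j) = (- x) + (- y) * j" by simp
    ultimately show "z \<in> ?A" unfolding adjoin_def using x y R.neg by blast
  qed
  let ?M = "adjoin_graph (Id_on R) j (- j)"
  have M: "hom_graph ?M" "Id_on R \<subseteq> ?M"
    using hom_graph_adjoin[OF hom_graph_Id[OF R(1)], of j "- j"] jR jj by auto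
  have "?M \<subseteq> Q \<times> Q" unfolding adjoin_graph_def using R(3) jQ by (auto intro!: Q.add Q.mult Q.neg Q.diff)
  moreover have "Id_on F \<subseteq> ?M" using M(2) R(2) by auto
  ultimately obtain \<sigma> where \<sigma>: "is_aut F Q \<sigma>" "\<And>a b. (a, b) \<in> ?M \<Longrightarrow> \<sigma> a = b"
    using extend_to_aut[OF M(1)] by metis
  have \<sigma>R: "\<sigma> (x + y * j) = x - y * j" if "x \<in> R" "y \<in> R" for x y
  proof -
    have "(x + y * j, x + y * (- j)) \<in> ?M" unfolding adjoin_graph_def using that by blast
    thus ?thesis using \<sigma>(2) by fastforce
  qed
  show ?thesis
  proof (rule that[of \<sigma> R])
    show "\<sigma> (\<sigma> x) = x" if "x \<in> Q" for x
    proof -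
      obtain u v where "x = u + v * j" "u \<in> R" "v \<in> R" using \<open>Q \<subseteq> ?A\<close> \<open>x \<in> Q\<close> unfolding adjoin_def by blast
      thus ?thesis using \<sigma>R[of u v] \<sigma>R[of u "- v"] R.neg by simp
    qed
    show "\<sigma> x = x" if "x \<in> R" for x using \<sigma>R[OF that R.zero] by simp
    show "\<sigma> i = - i" if i: "i * i = - 1" for i
    proof -
      have "i * i = j * j" using i j by simp
      hence "i = j \<or> i = - j" by (rule square_eq_cases)
      thus ?thesis using \<sigma>R[OF R.zero R.one] \<sigma>R[OF R.zero R.neg[OF R.one]] by auto
    qed
  qed (use \<sigma>(1) R in blast)+
qed

end

section \<open>Automorphisms\<close>

lemma is_autD:
  assumes "is_aut F E \<sigma>"
  shows "bij_betw \<sigma> E E" "x \<in> E \<Longrightarrow> \<sigma> x \<in> E" "x \<in> E \<Longrightarrow> y \<in> E \<Longrightarrow> \<sigma> (x + y) = \<sigma> x + \<sigma> y"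
    "x \<in> E \<Longrightarrow> y \<in> E \<Longrightarrow> \<sigma> (x * y) = \<sigma> x * \<sigma> y" "c \<in> F \<Longrightarrow> \<sigma> c = c"
    "x \<in> E \<Longrightarrow> y \<in> E \<Longrightarrow> \<sigma> x = \<sigma> y \<Longrightarrow> x = y"
  using assms unfolding is_aut_def bij_betw_def inj_on_def by auto

lemma is_aut_field:
  assumes \<sigma>: "is_aut F E \<sigma>" and E: "subfield_of E" "F \<subseteq> E" and F: "subfield_of F"
  shows "x \<in> E \<Longrightarrow> \<sigma> (- x) = - \<sigma> x" "x \<in> E \<Longrightarrow> \<sigma> (inverse x) = inverse (\<sigma> x)"
    "x \<in> E \<Longrightarrow> y \<in> E \<Longrightarrow> \<sigma> (x - y) = \<sigma> x - \<sigma> y"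
    "(\<And>i. i \<in> I \<Longrightarrow> f i \<in> E) \<Longrightarrow> \<sigma> (sum f I) = (\<Sum>i\<in>I. \<sigma> (f i))"
proof -
  note D = is_autD[OF \<sigma>]
  interpret E: subfield_of E by fact
  interpret F: subfield_of F by fact
  have n: "\<sigma> (- x) = - \<sigma> x" if "x \<in> E" for x
    using D(4)[OF E.neg[OF E.one] that] D(5)[OF F.neg[OF F.one]] by simp
  show "x \<in> E \<Longrightarrow> \<sigma> (- x) = - \<sigma> x" by (rule n)
  show "x \<in> E \<Longrightarrow> y \<in> E \<Longrightarrow> \<sigma> (x - y) = \<sigma> x - \<sigma> y"
    using D(3)[OF _ E.neg, of x y] n by simp
  show "\<sigma> (inverse x) = inverse (\<sigma> x)" if "x \<in> E" for x
  proof (cases "x = 0")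
    case True thus ?thesis using D(5)[OF F.zero] by simp
  next
    case False
    hence "\<sigma> x * \<sigma> (inverse x) = 1" using D(4)[OF that E.inv[OF that]] D(5)[OF F.one] by simp
    thus ?thesis by (simp add: inverse_unique)
  qed
  show "\<sigma> (sum f I) = (\<Sum>i\<in>I. \<sigma> (f i))" if "\<And>i. i \<in> I \<Longrightarrow> f i \<in> E"
    using that
  proof (induction I rule: infinite_finite_induct)
    case (insert i I)
    have "\<sigma> (f i + sum f I) = \<sigma> (f i) + \<sigma> (sum f I)" using insert by (intro D(3) E.sum) auto
    thus ?case using insert by simp
  qed (use D(5)[OF F.zero] in simp_all)
qed

lemma is_aut_comp:
  assumes "is_aut F E \<sigma>" "is_aut F E \<tau>" shows "is_aut F E (\<sigma> \<circ> \<tau>)"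
proof -
  note D = is_autD[OF assms(1)] and D' = is_autD[OF assms(2)]
  have "bij_betw (\<sigma> \<circ> \<tau>) E E" using bij_betw_trans[OF D'(1) D(1)] .
  moreover have "\<sigma> (\<tau> (x + y)) = \<sigma> (\<tau> x) + \<sigma> (\<tau> y)" "\<sigma> (\<tau> (x * y)) = \<sigma> (\<tau> x) * \<sigma> (\<tau> y)"
    if "x \<in> E" "y \<in> E" for x y
    using D'(3)[OF that] D'(4)[OF that] D(3)[OF D'(2) D'(2), OF that] D(4)[OF D'(2) D'(2), OF that] by simp_all
  moreover have "\<sigma> (\<tau> c) = c" if "c \<in> F" for c using D(5)[OF that] D'(5)[OF that] by simp
  ultimately show ?thesis unfolding is_aut_def by (simp add: comp_def)
qed

lemma is_aut_cong:
  assumes "is_aut F E \<sigma>" "\<And>x. x \<in> E \<Longrightarrow> \<tau> x = \<sigma> x" "subfield_of E" "F \<subseteq> E"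
  shows "is_aut F E \<tau>"
proof -
  note D = is_autD[OF assms(1)]
  have "bij_betw \<tau> E E" using D(1) assms(2) bij_betw_cong by metis
  moreover have "\<tau> (x + y) = \<tau> x + \<tau> y" "\<tau> (x * y) = \<tau> x * \<tau> y" if "x \<in> E" "y \<in> E" for x y
    using D(3)[OF that] D(4)[OF that] assms(2) that subfield_of.add[OF assms(3)] subfield_of.mult[OF assms(3)] by simp_all
  moreover have "\<tau> c = c" if "c \<in> F" for c using D(5)[OF that] assms(2,4) that by (metis subsetD)
  ultimately show ?thesis unfolding is_aut_def by simp
qed

lemma is_aut_id: "is_aut F E id"
  by (simp add: is_aut_def)

lemma is_aut_inv:
  assumes "is_aut F E \<sigma>" "subfield_of E" "F \<subseteq> E"
  shows "is_aut F E (inv_into E \<sigma>)" "x \<in> E \<Longrightarrow> \<sigma> (inv_into E \<sigma> x) = x" "x \<in> E \<Longrightarrow> inv_into E \<sigma> x \<in> E"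
    "x \<in> E \<Longrightarrow> inv_into E \<sigma> (\<sigma> x) = x"
proof -
  note D = is_autD[OF assms(1)]
  let ?\<delta> = "inv_into E \<sigma>"
  have i: "\<sigma> (?\<delta> x) = x" "?\<delta> x \<in> E" if "x \<in> E" for x
    using that D(1) by (auto simp: bij_betw_def f_inv_into_f inv_into_into)
  show "x \<in> E \<Longrightarrow> \<sigma> (?\<delta> x) = x" "x \<in> E \<Longrightarrow> ?\<delta> x \<in> E" by (fact i)+
  show "x \<in> E \<Longrightarrow> ?\<delta> (\<sigma> x) = x" using D(1) by (simp add: bij_betw_def)
  have "?\<delta> (x + y) = ?\<delta> x + ?\<delta> y" "?\<delta> (x * y) = ?\<delta> x * ?\<delta> y" if xy: "x \<in> E" "y \<in> E" for x y
  proof -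
    note c = subfield_of.add[OF assms(2)] subfield_of.mult[OF assms(2)]
    show "?\<delta> (x + y) = ?\<delta> x + ?\<delta> y"
      by (rule D(6)[OF i(2)[OF c(1)[OF xy]] c(1)[OF i(2)[OF xy(1)] i(2)[OF xy(2)]]])
         (simp only: i(1)[OF c(1)[OF xy]] D(3)[OF i(2)[OF xy(1)] i(2)[OF xy(2)]] i(1)[OF xy(1)] i(1)[OF xy(2)])
    show "?\<delta> (x * y) = ?\<delta> x * ?\<delta> y"
      by (rule D(6)[OF i(2)[OF c(2)[OF xy]] c(2)[OF i(2)[OF xy(1)] i(2)[OF xy(2)]]])
         (simp only: i(1)[OF c(2)[OF xy]] D(4)[OF i(2)[OF xy(1)] i(2)[OF xy(2)]] i(1)[OF xy(1)] i(1)[OF xy(2)])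
  qed
  moreover have "?\<delta> c = c" if "c \<in> F" for c
    using D(6)[OF i(2)[of c], of c] i(1)[of c] D(5)[OF that] that assms(3) by auto
  ultimately show "is_aut F E ?\<delta>" unfolding is_aut_def using bij_betw_inv_into[OF D(1)] by blast
qed

lemma is_aut_funpow: "is_aut F E \<sigma> \<Longrightarrow> is_aut F E (\<sigma> ^^ n)"
  by (induction n) (simp_all only: funpow.simps is_aut_id is_aut_comp)

text \<open>
  The elements with this property form a field closed under square roots, because a map fixing \<open>x\<^sup>2\<close>
  sends \<open>x\<close> to \<open>x\<close> or \<open>-x\<close>.  This makes the Galois group of \<open>Q\<close> pro-2 without computing any degree.
\<close>

lemma (in quadratically_closed_over) aut_two_power:
  assumes \<sigma>: "is_aut F Q \<sigma>" and x: "x \<in> Q"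
  shows "\<exists>m. (\<sigma> ^^ (2 ^ m)) x = x"
proof -
  let ?E = "{x \<in> Q. \<exists>m. (\<sigma> ^^ (2 ^ m)) x = x}"
  note D = is_autD[OF is_aut_funpow[OF \<sigma>]]
  note A = is_aut_field[OF is_aut_funpow[OF \<sigma>] Q.subfield_of_axioms F_sub_Q F.subfield_of_axioms]
  have iter: "(f ^^ n) x = x" if "f x = x" for f and n :: nat and x :: 'k using that by (induction n) auto
  have up: "(\<sigma> ^^ (2 ^ (m + n))) x = x" if "(\<sigma> ^^ (2 ^ m)) x = x" for x m n
    using iter[of "\<sigma> ^^ (2 ^ m)" x "2 ^ n"] that by (simp add: funpow_mult power_add mult.commute)
  have two: "\<exists>m. (\<sigma> ^^ (2 ^ m)) x = x \<and> (\<sigma> ^^ (2 ^ m)) y = y" if xy: "x \<in> ?E" "y \<in> ?E" for x y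
  proof -
    obtain m n where "(\<sigma> ^^ (2 ^ m)) x = x" "(\<sigma> ^^ (2 ^ n)) y = y" using xy by blast
    hence "(\<sigma> ^^ (2 ^ (m + n))) x = x" "(\<sigma> ^^ (2 ^ (n + m))) y = y" using up by blast+
    thus ?thesis by (metis add.commute)
  qed
  have sub: "subfield_of ?E"
  proof unfold_locales
    show "1 \<in> ?E" using Q.one D(5)[OF F.one] by blast
    show "- x \<in> ?E" "inverse x \<in> ?E" if "x \<in> ?E" for x
      using that A(1,2) Q.neg Q.inv by fastforce+
    fix x y assume xy: "x \<in> ?E" "y \<in> ?E"
    then obtain m where m: "(\<sigma> ^^ (2 ^ m)) x = x" "(\<sigma> ^^ (2 ^ m)) y = y" using two by blast
    have xyQ: "x \<in> Q" "y \<in> Q" using xy by auto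
    have "(\<sigma> ^^ (2 ^ m)) (x + y) = x + y" "(\<sigma> ^^ (2 ^ m)) (x * y) = x * y"
      using D(3)[OF xyQ, of "2 ^ m"] D(4)[OF xyQ, of "2 ^ m"] m by simp_all
    thus "x + y \<in> ?E" "x * y \<in> ?E" using Q.add[OF xyQ] Q.mult[OF xyQ] by blast+
  qed
  have "Q \<subseteq> ?E"
  proof (rule Q_least[OF sub])
    show "F \<subseteq> ?E" using F_sub_Q D(5) by blast
    fix x assume xx: "x * x \<in> ?E"
    hence xQ: "x \<in> Q" using Q_sqrt by blast
    obtain m where m: "(\<sigma> ^^ (2 ^ m)) (x * x) = x * x" using xx by blast
    let ?t = "\<sigma> ^^ (2 ^ m)"
    have "?t x * ?t x = x * x" using D(4)[OF xQ xQ] m by metis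
    hence "?t x = x \<or> ?t x = - x" by (rule square_eq_cases)
    hence "?t (?t x) = x" using A(1)[OF xQ, of "2 ^ m"] by auto
    hence "(\<sigma> ^^ (2 ^ Suc m)) x = x" by (simp add: funpow_add mult_2)
    thus "x \<in> ?E" using xQ by blast
  qed
  thus ?thesis using x by blast
qed

section \<open>Independence of characters and the degree of a Galois extension\<close>

text \<open>
  Dedekind's argument: evaluating the relation at \<open>a x\<close> and subtracting a multiple of it removes one
  character and keeps the others.
\<close>

lemma character_independence:
  fixes \<Phi> :: "('k::field \<Rightarrow> 'k) set"
  assumes "finite \<Phi>" and D: "1 \<in> D" "\<And>x y. x \<in> D \<Longrightarrow> y \<in> D \<Longrightarrow> x * y \<in> D"
    and "\<And>\<phi>. \<phi> \<in> \<Phi> \<Longrightarrow> \<phi> 1 = 1" "\<And>\<phi> x y. \<phi> \<in> \<Phi> \<Longrightarrow> x \<in> D \<Longrightarrow> y \<in> D \<Longrightarrow> \<phi> (x * y) = \<phi> x * \<phi> y"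
    and "\<And>\<phi> \<psi>. \<phi> \<in> \<Phi> \<Longrightarrow> \<psi> \<in> \<Phi> \<Longrightarrow> \<phi> \<noteq> \<psi> \<Longrightarrow> \<exists>x\<in>D. \<phi> x \<noteq> \<psi> x"
    and "\<And>x. x \<in> D \<Longrightarrow> (\<Sum>\<phi>\<in>\<Phi>. c \<phi> * \<phi> x) = 0"
  shows "\<forall>\<phi>\<in>\<Phi>. c \<phi> = 0"
  using assms(1,4-7)
proof (induction \<Phi> arbitrary: c rule: finite_induct)
  case empty thus ?case by simp
next
  case (insert \<phi> \<Phi>)
  have c0: "c \<psi> = 0" if \<psi>: "\<psi> \<in> \<Phi>" for \<psi>
  proof -
    have "\<phi> \<noteq> \<psi>" using \<psi> insert.hyps by blast
    then obtain a where a: "a \<in> D" "\<phi> a \<noteq> \<psi> a" using insert.prems(3) \<psi> by blast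
    have "(\<Sum>\<eta>\<in>\<Phi>. (c \<eta> * (\<eta> a - \<phi> a)) * \<eta> x) = 0" if x: "x \<in> D" for x
    proof -
      have "c \<phi> * \<phi> (a * x) + (\<Sum>\<eta>\<in>\<Phi>. c \<eta> * \<eta> (a * x)) = 0"
        using insert.prems(4)[OF D(2)[OF a(1) x]] insert.hyps by simp
      moreover have "\<eta> (a * x) = \<eta> a * \<eta> x" if "\<eta> \<in> insert \<phi> \<Phi>" for \<eta> using insert.prems(2) that a x by blast
      ultimately have 1: "c \<phi> * (\<phi> a * \<phi> x) + (\<Sum>\<eta>\<in>\<Phi>. c \<eta> * (\<eta> a * \<eta> x)) = 0" by simp
      have "c \<phi> * \<phi> x + (\<Sum>\<eta>\<in>\<Phi>. c \<eta> * \<eta> x) = 0" using insert.prems(4)[OF x] insert.hyps by simp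
      hence "\<phi> a * (c \<phi> * \<phi> x + (\<Sum>\<eta>\<in>\<Phi>. c \<eta> * \<eta> x)) = 0" by simp
      hence 2: "c \<phi> * (\<phi> a * \<phi> x) + (\<Sum>\<eta>\<in>\<Phi>. \<phi> a * (c \<eta> * \<eta> x)) = 0"
        by (simp add: distrib_left sum_distrib_left ac_simps)
      have "(\<Sum>\<eta>\<in>\<Phi>. (c \<eta> * (\<eta> a - \<phi> a)) * \<eta> x) = (\<Sum>\<eta>\<in>\<Phi>. c \<eta> * (\<eta> a * \<eta> x)) - (\<Sum>\<eta>\<in>\<Phi>. \<phi> a * (c \<eta> * \<eta> x))"
        unfolding sum_subtractf[symmetric] by (intro sum.cong refl) (simp add: algebra_simps)
      moreover have "(\<Sum>\<eta>\<in>\<Phi>. c \<eta> * (\<eta> a * \<eta> x)) = (\<Sum>\<eta>\<in>\<Phi>. \<phi> a * (c \<eta> * \<eta> x))"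
        by (rule add_left_imp_eq[of "c \<phi> * (\<phi> a * \<phi> x)"]) (simp only: 1 2)
      ultimately show ?thesis by simp
    qed
    hence "\<forall>\<eta>\<in>\<Phi>. c \<eta> * (\<eta> a - \<phi> a) = 0" using insert.prems by (intro insert.IH) auto
    thus ?thesis using \<psi> a by auto
  qed
  have "c \<phi> * \<phi> 1 = 0" using insert.prems(4)[OF D(1)] insert.hyps c0 by simp
  moreover have "\<phi> 1 = 1" using insert.prems(1) by blast
  ultimately show ?case using c0 by simp
qed

text \<open>
  Gaussian elimination over a subfield; for \<open>galois_degree\<close> it matters that the solution lies
  in \<open>E\<close>.
\<close>

lemma underdetermined_system:
  fixes a :: "'i \<Rightarrow> 'j \<Rightarrow> 'k::field"
  assumes E: "subfield_of E" and "finite I" "finite J" "card I < card J" "\<And>i j. i \<in> I \<Longrightarrow> j \<in> J \<Longrightarrow> a i j \<in> E"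
  shows "\<exists>c. (\<forall>j\<in>J. c j \<in> E) \<and> (\<exists>j\<in>J. c j \<noteq> 0) \<and> (\<forall>i\<in>I. (\<Sum>j\<in>J. a i j * c j) = 0)"
  using assms(2-)
proof (induction I arbitrary: J a rule: finite_induct)
  case empty
  then obtain j where "j \<in> J" by fastforce
  thus ?case by (intro exI[of _ "\<lambda>_. 1"]) (use subfield_of.one[OF E] in auto)
next
  case (insert i I)
  interpret E: subfield_of E by fact
  show ?case
  proof (cases "\<forall>j\<in>J. a i j = 0")
    case True
    obtain c where "(\<forall>j\<in>J. c j \<in> E) \<and> (\<exists>j\<in>J. c j \<noteq> 0) \<and> (\<forall>i\<in>I. (\<Sum>j\<in>J. a i j * c j) = 0)"
      using insert.IH[of J a] insert.prems insert.hyps by auto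
    thus ?thesis using True by (intro exI[of _ c]) simp
  next
    case False
    then obtain k where k: "k \<in> J" "a i k \<noteq> 0" by blast
    let ?J = "J - {k}"
    let ?a = "\<lambda>i' j. a i' j - a i' k * (a i j / a i k)"
    have "card I < card ?J" using insert.prems(1,2) insert.hyps k by simp
    moreover have "?a i' j \<in> E" if "i' \<in> I" "j \<in> ?J" for i' j
      using that insert.prems(3) k by (intro E.diff E.mult E.div) auto
    ultimately obtain c where c: "\<forall>j\<in>?J. c j \<in> E" "\<exists>j\<in>?J. c j \<noteq> 0" "\<forall>i'\<in>I. (\<Sum>j\<in>?J. ?a i' j * c j) = 0"
      using insert.IH[of ?J ?a] insert.prems(1) by auto
    define ck where "ck = - (\<Sum>j\<in>?J. a i j / a i k * c j)"
    let ?c = "c(k := ck)"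
    have sumJ: "(\<Sum>j\<in>J. b j * ?c j) = b k * ck + (\<Sum>j\<in>?J. b j * c j)" for b
    proof -
      have "(\<Sum>j\<in>J. b j * ?c j) = b k * ?c k + (\<Sum>j\<in>?J. b j * ?c j)" by (rule sum.remove[OF insert.prems(1) k(1)])
      also have "(\<Sum>j\<in>?J. b j * ?c j) = (\<Sum>j\<in>?J. b j * c j)" by (intro sum.cong) auto
      finally show ?thesis by simp
    qed
    have "a i k * ck = - (\<Sum>j\<in>?J. a i j * c j)"
      unfolding ck_def using k(2) by (simp add: sum_distrib_left)
    hence "(\<Sum>j\<in>J. a i j * ?c j) = 0" unfolding sumJ by simp
    moreover have "(\<Sum>j\<in>J. a i' j * ?c j) = 0" if i': "i' \<in> I" for i'
    proof -
      have "(\<Sum>j\<in>?J. ?a i' j * c j) = (\<Sum>j\<in>?J. a i' j * c j) - (\<Sum>j\<in>?J. a i' k * (a i j / a i k * c j))"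
        unfolding sum_subtractf[symmetric] by (intro sum.cong refl) (simp add: algebra_simps)
      also have "\<dots> = (\<Sum>j\<in>?J. a i' j * c j) + a i' k * ck" unfolding ck_def sum_distrib_left[symmetric] by simp
      finally show ?thesis unfolding sumJ using c(3) i' by (simp add: add.commute)
    qed
    moreover have "\<forall>j\<in>J. ?c j \<in> E"
      using c(1) insert.prems(3) k unfolding ck_def by (auto intro!: E.neg E.sum E.mult E.div)
    moreover have "\<exists>j\<in>J. ?c j \<noteq> 0" using c(2) by auto
    ultimately show ?thesis by (intro exI[of _ ?c]) auto
  qed
qed

text \<open>
  Artin's theorem.  If there were more automorphisms than basis elements, the matrix of the values of
  the automorphisms on the basis would have dependent rows, against independence of characters.  If there
  were fewer, its columns would be dependent over \<open>E\<close>; traces turn such a relation into relations over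
  \<open>F\<close>, which force the trace to vanish, again against independence of characters.
\<close>

lemma galois_degree:
  fixes F E :: "'k::field set"
  assumes F: "subfield_of F" and E: "subfield_of E" "F \<subseteq> E"
    and B: "finite B" "B \<subseteq> E" "\<And>x. x \<in> E \<Longrightarrow> \<exists>f. (\<forall>b\<in>B. f b \<in> F) \<and> x = (\<Sum>b\<in>B. f b * b)"
    and indep: "\<And>f. (\<forall>b\<in>B. f b \<in> F) \<Longrightarrow> (\<Sum>b\<in>B. f b * b) = 0 \<Longrightarrow> \<forall>b\<in>B. f b = 0"
    and fixed: "\<And>x. x \<in> E \<Longrightarrow> (\<And>\<sigma>. is_aut F E \<sigma> \<Longrightarrow> \<sigma> x = x) \<Longrightarrow> x \<in> F"
  defines "\<Gamma> \<equiv> {\<sigma> \<in> extensional E. is_aut F E \<sigma>}"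
  shows "finite \<Gamma> \<and> card \<Gamma> = card B"
proof -
  interpret F: subfield_of F by fact
  interpret E: subfield_of E by fact
  have G: "is_aut F E \<phi>" if "\<phi> \<in> \<Gamma>" for \<phi> using that by (simp add: \<Gamma>_def)
  have ind: "\<forall>\<phi>\<in>\<Phi>. c \<phi> = 0" if "finite \<Phi>" "\<Phi> \<subseteq> \<Gamma>" "\<And>x. x \<in> E \<Longrightarrow> (\<Sum>\<phi>\<in>\<Phi>. c \<phi> * \<phi> x) = 0" for \<Phi> c
  proof (rule character_independence[OF that(1) E.one E.mult _ _ _ that(3)])
    show "\<phi> 1 = 1" if "\<phi> \<in> \<Phi>" for \<phi> using is_autD(5)[OF G F.one] that \<open>\<Phi> \<subseteq> \<Gamma>\<close> by blast
    show "\<phi> (x * y) = \<phi> x * \<phi> y" if "\<phi> \<in> \<Phi>" "x \<in> E" "y \<in> E" for \<phi> x y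
      using is_autD(4)[OF G] that \<open>\<Phi> \<subseteq> \<Gamma>\<close> by blast
    show "\<exists>x\<in>E. \<phi> x \<noteq> \<psi> x" if "\<phi> \<in> \<Phi>" "\<psi> \<in> \<Phi>" "\<phi> \<noteq> \<psi>" for \<phi> \<psi>
    proof -
      have "\<phi> \<in> extensional E" "\<psi> \<in> extensional E" using that \<open>\<Phi> \<subseteq> \<Gamma>\<close> by (auto simp: \<Gamma>_def)
      thus ?thesis using that(3) extensionalityI by blast
    qed
  qed
  have le: "card \<Phi> \<le> card B" if \<Phi>: "finite \<Phi>" "\<Phi> \<subseteq> \<Gamma>" for \<Phi>
  proof (rule ccontr)
    assume "\<not> card \<Phi> \<le> card B"
    hence "\<exists>c. (\<forall>\<phi>\<in>\<Phi>. c \<phi> \<in> UNIV) \<and> (\<exists>\<phi>\<in>\<Phi>. c \<phi> \<noteq> 0) \<and> (\<forall>b\<in>B. (\<Sum>\<phi>\<in>\<Phi>. \<phi> b * c \<phi>) = 0)"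
      by (intro underdetermined_system[OF subfield_UNIV B(1) \<Phi>(1)]) auto
    then obtain c where c: "\<exists>\<phi>\<in>\<Phi>. c \<phi> \<noteq> 0" "\<And>b. b \<in> B \<Longrightarrow> (\<Sum>\<phi>\<in>\<Phi>. \<phi> b * c \<phi>) = 0" by blast
    have "(\<Sum>\<phi>\<in>\<Phi>. c \<phi> * \<phi> x) = 0" if x: "x \<in> E" for x
    proof -
      obtain f where f: "\<forall>b\<in>B. f b \<in> F" "x = (\<Sum>b\<in>B. f b * b)" using B(3) x by blast
      have "\<phi> x = (\<Sum>b\<in>B. f b * \<phi> b)" if "\<phi> \<in> \<Phi>" for \<phi>
      proof -
        have \<phi>: "is_aut F E \<phi>" using G that \<Phi> by blast
        have "\<phi> x = (\<Sum>b\<in>B. \<phi> (f b * b))" unfolding f(2)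
          by (rule is_aut_field(4)[OF \<phi> E F]) (use f B E in \<open>auto intro!: E.mult\<close>)
        also have "\<dots> = (\<Sum>b\<in>B. f b * \<phi> b)"
          by (rule sum.cong) (use is_autD(4,5)[OF \<phi>] f(1) B(2) E(2) in \<open>auto simp: subset_iff\<close>)
        finally show ?thesis .
      qed
      hence "(\<Sum>\<phi>\<in>\<Phi>. c \<phi> * \<phi> x) = (\<Sum>\<phi>\<in>\<Phi>. \<Sum>b\<in>B. f b * (\<phi> b * c \<phi>))"
      proof (intro sum.cong refl)
        fix \<phi> assume "\<phi> \<in> \<Phi>" "\<And>\<phi>. \<phi> \<in> \<Phi> \<Longrightarrow> \<phi> x = (\<Sum>b\<in>B. f b * \<phi> b)"
        hence *: "\<phi> x = (\<Sum>b\<in>B. f b * \<phi> b)" by blast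
        show "c \<phi> * \<phi> x = (\<Sum>b\<in>B. f b * (\<phi> b * c \<phi>))" unfolding * by (simp add: sum_distrib_left ac_simps)
      qed
      also have "\<dots> = (\<Sum>b\<in>B. f b * (\<Sum>\<phi>\<in>\<Phi>. \<phi> b * c \<phi>))" by (subst sum.swap) (simp add: sum_distrib_left)
      also have "\<dots> = 0" using c(2) by simp
      finally show ?thesis .
    qed
    thus False using ind[OF \<Phi>] c(1) by blast
  qed
  have fin: "finite \<Gamma>"
  proof (rule ccontr)
    assume "infinite \<Gamma>"
    then obtain \<Phi> where "\<Phi> \<subseteq> \<Gamma>" "finite \<Phi>" "card \<Phi> = Suc (card B)" using infinite_arbitrarily_large by blast
    thus False using le[of \<Phi>] by simp
  qed
  have res: "restrict \<sigma> E \<in> \<Gamma>" if "is_aut F E \<sigma>" for \<sigma>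
    using is_aut_cong[OF that _ E, of "restrict \<sigma> E"] by (simp add: \<Gamma>_def)
  have comp: "restrict (\<gamma> \<circ> \<phi>) E \<in> \<Gamma>" if "\<gamma> \<in> \<Gamma>" "\<phi> \<in> \<Gamma>" for \<gamma> \<phi>
    by (rule res[OF is_aut_comp[OF G[OF that(1)] G[OF that(2)]]])
  have "card B \<le> card \<Gamma>"
  proof (rule ccontr)
    assume "\<not> card B \<le> card \<Gamma>"
    hence "\<exists>c. (\<forall>b\<in>B. c b \<in> E) \<and> (\<exists>b\<in>B. c b \<noteq> 0) \<and> (\<forall>\<gamma>\<in>\<Gamma>. (\<Sum>b\<in>B. \<gamma> b * c b) = 0)"
      by (intro underdetermined_system[OF E(1) fin B(1)]) (use is_autD(2)[OF G] B in auto)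
    then obtain c b0 where c: "\<And>b. b \<in> B \<Longrightarrow> c b \<in> E" "b0 \<in> B" "c b0 \<noteq> 0"
      "\<And>\<gamma>. \<gamma> \<in> \<Gamma> \<Longrightarrow> (\<Sum>b\<in>B. \<gamma> b * c b) = 0" by blast
    define Tr where "Tr x = (\<Sum>\<gamma>\<in>\<Gamma>. \<gamma> x)" for x
    have TrF: "Tr x \<in> F" if x: "x \<in> E" for x
    proof (rule fixed)
      have gE: "\<gamma> x \<in> E" if "\<gamma> \<in> \<Gamma>" for \<gamma> using is_autD(2)[OF G] x that by blast
      show "Tr x \<in> E" unfolding Tr_def by (rule E.sum) (rule gE)
      fix \<sigma>' assume s': "is_aut F E \<sigma>'"
      define \<sigma> where "\<sigma> = restrict \<sigma>' E"
      have \<sigma>: "\<sigma> \<in> \<Gamma>" unfolding \<sigma>_def by (rule res[OF s'])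
      have inj: "inj_on (\<lambda>\<gamma>. restrict (\<sigma> \<circ> \<gamma>) E) \<Gamma>"
      proof (rule inj_onI)
        fix \<gamma> \<delta> assume h: "\<gamma> \<in> \<Gamma>" "\<delta> \<in> \<Gamma>" "restrict (\<sigma> \<circ> \<gamma>) E = restrict (\<sigma> \<circ> \<delta>) E"
        have "\<gamma> y = \<delta> y" if y: "y \<in> E" for y
        proof -
          have "\<sigma> (\<gamma> y) = \<sigma> (\<delta> y)" using fun_cong[OF h(3), of y] y by simp
          thus ?thesis using is_autD(6)[OF G[OF \<sigma>]] is_autD(2)[OF G] h y by blast
        qed
        thus "\<gamma> = \<delta>" using h by (intro extensionalityI[of _ E]) (auto simp: \<Gamma>_def)
      qed
      have "\<sigma>' (Tr x) = \<sigma> (Tr x)" using \<open>Tr x \<in> E\<close> by (simp add: \<sigma>_def)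
      also have "\<dots> = (\<Sum>\<gamma>\<in>\<Gamma>. \<sigma> (\<gamma> x))" unfolding Tr_def
        by (rule is_aut_field(4)[OF G[OF \<sigma>] E F]) (rule gE)
      also have "\<dots> = (\<Sum>\<gamma>\<in>\<Gamma>. (restrict (\<sigma> \<circ> \<gamma>) E) x)" using x by simp
      also have "\<dots> = (\<Sum>\<gamma>\<in>(\<lambda>\<gamma>. restrict (\<sigma> \<circ> \<gamma>) E) ` \<Gamma>. \<gamma> x)"
      proof (rule sum.reindex_cong[symmetric])
        show "inj_on (\<lambda>\<gamma>. restrict (\<sigma> \<circ> \<gamma>) E) \<Gamma>" by (rule inj)
        show "(\<lambda>\<gamma>. restrict (\<sigma> \<circ> \<gamma>) E) ` \<Gamma> = (\<lambda>\<gamma>. restrict (\<sigma> \<circ> \<gamma>) E) ` \<Gamma>" ..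
      qed simp
      also have "(\<lambda>\<gamma>. restrict (\<sigma> \<circ> \<gamma>) E) ` \<Gamma> = \<Gamma>"
      proof (rule endo_inj_surj[OF fin])
        show "(\<lambda>\<gamma>. restrict (\<sigma> \<circ> \<gamma>) E) ` \<Gamma> \<subseteq> \<Gamma>" using comp \<sigma> by blast
        show "inj_on (\<lambda>\<gamma>. restrict (\<sigma> \<circ> \<gamma>) E) \<Gamma>" by (rule inj)
      qed
      finally show "\<sigma>' (Tr x) = Tr x" by (simp add: Tr_def)
    qed
    have app: "(\<Sum>b\<in>B. \<gamma> (e * c b) * b) = 0" if "\<gamma> \<in> \<Gamma>" "e \<in> E" for \<gamma> e
    proof -
      note A = is_autD[OF G[OF that(1)]]
      define \<delta> where "\<delta> = restrict (inv_into E \<gamma>) E"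
      have inv: "\<gamma> (\<delta> x) = x" "\<delta> x \<in> E" if "x \<in> E" for x
        using is_aut_inv(2,3)[OF G[OF \<open>\<gamma> \<in> \<Gamma>\<close>] E] that by (simp_all add: \<delta>_def)
      have \<delta>: "\<delta> \<in> \<Gamma>" unfolding \<delta>_def by (rule res[OF is_aut_inv(1)[OF G[OF that(1)] E]])
      have "(\<Sum>b\<in>B. \<gamma> (e * c b) * b) = (\<Sum>b\<in>B. \<gamma> (e * (\<delta> b * c b)))"
      proof (rule sum.cong[OF refl])
        fix b assume b: "b \<in> B"
        have "\<gamma> (e * (\<delta> b * c b)) = \<gamma> ((e * c b) * \<delta> b)" by (simp add: ac_simps)
        also have "\<dots> = \<gamma> (e * c b) * \<gamma> (\<delta> b)" using b B(2) c(1) inv(2) that by (intro A(4) E.mult) auto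
        finally show "\<gamma> (e * c b) * b = \<gamma> (e * (\<delta> b * c b))" using inv(1) b B(2) by auto
      qed
      also have "\<dots> = \<gamma> (\<Sum>b\<in>B. e * (\<delta> b * c b))"
        by (rule is_aut_field(4)[OF G[OF that(1)] E F, symmetric]) (use inv(2) B(2) c(1) that in \<open>auto intro!: E.mult\<close>)
      also have "(\<Sum>b\<in>B. e * (\<delta> b * c b)) = 0" unfolding sum_distrib_left[symmetric] using c(4)[OF \<delta>] by simp
      also have "\<gamma> 0 = 0" using A(5)[OF F.zero] .
      finally show ?thesis .
    qed
    have "Tr (e * c b0) = 0" if e: "e \<in> E" for e
    proof -
      have "(\<Sum>b\<in>B. Tr (e * c b) * b) = (\<Sum>\<gamma>\<in>\<Gamma>. \<Sum>b\<in>B. \<gamma> (e * c b) * b)"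
        unfolding Tr_def by (subst sum.swap) (simp add: sum_distrib_right)
      also have "\<dots> = 0" using app e by simp
      finally show ?thesis using indep[of "\<lambda>b. Tr (e * c b)"] TrF e c(1,2) E.mult by blast
    qed
    hence "Tr x = 0" if "x \<in> E" for x using that E.div[OF that c(1)[OF c(2)]] c(3) by fastforce
    hence "\<forall>\<gamma>\<in>\<Gamma>. (1::'k) = 0" using fin by (intro ind) (auto simp: Tr_def)
    moreover have "restrict id E \<in> \<Gamma>" by (rule res[OF is_aut_id])
    ultimately show False by auto
  qed
  thus ?thesis using le[OF fin] fin by auto
qed

section \<open>Finite Galois extensions inside the algebraic closure\<close>

lemma ring_of_type_sel [simp]:
  "carrier (ring_of_type_algebra :: 'k::field ring) = UNIV" "monoid.mult (ring_of_type_algebra :: 'k ring) = (*)"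
  "monoid.one (ring_of_type_algebra :: 'k ring) = 1" "ring.add (ring_of_type_algebra :: 'k ring) = (+)"
  "ring.zero (ring_of_type_algebra :: 'k ring) = 0"
  by (simp_all add: ring_of_type_algebra_def)

lemma a_inv_ring_of_type: "a_inv (ring_of_type_algebra :: 'k::field ring) x = - x"
proof -
  interpret R: field "ring_of_type_algebra :: 'k ring" by (rule field_from_type_algebra)
  show ?thesis using R.minus_equality[of "- x" x] by simp
qed

lemma m_inv_ring_of_type:
  assumes "x \<noteq> 0" shows "m_inv (ring_of_type_algebra :: 'k::field ring) x = inverse x"
proof -
  interpret R: field "ring_of_type_algebra :: 'k ring" by (rule field_from_type_algebra)
  show ?thesis using R.comm_inv_char[of x "inverse x"] assms by simp
qed

lemma subfield_iff_subfield_of: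
  fixes E :: "'k::field set"
  shows "subfield E (ring_of_type_algebra :: 'k ring) \<longleftrightarrow> subfield_of E"
proof
  interpret R: field "ring_of_type_algebra :: 'k ring" by (rule field_from_type_algebra)
  assume E: "subfield E (ring_of_type_algebra :: 'k ring)"
  note S = subringE[OF subfieldE(1)[OF E]]
  show "subfield_of E"
  proof unfold_locales
    show "1 \<in> E" using S(3) by simp
    show "x + y \<in> E" "x * y \<in> E" if "x \<in> E" "y \<in> E" for x y using S(6,7)[OF that] by simp_all
    show "- x \<in> E" if "x \<in> E" for x using S(5)[OF that] by (simp add: a_inv_ring_of_type)
    show "inverse x \<in> E" if "x \<in> E" for x
    proof (cases "x = 0")
      case False
      thus ?thesis using R.subfield_m_inv(1)[OF E, of x] that by (simp add: m_inv_ring_of_type)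
    qed (use that in simp)
  qed
next
  interpret R: field "ring_of_type_algebra :: 'k ring" by (rule field_from_type_algebra)
  assume "subfield_of E"
  then interpret E: subfield_of E .
  have "subring E (ring_of_type_algebra :: 'k ring)"
    by (rule R.subringI) (auto simp: a_inv_ring_of_type intro: E.closed)
  thus "subfield E (ring_of_type_algebra :: 'k ring)"
    by (rule R.subfieldI') (auto simp: m_inv_ring_of_type intro: E.inv)
qed

abbreviation F0 :: "'a::field alg_closure set" where "F0 \<equiv> range to_ac"

lemma intermediate_field_iff: "intermediate_field E \<longleftrightarrow> subfield_of E \<and> F0 \<subseteq> E"
  by (simp add: intermediate_field_def subfield_iff_subfield_of)

lemma subfield_F0: "subfield_of (F0 :: 'a::field alg_closure set)"
proof unfold_locales
  fix x y :: "'a alg_closure"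
  show "(1 :: 'a alg_closure) \<in> F0" using rangeI[of to_ac 1] by simp
  show "inverse x \<in> F0" "- x \<in> F0" if x: "x \<in> F0"
  proof -
    from x obtain a where "x = to_ac a" by blast
    thus "inverse x \<in> F0" "- x \<in> F0" using rangeI[of to_ac "inverse a"] rangeI[of to_ac "- a"] by simp_all
  qed
  show "x + y \<in> F0" "x * y \<in> F0" if xy: "x \<in> F0" "y \<in> F0"
  proof -
    from xy obtain a b where "x = to_ac a" "y = to_ac b" by blast
    thus "x + y \<in> F0" "x * y \<in> F0" using rangeI[of to_ac "a + b"] rangeI[of to_ac "a * b"] by simp_all
  qed
qed

lemma field_auts_iff:
  assumes "F0 \<subseteq> E"
  shows "\<sigma> \<in> field_auts E \<longleftrightarrow> \<sigma> \<in> extensional E \<and> is_aut F0 E \<sigma>"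
  by (auto simp: field_auts_def is_aut_def Bij_def)

interpretation ac: vector_space "ac_scale :: 'a::field \<Rightarrow> 'a alg_closure \<Rightarrow> 'a alg_closure"
  by unfold_locales (simp_all add: ac_scale_def algebra_simps)

lemma span_intermediate:
  assumes "intermediate_field E" "B \<subseteq> E" shows "ac.span B \<subseteq> E"
proof
  have E: "subfield_of E" "F0 \<subseteq> E" using assms by (auto simp: intermediate_field_iff)
  fix x assume "x \<in> ac.span B"
  thus "x \<in> E" by (induction rule: ac.span_induct_alt)
    (use assms E in \<open>auto simp: ac_scale_def intro!: subfield_of.zero subfield_of.add subfield_of.mult\<close>)
qed

lemma galois_finite:
  fixes E :: "'a::field alg_closure set"
  assumes "finite_extension E" "galois_extension E"
  shows "finite (field_auts E) \<and> card (field_auts E) = extension_degree E"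
proof -
  have E: "subfield_of E" "F0 \<subseteq> E" using assms by (auto simp: finite_extension_def intermediate_field_iff)
  obtain S where S: "finite S" "ac.span S = E" using assms(1) by (auto simp: finite_extension_def)
  obtain B where B: "B \<subseteq> E" "ac.independent B" "E \<subseteq> ac.span B" "card B = ac.dim E"
    by (rule ac.basis_exists[of E])
  have finB: "finite B" using ac.independent_span_bound[OF S(1) B(2)] B(1) S(2) by blast
  have "finite {\<sigma> \<in> extensional E. is_aut F0 E \<sigma>} \<and> card {\<sigma> \<in> extensional E. is_aut F0 E \<sigma>} = card B"
  proof (rule galois_degree[OF subfield_F0 E finB B(1)])
    show "\<exists>f. (\<forall>b\<in>B. f b \<in> F0) \<and> x = (\<Sum>b\<in>B. f b * b)" if x: "x \<in> E" for x
    proof -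
      have "x \<in> range (\<lambda>u. \<Sum>b\<in>B. ac_scale (u b) b)" using B(3) x ac.span_finite[OF finB] by blast
      then obtain u where "x = (\<Sum>b\<in>B. ac_scale (u b) b)" by blast
      thus ?thesis by (intro exI[of _ "\<lambda>b. to_ac (u b)"]) (simp add: ac_scale_def)
    qed
    show "\<forall>b\<in>B. f b = 0" if f: "\<forall>b\<in>B. f b \<in> F0" "(\<Sum>b\<in>B. f b * b) = 0" for f
    proof -
      define u where "u b = of_ac (f b)" for b
      have u: "to_ac (u b) = f b" if "b \<in> B" for b using f(1) that by (simp add: u_def to_ac_of_ac)
      have "(\<Sum>b\<in>B. ac_scale (u b) b) = (\<Sum>b\<in>B. f b * b)"
        by (intro sum.cong) (simp_all add: ac_scale_def u)
      hence "\<forall>b\<in>B. u b = 0" using B(2) f(2) ac.dependent_finite[OF finB] by auto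
      thus ?thesis using u by (metis to_ac_0)
    qed
    show "x \<in> F0" if x: "x \<in> E" "\<And>\<sigma>. is_aut F0 E \<sigma> \<Longrightarrow> \<sigma> x = x" for x
    proof -
      have "\<forall>\<sigma>\<in>field_auts E. \<sigma> x = x" using x(2) field_auts_iff[OF E(2)] by blast
      thus ?thesis using assms(2) x(1) unfolding galois_extension_def by blast
    qed
  qed
  moreover have "field_auts E = {\<sigma> \<in> extensional E. is_aut F0 E \<sigma>}" using field_auts_iff[OF E(2)] by blast
  ultimately show ?thesis using B(4) by (simp add: extension_degree_def)
qed

lemma galois_group_simps:
  "carrier (galois_group E) = field_auts E" "monoid.one (galois_group E) = (\<lambda>x\<in>E. x)"
  by (simp_all add: galois_group_def BijGroup_def)

lemma galois_group_mult:
  assumes "\<sigma> \<in> field_auts E" "\<tau> \<in> field_auts E"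
  shows "\<sigma> \<otimes>\<^bsub>galois_group E\<^esub> \<tau> = restrict (\<sigma> \<circ> \<tau>) E"
  using assms by (simp add: galois_group_def BijGroup_def field_auts_def compose_def restrict_def fun_eq_iff)

lemma field_auts_restrict:
  assumes "intermediate_field E" "is_aut F0 E \<sigma>" shows "restrict \<sigma> E \<in> field_auts E"
  using is_aut_cong[OF assms(2), of "restrict \<sigma> E"] assms(1) field_auts_iff[of E "restrict \<sigma> E"]
  by (simp add: intermediate_field_iff)

lemma galois_group_group:
  assumes E: "intermediate_field E" shows "group (galois_group E)"
proof (rule groupI)
  let ?G = "galois_group E"
  have E': "subfield_of E" "F0 \<subseteq> E" using E by (auto simp: intermediate_field_iff)
  have A: "is_aut F0 E \<sigma>" if "\<sigma> \<in> field_auts E" for \<sigma> using that field_auts_iff[OF E'(2)] by blast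
  have ext: "\<sigma> \<in> extensional E" if "\<sigma> \<in> field_auts E" for \<sigma> using that field_auts_iff[OF E'(2)] by blast
  have cl: "restrict (\<sigma> \<circ> \<tau>) E \<in> field_auts E" if "\<sigma> \<in> field_auts E" "\<tau> \<in> field_auts E" for \<sigma> \<tau>
    using field_auts_restrict[OF E is_aut_comp[OF A A]] that by blast
  have one: "(\<lambda>x\<in>E. x) \<in> field_auts E" using field_auts_restrict[OF E is_aut_id] by (simp add: id_def)
  show "\<one>\<^bsub>?G\<^esub> \<in> carrier ?G" using one by (simp add: galois_group_simps)
  show "x \<otimes>\<^bsub>?G\<^esub> y \<in> carrier ?G" if "x \<in> carrier ?G" "y \<in> carrier ?G" for x y
    using that cl by (simp add: galois_group_simps galois_group_mult)
  show "x \<otimes>\<^bsub>?G\<^esub> y \<otimes>\<^bsub>?G\<^esub> z = x \<otimes>\<^bsub>?G\<^esub> (y \<otimes>\<^bsub>?G\<^esub> z)" if "x \<in> carrier ?G" "y \<in> carrier ?G" "z \<in> carrier ?G" for x y z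
    using that cl is_autD(2)[OF A] by (auto simp: galois_group_simps galois_group_mult fun_eq_iff restrict_def)
  show "\<one>\<^bsub>?G\<^esub> \<otimes>\<^bsub>?G\<^esub> x = x" if x: "x \<in> carrier ?G" for x
  proof -
    have x': "x \<in> field_auts E" using x by (simp add: galois_group_simps)
    have "restrict ((\<lambda>x\<in>E. x) \<circ> x) E = x"
      by (rule extensionalityI[of _ E]) (use ext x' is_autD(2)[OF A[OF x']] in auto)
    thus ?thesis using x' one by (simp add: galois_group_simps(2) galois_group_mult)
  qed
  show "\<exists>y\<in>carrier ?G. y \<otimes>\<^bsub>?G\<^esub> x = \<one>\<^bsub>?G\<^esub>" if x: "x \<in> carrier ?G" for x
  proof
    have x': "x \<in> field_auts E" using x by (simp add: galois_group_simps)
    note I = is_aut_inv[OF A[OF x'] E']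
    let ?y = "restrict (inv_into E x) E"
    have y: "?y \<in> field_auts E" using field_auts_restrict[OF E I(1)] .
    thus "?y \<in> carrier ?G" by (simp add: galois_group_simps)
    show "?y \<otimes>\<^bsub>?G\<^esub> x = \<one>\<^bsub>?G\<^esub>" unfolding galois_group_mult[OF y x'] galois_group_simps
      by (rule restrict_ext) (use I(4) is_autD(2)[OF A[OF x']] in auto)
  qed
qed

text \<open>
  The conjugates of \<open>x\<close> over \<open>F\<close> are the roots of a polynomial with coefficients in the fixed field \<open>F\<close>, and
  \<open>\<sigma>\<close> permutes these roots.
\<close>

lemma galois_normal:
  fixes E M :: "'a::field alg_closure set"
  assumes E: "finite_extension E" "galois_extension E"
    and M: "subfield_of M" "E \<subseteq> M" "is_aut F0 M \<sigma>" and x: "x \<in> E"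
  shows "\<sigma> x \<in> E"
proof -
  have E': "subfield_of E" "F0 \<subseteq> E" and iE: "intermediate_field E" using E by (auto simp: finite_extension_def intermediate_field_iff)
  interpret E: subfield_of E by fact
  interpret M: subfield_of M by fact
  interpret G: group "galois_group E" by (rule galois_group_group[OF iE])
  have A: "is_aut F0 E \<gamma>" if "\<gamma> \<in> field_auts E" for \<gamma> using that field_auts_iff[OF E'(2)] by blast
  have fin: "finite (field_auts E)" using galois_finite E by blast
  define Z where "Z = (\<lambda>\<gamma>. \<gamma> x) ` field_auts E"
  have finZ: "finite Z" using fin by (simp add: Z_def)
  have ZE: "Z \<subseteq> E" using is_autD(2)[OF A] x by (auto simp: Z_def)
  let ?p = "\<lambda>f Z. \<Prod>z\<in>Z. [:- f z, 1:] :: 'a alg_closure poly"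
  have co: "\<forall>n. poly.coeff (?p id Y) n \<in> E \<and> \<gamma> (poly.coeff (?p id Y) n) = poly.coeff (?p \<gamma> Y) n"
    if "finite Y" "Y \<subseteq> E" and g: "\<gamma> \<in> field_auts E" for Y \<gamma>
    using that(1,2)
  proof (induction Y rule: finite_induct)
    case empty
    have "\<gamma> 1 = 1" "\<gamma> 0 = 0" using is_autD(5)[OF A[OF g]] subfield_of.one[OF subfield_F0] subfield_of.zero[OF subfield_F0] by blast+
    thus ?case by (simp add: E.one E.zero coeff_1)
  next
    case (insert z Y)
    note D = is_autD[OF A[OF g]] and D' = is_aut_field[OF A[OF g] E' subfield_F0]
    have IH: "poly.coeff (?p id Y) n \<in> E" "\<gamma> (poly.coeff (?p id Y) n) = poly.coeff (?p \<gamma> Y) n" for n using insert by auto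
    have zE: "z \<in> E" using insert by simp
    have c: "poly.coeff (?p f (insert z Y)) n = - f z * poly.coeff (?p f Y) n + (case n of 0 \<Rightarrow> 0 | Suc m \<Rightarrow> poly.coeff (?p f Y) m)" for f n
      using insert.hyps by (simp add: coeff_pCons split: nat.split)
    show ?case
    proof
      fix n
      define t where "t = (case n of 0 \<Rightarrow> 0 | Suc m \<Rightarrow> poly.coeff (?p id Y) m)"
      have g0: "\<gamma> 0 = 0" using D(5) subfield_of.zero[OF subfield_F0] by blast
      have t: "t \<in> E" "\<gamma> t = (case n of 0 \<Rightarrow> 0 | Suc m \<Rightarrow> poly.coeff (?p \<gamma> Y) m)"
        using IH g0 E.zero by (auto simp: t_def split: nat.split)
      define u where "u = - z * poly.coeff (?p id Y) n"
      have "poly.coeff (?p id (insert z Y)) n = u + t" unfolding c t_def u_def by simp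
      moreover have "u \<in> E" unfolding u_def using zE IH by (intro E.mult E.neg) auto
      moreover have "\<gamma> u = - \<gamma> z * poly.coeff (?p \<gamma> Y) n"
        unfolding u_def using D(4)[OF E.neg[OF zE] IH(1)] D'(1)[OF zE] IH(2) by simp
      ultimately show "poly.coeff (?p id (insert z Y)) n \<in> E \<and> \<gamma> (poly.coeff (?p id (insert z Y)) n) = poly.coeff (?p \<gamma> (insert z Y)) n"
        unfolding c[of \<gamma>] using t D(3)[of u t] E.add[of u t] by (simp only: simp_thms)
    qed
  qed
  have one: "(\<lambda>x\<in>E. x) \<in> field_auts E" using G.one_closed by (simp add: galois_group_simps)
  let ?P = "?p id Z"
  have inF: "poly.coeff ?P n \<in> F0" for n
  proof -
    have "poly.coeff ?P n \<in> E" using co[OF finZ ZE one] by blast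
    moreover have "\<gamma> (poly.coeff ?P n) = poly.coeff ?P n" if g: "\<gamma> \<in> field_auts E" for \<gamma>
    proof -
      have sub: "\<gamma> ` Z \<subseteq> Z"
      proof
        fix w assume "w \<in> \<gamma> ` Z"
        then obtain \<delta> where d: "\<delta> \<in> field_auts E" "w = \<gamma> (\<delta> x)" by (auto simp: Z_def)
        have "restrict (\<gamma> \<circ> \<delta>) E \<in> field_auts E"
          using field_auts_restrict[OF iE is_aut_comp[OF A[OF g] A[OF d(1)]]] .
        thus "w \<in> Z" unfolding Z_def d(2) using x by (intro image_eqI[of _ _ "restrict (\<gamma> \<circ> \<delta>) E"]) auto
      qed
      have inj: "inj_on \<gamma> Z" using is_autD(1)[OF A[OF g]] ZE by (meson bij_betw_def inj_on_subset)
      have "\<gamma> ` Z = Z" by (rule endo_inj_surj[OF finZ sub inj])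
      hence "?p \<gamma> Z = ?P" using prod.reindex[OF inj, of "\<lambda>z. [:- z, 1:]"] by (simp add: comp_def)
      thus ?thesis using co[OF finZ ZE g] by simp
    qed
    ultimately show ?thesis using E(2) unfolding galois_extension_def by blast
  qed
  have "x \<in> Z" unfolding Z_def using one x by (intro image_eqI[of _ _ "\<lambda>x\<in>E. x"]) auto
  hence p0: "poly ?P x = 0" using finZ by (auto simp: poly_prod)
  note D = is_autD[OF M(3)]
  have F0M: "F0 \<subseteq> M" using E' M by blast
  note D' = is_aut_field[OF M(3,1) F0M subfield_F0]
  have xM: "x \<in> M" using x M by blast
  have pw: "\<sigma> (x ^ n) = \<sigma> x ^ n" for n
  proof (induction n)
    case 0 thus ?case using D(5) subfield_of.one[OF subfield_F0] by simp
  next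
    case (Suc n) thus ?case using D(4)[OF xM M.power[OF xM]] by simp
  qed
  have "\<sigma> (poly ?P x) = (\<Sum>i\<le>Polynomial.degree ?P. \<sigma> (poly.coeff ?P i * x ^ i))"
    unfolding poly_altdef by (rule D'(4)) (use inF F0M xM in \<open>auto intro!: M.mult M.power\<close>)
  also have "\<dots> = (\<Sum>i\<le>Polynomial.degree ?P. poly.coeff ?P i * \<sigma> x ^ i)"
  proof (rule sum.cong[OF refl])
    fix i show "\<sigma> (poly.coeff ?P i * x ^ i) = poly.coeff ?P i * \<sigma> x ^ i"
      using D(4)[of "poly.coeff ?P i" "x ^ i"] D(5)[OF inF[of i]] pw inF[of i] F0M M.power[OF xM] by auto
  qed
  also have "\<dots> = poly ?P (\<sigma> x)" by (simp add: poly_altdef)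
  finally have "poly ?P (\<sigma> x) = 0" using p0 D(5)[OF subfield_of.zero[OF subfield_F0]] by simp
  hence "\<sigma> x \<in> Z" using finZ by (auto simp: poly_prod)
  thus ?thesis using ZE by blast
qed

section \<open>The Galois group of the maximal 2-extension\<close>

locale char_not_2 =
  fixes ty :: "'a::field itself"
  assumes two: "(2 :: 'a) \<noteq> 0"

sublocale char_not_2 \<subseteq> quadratically_closed_over "F0 :: 'a alg_closure set"
proof -
  have "(to_ac 2 :: 'a alg_closure) \<noteq> 0" using two to_ac_eq_0_iff by blast
  hence 2: "(2 :: 'a alg_closure) \<noteq> 0" by simp
  have "\<exists>y. y * y = x" for x :: "'a alg_closure"
    using nth_root_exists[of 2 x] by (auto simp: power2_eq_square)
  with 2 show "quadratically_closed_over (F0 :: 'a alg_closure set)"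
    unfolding quadratically_closed_over_def quadratically_closed_over_axioms_def using subfield_F0 by blast
qed

context char_not_2
begin

abbreviation L :: "'a alg_closure set" where "L \<equiv> maximal_2_extension ty"
abbreviation G :: "('a alg_closure \<Rightarrow> 'a alg_closure) monoid" where "G \<equiv> galois_group L"

text \<open>
  Ascend from \<open>F\<close> along subgroups.  If \<open>H\<close> has index two in \<open>H'\<close> and \<open>w\<close> represents the other coset, then for
  \<open>y\<close> fixed by \<open>H\<close> both \<open>y + w y\<close> and \<open>(y - w y)\<^sup>2\<close> are fixed by \<open>H'\<close>; so \<open>y\<close> is reached by one square
  root.
\<close>

lemma galois_2_sub_Q:
  assumes "finite_galois_2_extension (E :: 'a alg_closure set)" shows "E \<subseteq> Q"
proof -
  have E: "finite_extension E" "galois_extension E" and deg: "\<exists>k. extension_degree E = 2 ^ k"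
    using assms by (auto simp: finite_galois_2_extension_def)
  have iE: "intermediate_field E" and E': "subfield_of E" "F0 \<subseteq> E"
    using E by (auto simp: finite_extension_def intermediate_field_iff)
  interpret E: subfield_of E by fact
  let ?\<Gamma> = "galois_group E"
  interpret \<Gamma>: group ?\<Gamma> by (rule galois_group_group[OF iE])
  have c: "carrier ?\<Gamma> = field_auts E" by (simp add: galois_group_simps)
  have A: "is_aut F0 E \<gamma>" if "\<gamma> \<in> field_auts E" for \<gamma> using that field_auts_iff[OF E'(2)] by blast
  obtain k where k: "order ?\<Gamma> = 2 ^ k" using deg galois_finite[OF E] by (auto simp: order_def c)
  have fin: "finite (carrier ?\<Gamma>)" using galois_finite[OF E] c by simp
  have app: "(a \<otimes>\<^bsub>?\<Gamma>\<^esub> b) y = a (b y)" if "a \<in> carrier ?\<Gamma>" "b \<in> carrier ?\<Gamma>" "y \<in> E" for a b y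
    using that by (simp add: c galois_group_mult)
  have claim: "{y \<in> E. \<forall>h\<in>H. h y = y} \<subseteq> Q" if "subgroup H ?\<Gamma>" for H
    using that
  proof (induction "card (carrier ?\<Gamma>) - card H" arbitrary: H rule: less_induct)
    case less
    note H = less.prems
    have Hs: "H \<subseteq> carrier ?\<Gamma>" using H subgroup.subset by blast
    show ?case
    proof (cases "H = carrier ?\<Gamma>")
      case True
      hence "{y \<in> E. \<forall>h\<in>H. h y = y} = F0" using E(2) by (simp add: galois_extension_def c)
      thus ?thesis using F_sub_Q by simp
    next
      case False
      obtain x where x: "x \<in> carrier ?\<Gamma> - H" "x \<otimes>\<^bsub>?\<Gamma>\<^esub> x \<in> H" "\<forall>h\<in>H. x \<otimes>\<^bsub>?\<Gamma>\<^esub> h \<otimes>\<^bsub>?\<Gamma>\<^esub> inv\<^bsub>?\<Gamma>\<^esub> x \<in> H"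
        using \<Gamma>.two_group_step[OF k H False] by blast
      have xG: "x \<in> carrier ?\<Gamma>" and xH: "x \<notin> H" using x by auto
      define H' where "H' = H \<union> (H #>\<^bsub>?\<Gamma>\<^esub> x)"
      have sH': "subgroup H' ?\<Gamma>" unfolding H'_def by (rule \<Gamma>.subgroup_adjoin[OF H xG x(2,3)])
      have "x \<in> H'" using \<Gamma>.rcos_self[OF xG H] by (simp add: H'_def)
      hence "H \<subset> H'" using xH H'_def by blast
      moreover have "finite H'" using finite_subset[OF subgroup.subset[OF sH'] fin] .
      ultimately have "card H < card H'" by (rule psubset_card_mono[rotated])
      moreover have "card H' \<le> card (carrier ?\<Gamma>)" using card_mono[OF fin subgroup.subset[OF sH']] .
      ultimately have IH: "{y \<in> E. \<forall>h\<in>H'. h y = y} \<subseteq> Q" by (intro less.hyps[OF _ sH']) simp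
      define w where "w = inv\<^bsub>?\<Gamma>\<^esub> x"
      have wG: "w \<in> carrier ?\<Gamma>" using xG by (simp add: w_def)
      note Aw = is_autD[OF A[OF wG[unfolded c]]]
      show ?thesis
      proof
        fix y assume "y \<in> {y \<in> E. \<forall>h\<in>H. h y = y}"
        hence yE: "y \<in> E" and hy: "\<And>h. h \<in> H \<Longrightarrow> h y = y" by auto
        have wyE: "w y \<in> E" by (rule Aw(2)[OF yE])
        have hwy: "h (w y) = w y" if h: "h \<in> H" for h
        proof -
          have hG: "h \<in> carrier ?\<Gamma>" using h Hs by blast
          let ?h = "x \<otimes>\<^bsub>?\<Gamma>\<^esub> h \<otimes>\<^bsub>?\<Gamma>\<^esub> w"
          have "?h \<in> H" using x(3) h by (simp add: w_def)
          moreover have "w \<otimes>\<^bsub>?\<Gamma>\<^esub> ?h = h \<otimes>\<^bsub>?\<Gamma>\<^esub> w" using hG xG by (simp add: w_def \<Gamma>.m_assoc)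
          ultimately show ?thesis using app[OF hG wG yE] app[OF wG _ yE, of ?h] hy Hs by (metis subsetD)
        qed
        have xwy: "x (w y) = y"
        proof -
          have "x \<otimes>\<^bsub>?\<Gamma>\<^esub> w = \<one>\<^bsub>?\<Gamma>\<^esub>" using xG by (simp add: w_def)
          thus ?thesis using app[OF xG wG yE] yE by (simp add: galois_group_simps)
        qed
        have xy: "x y = w y"
        proof -
          have "w \<otimes>\<^bsub>?\<Gamma>\<^esub> (x \<otimes>\<^bsub>?\<Gamma>\<^esub> x) = x" using xG by (simp add: w_def)
          thus ?thesis using app[OF wG _ yE, of "x \<otimes>\<^bsub>?\<Gamma>\<^esub> x"] hy[OF x(2)] xG by simp
        qed
        have H'c: "(\<forall>z\<in>{y, w y}. g z = z) \<or> (g y = w y \<and> g (w y) = y)" if g: "g \<in> H'" for g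
        proof (cases "g \<in> H")
          case True thus ?thesis using hy hwy by simp
        next
          case False
          then obtain h where h: "h \<in> H" "g = h \<otimes>\<^bsub>?\<Gamma>\<^esub> x" using g by (auto simp: H'_def r_coset_def)
          have hG: "h \<in> carrier ?\<Gamma>" using h Hs by blast
          have "g y = w y" "g (w y) = y" unfolding h(2) app[OF hG xG yE] app[OF hG xG wyE]
            using xy xwy hwy[OF h(1)] hy[OF h(1)] by simp_all
          thus ?thesis by simp
        qed
        have gG: "is_aut F0 E g" if "g \<in> H'" for g using that subgroup.subset[OF sH'] A c by blast
        let ?s = "y + w y" and ?d = "y - w y"
        have "?s \<in> Q"
        proof (rule subsetD[OF IH], intro CollectI conjI ballI)
          show "?s \<in> E" using yE wyE E.add by blast
          fix g assume g: "g \<in> H'"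
          have "g ?s = g y + g (w y)" by (rule is_autD(3)[OF gG[OF g] yE wyE])
          thus "g ?s = ?s" using H'c[OF g] by (auto simp: add.commute)
        qed
        moreover have "?d * ?d \<in> Q"
        proof (rule subsetD[OF IH], intro CollectI conjI ballI)
          have dE: "?d \<in> E" using yE wyE E.diff by blast
          show "?d * ?d \<in> E" using dE E.mult by blast
          fix g assume g: "g \<in> H'"
          have "g (?d * ?d) = g ?d * g ?d" by (rule is_autD(4)[OF gG[OF g] dE dE])
          also have "g ?d = g y - g (w y)" by (rule is_aut_field(3)[OF gG[OF g] E' subfield_F0 yE wyE])
          also have "\<dots> * \<dots> = ?d * ?d" using H'c[OF g] by (auto simp: algebra_simps)
          finally show "g (?d * ?d) = ?d * ?d" .
        qed
        hence "?d \<in> Q" by (rule Q_sqrt)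
        ultimately have "(?s + ?d) / 2 \<in> Q" by (rule Q.div[OF Q.add Q.two])
        moreover have "(?s + ?d) / 2 = y" using two_nz by (simp add: field_simps)
        ultimately show "y \<in> Q" by simp
      qed
    qed
  qed
  have "{y \<in> E. \<forall>h\<in>{\<one>\<^bsub>?\<Gamma>\<^esub>}. h y = y} \<subseteq> Q" by (rule claim[OF \<Gamma>.triv_subgroup])
  moreover have "\<one>\<^bsub>?\<Gamma>\<^esub> y = y" if "y \<in> E" for y using that by (simp add: galois_group_simps)
  ultimately show ?thesis by auto
qed

lemma intermediate_L: "intermediate_field L"
proof -
  have "subfield_of L" unfolding maximal_2_extension_def
    by (rule subfield_Inter) (auto simp: intermediate_field_iff)
  moreover have "F0 \<subseteq> L" unfolding maximal_2_extension_def by (auto simp: intermediate_field_iff)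
  ultimately show ?thesis by (simp add: intermediate_field_iff)
qed

lemma subfield_L: "subfield_of L" and F0_sub_L: "F0 \<subseteq> L"
  using intermediate_L by (auto simp: intermediate_field_iff)

lemma galois_2_sub_L: "finite_galois_2_extension E \<Longrightarrow> E \<subseteq> L"
  unfolding maximal_2_extension_def by blast

lemma L_least: "intermediate_field M \<Longrightarrow> (\<And>E. finite_galois_2_extension E \<Longrightarrow> E \<subseteq> M) \<Longrightarrow> L \<subseteq> M"
  unfolding maximal_2_extension_def by blast

lemma L_sub_Q: "L \<subseteq> Q"
  by (rule L_least) (use F_sub_Q Q.subfield_of_axioms galois_2_sub_Q in \<open>auto simp: intermediate_field_iff\<close>)

text \<open>
  By normality an automorphism of \<open>Q\<close> preserves each of the finite extensions generating \<open>L\<close>.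
\<close>

lemma aut_Q_L:
  assumes \<sigma>: "is_aut F0 Q \<sigma>" shows "is_aut F0 L \<sigma>"
proof -
  interpret L: subfield_of L by (rule subfield_L)
  have stable: "\<tau> x \<in> L" if \<tau>: "is_aut F0 Q \<tau>" and x: "x \<in> L" for \<tau> x
  proof -
    note D = is_autD[OF \<tau>] and D' = is_aut_field[OF \<tau> Q.subfield_of_axioms F_sub_Q subfield_F0]
    let ?M = "{x \<in> L. \<tau> x \<in> L}"
    have "subfield_of ?M"
    proof unfold_locales
      show "1 \<in> ?M" using D(5)[OF subfield_of.one[OF subfield_F0]] L.one by simp
      fix x assume x: "x \<in> ?M"
      hence xQ: "x \<in> Q" using L_sub_Q by blast
      show "- x \<in> ?M" "inverse x \<in> ?M" using x D'(1)[OF xQ] D'(2)[OF xQ] L.neg L.inv by auto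
      fix y assume y: "y \<in> ?M"
      hence yQ: "y \<in> Q" using L_sub_Q by blast
      show "x + y \<in> ?M" "x * y \<in> ?M" using x y D(3)[OF xQ yQ] D(4)[OF xQ yQ] L.add L.mult by auto
    qed
    moreover have "c \<in> ?M" if "c \<in> F0" for c using D(5)[OF that] that F0_sub_L by auto
    hence "F0 \<subseteq> ?M" by blast
    moreover have "E \<subseteq> ?M" if E: "finite_galois_2_extension E" for E
    proof
      fix z assume z: "z \<in> E"
      have "\<tau> z \<in> E"
        by (rule galois_normal[OF _ _ Q.subfield_of_axioms galois_2_sub_Q[OF E] \<tau> z])
           (use E in \<open>auto simp: finite_galois_2_extension_def\<close>)
      thus "z \<in> ?M" using z galois_2_sub_L[OF E] by blast
    qed
    ultimately have "L \<subseteq> ?M" by (intro L_least) (auto simp: intermediate_field_iff)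
    thus ?thesis using x by blast
  qed
  note D = is_autD[OF \<sigma>] and I = is_aut_inv[OF \<sigma> Q.subfield_of_axioms F_sub_Q]
  have "bij_betw \<sigma> L L"
  proof (rule bij_betwI')
    show "(\<sigma> x = \<sigma> y) = (x = y)" if "x \<in> L" "y \<in> L" for x y using D(6) that L_sub_Q by blast
    show "\<sigma> x \<in> L" if "x \<in> L" for x using stable[OF \<sigma> that] .
    show "\<exists>x\<in>L. y = \<sigma> x" if y: "y \<in> L" for y
      using stable[OF I(1) y] I(2)[of y] y L_sub_Q by (metis subsetD)
  qed
  thus ?thesis unfolding is_aut_def using D(3,4,5) L_sub_Q by blast
qed

lemma G_carrier: "g \<in> carrier G \<longleftrightarrow> g \<in> extensional L \<and> is_aut F0 L g"
  by (simp add: galois_group_simps field_auts_iff[OF F0_sub_L])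

lemma G_aut: "g \<in> carrier G \<Longrightarrow> is_aut F0 L g" by (simp add: G_carrier)

lemma restrict_aut_Q: "is_aut F0 Q \<sigma> \<Longrightarrow> restrict \<sigma> L \<in> carrier G"
  using field_auts_restrict[OF intermediate_L aut_Q_L] by (simp add: galois_group_simps)

lemma G_extend:
  assumes g: "g \<in> carrier G"
  obtains \<sigma> where "is_aut F0 Q \<sigma>" "\<And>x. x \<in> L \<Longrightarrow> \<sigma> x = g x"
proof -
  interpret L: subfield_of L by (rule subfield_L)
  note D = is_autD[OF G_aut[OF g]] and D' = is_aut_field[OF G_aut[OF g] subfield_L F0_sub_L subfield_F0]
  let ?A = "(\<lambda>x. (x, g x)) ` L"
  have A: "(a, b) \<in> ?A \<longleftrightarrow> a \<in> L \<and> b = g a" for a b by auto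
  have h1: "hom_graph ?A" unfolding hom_graph_def A
    using D(3,4) D(5)[OF subfield_of.one[OF subfield_F0]] D(5)[OF subfield_of.zero[OF subfield_F0]] D'(1,2)
    by (auto intro: L.closed)
  have h2: "?A \<subseteq> Q \<times> Q" using D(2) L_sub_Q by auto
  have "(c, c) \<in> ?A" if "c \<in> F0" for c using A[of c c] D(5)[OF that] that F0_sub_L by auto
  hence h3: "Id_on F0 \<subseteq> ?A" by auto
  obtain \<sigma> where s: "is_aut F0 Q \<sigma>" "\<And>a b. (a, b) \<in> ?A \<Longrightarrow> \<sigma> a = b"
    by (rule extend_to_aut[OF h1 h2 h3]) (rule that, assumption+)
  show ?thesis using that[OF s(1)] s(2) by blast
qed

lemma G_fixed: 
  assumes "x \<in> L" "\<And>g. g \<in> carrier G \<Longrightarrow> g x = x" shows "x \<in> F0"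
proof (rule ccontr)
  assume n: "x \<notin> F0"
  have "x \<in> Q" using assms(1) L_sub_Q by blast
  from moved_by_aut[OF this n] obtain \<sigma> where s: "is_aut F0 Q \<sigma>" "\<sigma> x \<noteq> x" by blast
  thus False using assms(2)[OF restrict_aut_Q[OF s(1)]] assms(1) by simp
qed

sublocale G: group G by (rule galois_group_group[OF intermediate_L])

lemma G_mult: "g \<in> carrier G \<Longrightarrow> h \<in> carrier G \<Longrightarrow> x \<in> L \<Longrightarrow> (g \<otimes>\<^bsub>G\<^esub> h) x = g (h x)"
  by (simp add: galois_group_simps galois_group_mult)

lemma G_one: "x \<in> L \<Longrightarrow> \<one>\<^bsub>G\<^esub> x = x"
  by (simp add: galois_group_simps)

lemma G_inv:
  assumes "g \<in> carrier G" "x \<in> L" shows "(inv\<^bsub>G\<^esub> g) (g x) = x" "g ((inv\<^bsub>G\<^esub> g) x) = x"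
  using G_mult[of "inv\<^bsub>G\<^esub> g" g x] G_mult[of g "inv\<^bsub>G\<^esub> g" x] G_one assms by simp_all

lemma G_pow: "g \<in> carrier G \<Longrightarrow> x \<in> L \<Longrightarrow> (g [^]\<^bsub>G\<^esub> (n::nat)) x = (g ^^ n) x"
proof (induction n arbitrary: x)
  case 0 thus ?case by (simp add: G_one)
next
  case (Suc n)
  have "g x \<in> L" using is_autD(2)[OF G_aut] Suc.prems by blast
  thus ?case using Suc by (simp add: G_mult funpow_swap1)
qed

lemma G_two_power:
  assumes g: "g \<in> carrier G" and x: "x \<in> L"
  shows "\<exists>m. (g [^]\<^bsub>G\<^esub> ((2::nat) ^ m)) x = x"
proof -
  obtain \<sigma> where s: "is_aut F0 Q \<sigma>" "\<And>x. x \<in> L \<Longrightarrow> \<sigma> x = g x" using G_extend[OF g] by blast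
  have it: "(\<sigma> ^^ n) y = (g ^^ n) y \<and> (g ^^ n) y \<in> L" if "y \<in> L" for n y
    by (induction n) (use that s(2) is_autD(2)[OF G_aut[OF g]] in auto)
  obtain m where "(\<sigma> ^^ (2 ^ m)) x = x" using aut_two_power[OF s(1)] x L_sub_Q by blast
  thus ?thesis using it[OF x] G_pow[OF g x] by auto
qed

definition \<N> :: "('a alg_closure \<Rightarrow> 'a alg_closure) set set" where
  "\<N> = {{\<tau> \<in> carrier G. \<forall>x\<in>E. \<tau> x = x} | E. finite_extension E \<and> galois_extension E \<and> E \<subseteq> L}"

text \<open>
  \<open>F\<close> itself is an admissible finite Galois extension; it provides a member of \<open>\<N>\<close>.
\<close>

lemma base_galois: "finite_extension (F0 :: 'a alg_closure set)" "galois_extension (F0 :: 'a alg_closure set)"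
proof -
  have i: "intermediate_field (F0 :: 'a alg_closure set)" by (simp add: intermediate_field_iff subfield_F0)
  have "ac.span {1 :: 'a alg_closure} = F0"
  proof
    show "ac.span {1 :: 'a alg_closure} \<subseteq> F0" by (rule span_intermediate[OF i]) (use subfield_of.one[OF subfield_F0] in auto)
    show "F0 \<subseteq> ac.span {1 :: 'a alg_closure}"
    proof
      fix x :: "'a alg_closure" assume "x \<in> F0"
      then obtain c where "x = ac_scale c 1" by (auto simp: ac_scale_def)
      thus "x \<in> ac.span {1}" using ac.span_scale[OF ac.span_base] by blast
    qed
  qed
  thus "finite_extension (F0 :: 'a alg_closure set)" using i unfolding finite_extension_def by blast
  show "galois_extension (F0 :: 'a alg_closure set)" using i unfolding galois_extension_def
    by (auto simp: field_auts_def)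
qed

lemma stabilizer_subgroup:
  assumes "S \<subseteq> L" shows "subgroup {\<tau> \<in> carrier G. \<forall>x\<in>S. \<tau> x = x} G"
proof (rule G.subgroupI)
  show "{\<tau> \<in> carrier G. \<forall>x\<in>S. \<tau> x = x} \<noteq> {}" using G.one_closed G_one assms by blast
  fix a assume a: "a \<in> {\<tau> \<in> carrier G. \<forall>x\<in>S. \<tau> x = x}"
  show "inv\<^bsub>G\<^esub> a \<in> {\<tau> \<in> carrier G. \<forall>x\<in>S. \<tau> x = x}"
    using a G_inv(1)[of a] assms by (auto simp: subset_iff) (metis)
  fix b assume "b \<in> {\<tau> \<in> carrier G. \<forall>x\<in>S. \<tau> x = x}"
  thus "a \<otimes>\<^bsub>G\<^esub> b \<in> {\<tau> \<in> carrier G. \<forall>x\<in>S. \<tau> x = x}" using a assms G_mult by (auto simp: subset_iff)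
qed auto

lemma G_stable:
  assumes "finite_extension E" "galois_extension E" "E \<subseteq> L" "g \<in> carrier G" "x \<in> E"
  shows "g x \<in> E"
  using galois_normal[OF assms(1,2) subfield_L assms(3) G_aut[OF assms(4)] assms(5)] .

sublocale P: pro_2_topology G \<N>
proof (rule pro_2_topology.intro[OF G.is_group], rule pro_2_topology_axioms.intro)
  show "\<N> \<noteq> {}" unfolding \<N>_def using base_galois F0_sub_L by blast
  fix N assume "N \<in> \<N>"
  then obtain E where E: "finite_extension E" "galois_extension E" "E \<subseteq> L"
    and N: "N = {\<tau> \<in> carrier G. \<forall>x\<in>E. \<tau> x = x}" unfolding \<N>_def by blast
  have iE: "intermediate_field E" using E by (simp add: finite_extension_def)
  have sN: "subgroup N G" unfolding N by (rule stabilizer_subgroup[OF E(3)])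
  have conj: "g \<otimes>\<^bsub>G\<^esub> h \<otimes>\<^bsub>G\<^esub> inv\<^bsub>G\<^esub> g \<in> N" if g: "g \<in> carrier G" and h: "h \<in> N" for g h
  proof -
    have hG: "h \<in> carrier G" using h N by blast
    have "(g \<otimes>\<^bsub>G\<^esub> h \<otimes>\<^bsub>G\<^esub> inv\<^bsub>G\<^esub> g) x = x" if x: "x \<in> E" for x
    proof -
      let ?y = "(inv\<^bsub>G\<^esub> g) x"
      have y: "?y \<in> E" using G_stable[OF E _ x] g by simp
      have "(g \<otimes>\<^bsub>G\<^esub> h \<otimes>\<^bsub>G\<^esub> inv\<^bsub>G\<^esub> g) x = g (h ?y)" using g hG x y E(3) by (simp add: G_mult subset_iff)
      also have "h ?y = ?y" using h y N by blast
      also have "g ?y = x" using G_inv(2)[OF g] x E(3) by blast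
      finally show ?thesis .
    qed
    thus ?thesis unfolding N using g hG by simp
  qed
  show "N \<lhd> G" using sN conj by (simp add: G.normal_inv_iff)
  show "finite (rcosets\<^bsub>G\<^esub> N)"
  proof -
    have "rcosets\<^bsub>G\<^esub> N \<subseteq> (\<lambda>\<phi>. {h \<in> carrier G. \<forall>x\<in>E. h x = \<phi> x}) ` field_auts E"
    proof
      fix C assume "C \<in> rcosets\<^bsub>G\<^esub> N"
      then obtain g where g: "g \<in> carrier G" "C = N #>\<^bsub>G\<^esub> g" by (auto simp: RCOSETS_def)
      have "is_aut F0 E g"
      proof -
        note D = is_autD[OF G_aut[OF g(1)]]
        have "bij_betw g E E"
        proof (rule bij_betwI')
          show "(g x = g y) = (x = y)" if "x \<in> E" "y \<in> E" for x y using D(6) that E(3) by blast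
          show "g x \<in> E" if "x \<in> E" for x using G_stable[OF E g(1) that] .
          show "\<exists>x\<in>E. y = g x" if y: "y \<in> E" for y
            using G_stable[OF E _ y, of "inv\<^bsub>G\<^esub> g"] G_inv(2)[OF g(1), of y] g(1) y E(3)
            by (metis G.inv_closed subsetD)
        qed
        thus ?thesis unfolding is_aut_def using D(3,4,5) E(3) by blast
      qed
      hence 1: "restrict g E \<in> field_auts E" by (rule field_auts_restrict[OF iE])
      have "C = {h \<in> carrier G. \<forall>x\<in>E. h x = restrict g E x}"
      proof (intro equalityI subsetI)
        fix h assume "h \<in> C"
        then obtain n where n: "n \<in> N" "h = n \<otimes>\<^bsub>G\<^esub> g" using g by (auto simp: r_coset_def)
        have nG: "n \<in> carrier G" using n N by blast
        have "h x = g x" if x: "x \<in> E" for x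
          using n nG g(1) x E(3) G_stable[OF E g(1) x] G_mult[OF nG g(1), of x] N by auto
        thus "h \<in> {h \<in> carrier G. \<forall>x\<in>E. h x = restrict g E x}" using n nG g(1) by auto
      next
        fix h assume "h \<in> {h \<in> carrier G. \<forall>x\<in>E. h x = restrict g E x}"
        hence h: "h \<in> carrier G" "\<And>x. x \<in> E \<Longrightarrow> h x = g x" by auto
        let ?n = "h \<otimes>\<^bsub>G\<^esub> inv\<^bsub>G\<^esub> g"
        have "?n x = x" if x: "x \<in> E" for x
        proof -
          have "(inv\<^bsub>G\<^esub> g) x \<in> E" using G_stable[OF E _ x] g(1) by simp
          thus ?thesis using h g(1) x E(3) G_inv(2)[OF g(1)] by (auto simp: G_mult subset_iff)
        qed
        hence "?n \<in> N" unfolding N using h(1) g(1) by simp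
        moreover have "h = ?n \<otimes>\<^bsub>G\<^esub> g" using h(1) g(1) by (simp add: G.m_assoc)
        ultimately show "h \<in> C" unfolding g(2) r_coset_def by blast
      qed
      thus "C \<in> (\<lambda>\<phi>. {h \<in> carrier G. \<forall>x\<in>E. h x = \<phi> x}) ` field_auts E" using 1 by blast
    qed
    thus ?thesis by (rule finite_subset) (use galois_finite[OF E(1,2)] in simp)
  qed
  fix g assume g: "g \<in> carrier G"
  obtain B where B: "finite B" "ac.span B = E" using E(1) by (auto simp: finite_extension_def)
  have BE: "B \<subseteq> E" using B(2) ac.span_superset by blast
  have "\<exists>m. \<forall>b\<in>B. (g [^]\<^bsub>G\<^esub> ((2::nat) ^ m)) b = b"
    using B(1) BE
  proof (induction B rule: finite_induct)
    case empty thus ?case by simp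
  next
    case (insert b B)
    have up: "(g [^]\<^bsub>G\<^esub> ((2::nat) ^ (m + n))) x = x" if "(g [^]\<^bsub>G\<^esub> ((2::nat) ^ m)) x = x" "x \<in> L" for m n x
    proof -
      let ?h = "g [^]\<^bsub>G\<^esub> ((2::nat) ^ m)"
      have "(?h ^^ j) x = x" for j using that(1) by (induction j) auto
      hence "(?h [^]\<^bsub>G\<^esub> ((2::nat) ^ n)) x = x" using G_pow[of ?h x] g that(2) by simp
      thus ?thesis using g by (simp add: G.nat_pow_pow power_add)
    qed
    obtain m where m: "\<forall>b\<in>B. (g [^]\<^bsub>G\<^esub> ((2::nat) ^ m)) b = b" using insert by auto
    have bL: "b \<in> L" "B \<subseteq> L" using insert.prems E(3) by auto
    obtain n where n: "(g [^]\<^bsub>G\<^esub> ((2::nat) ^ n)) b = b" using G_two_power[OF g bL(1)] by blast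
    have "\<forall>c\<in>insert b B. (g [^]\<^bsub>G\<^esub> ((2::nat) ^ (m + n))) c = c"
      using up[of m _ n] up[OF n bL(1), of m] m bL by (auto simp: add.commute)
    thus ?case by blast
  qed
  then obtain m where m: "\<forall>b\<in>B. (g [^]\<^bsub>G\<^esub> ((2::nat) ^ m)) b = b" by blast
  let ?h = "g [^]\<^bsub>G\<^esub> ((2::nat) ^ m)"
  have hG: "?h \<in> carrier G" using g by simp
  note D = is_autD[OF G_aut[OF hG]]
  have "x \<in> L \<and> ?h x = x" if "x \<in> ac.span B" for x
    using that
  proof (induction rule: ac.span_induct_alt)
    case base thus ?case using D(5)[OF subfield_of.zero[OF subfield_F0]] subfield_of.zero[OF subfield_L] by blast
  next
    case (step c x y)
    have xL: "x \<in> L" "y \<in> L" "to_ac c \<in> L" using step BE E(3) F0_sub_L by auto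
    have cx: "ac_scale c x \<in> L" unfolding ac_scale_def by (rule subfield_of.mult[OF subfield_L xL(3,1)])
    have "?h (ac_scale c x) = ac_scale c x"
      using D(4)[OF xL(3,1)] D(5)[of "to_ac c"] m step(1) by (simp add: ac_scale_def)
    thus ?case using D(3)[OF cx xL(2)] subfield_of.add[OF subfield_L cx xL(2)] step by simp
  qed
  thus "\<exists>m. g [^]\<^bsub>G\<^esub> ((2::nat) ^ m) \<in> N" unfolding N using B(2) hG by blast
qed

lemma krull_eq: "krull_topology L = P.T"
proof -
  have "{{\<tau> \<in> field_auts L. \<forall>x\<in>E. \<tau> x = \<sigma> x} | \<sigma> E. \<sigma> \<in> field_auts L \<and> finite_extension E \<and> galois_extension E \<and> E \<subseteq> L}
     = {g <#\<^bsub>G\<^esub> N | g N. g \<in> carrier G \<and> N \<in> \<N>}"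
  proof -
    have *: "{\<tau> \<in> field_auts L. \<forall>x\<in>E. \<tau> x = \<sigma> x} = \<sigma> <#\<^bsub>G\<^esub> {\<tau> \<in> carrier G. \<forall>x\<in>E. \<tau> x = x}"
      if s: "\<sigma> \<in> carrier G" and E: "E \<subseteq> L" for \<sigma> E
    proof (intro equalityI subsetI)
      fix \<tau> assume "\<tau> \<in> {\<tau> \<in> field_auts L. \<forall>x\<in>E. \<tau> x = \<sigma> x}"
      hence t: "\<tau> \<in> carrier G" "\<And>x. x \<in> E \<Longrightarrow> \<tau> x = \<sigma> x" by (auto simp: galois_group_simps)
      let ?n = "inv\<^bsub>G\<^esub> \<sigma> \<otimes>\<^bsub>G\<^esub> \<tau>"
      have "?n x = x" if "x \<in> E" for x using that t s E G_inv(1)[OF s] by (auto simp: G_mult subset_iff)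
      moreover have "\<tau> = \<sigma> \<otimes>\<^bsub>G\<^esub> ?n" using t s by simp
      ultimately show "\<tau> \<in> \<sigma> <#\<^bsub>G\<^esub> {\<tau> \<in> carrier G. \<forall>x\<in>E. \<tau> x = x}"
        unfolding l_coset_def using t s by blast
    next
      fix \<tau> assume "\<tau> \<in> \<sigma> <#\<^bsub>G\<^esub> {\<tau> \<in> carrier G. \<forall>x\<in>E. \<tau> x = x}"
      then obtain n where n: "n \<in> carrier G" "\<forall>x\<in>E. n x = x" "\<tau> = \<sigma> \<otimes>\<^bsub>G\<^esub> n" by (auto simp: l_coset_def)
      have "\<tau> x = \<sigma> x" if "x \<in> E" for x using n that s E G_mult[OF s n(1), of x] by auto
      moreover have "\<tau> \<in> field_auts L" using n s G.m_closed[OF s n(1)] by (simp add: galois_group_simps)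
      ultimately show "\<tau> \<in> {\<tau> \<in> field_auts L. \<forall>x\<in>E. \<tau> x = \<sigma> x}" by blast
    qed
    have c: "carrier G = field_auts L" by (simp add: galois_group_simps)
    show ?thesis unfolding \<N>_def using * c by blast
  qed
  thus ?thesis unfolding krull_topology_def P.T_def by simp
qed

end

context char_not_2
begin

section \<open>Kummer theory in degree two\<close>

lemma quadratic_extension:
  fixes y :: "'a alg_closure"
  assumes yy: "y * y \<in> F0" and y: "y \<notin> F0"
  shows "finite_galois_2_extension (adjoin F0 y)"
proof -
  interpret F: subfield_of "F0 :: 'a alg_closure set" by (rule subfield_F0)
  let ?E = "adjoin F0 y"
  have E: "subfield_of ?E" "F0 \<subseteq> ?E" "y \<in> ?E" using F.adjoin_subfield[OF y yy] F.sub_adjoin by blast+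
  have iE: "intermediate_field ?E" using E by (simp add: intermediate_field_iff)
  have y1: "1 \<noteq> y" using y F.one by blast
  have span: "ac.span {1, y} = ?E"
  proof
    show "ac.span {1, y} \<subseteq> ?E" by (rule span_intermediate[OF iE]) (use E F.one in auto)
    show "?E \<subseteq> ac.span {1, y}"
    proof
      fix x assume "x \<in> ?E"
      then obtain a b where x: "x = to_ac a + to_ac b * y" unfolding adjoin_def by blast
      have "x = ac_scale a 1 + ac_scale b y" by (simp add: x ac_scale_def)
      thus "x \<in> ac.span {1, y}" by (auto intro!: ac.span_add ac.span_scale intro: ac.span_base)
    qed
  qed
  have fin: "finite_extension ?E" 
    unfolding finite_extension_def by (intro conjI iE exI[of _ "{1, y}"] span) simp
  have "ac.independent {1, y}"
  proof
    assume "ac.dependent {1, y}"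
    then obtain u where u: "u 1 \<noteq> 0 \<or> u y \<noteq> 0" "(\<Sum>v\<in>{1, y}. ac_scale (u v) v) = 0"
      using ac.dependent_finite[of "{1, y}"] by auto
    have "to_ac (u 1) + to_ac (u y) * y = 0" using u(2) y1 by (simp add: ac_scale_def)
    hence "to_ac (u 1) = 0 \<and> to_ac (u y) = 0" by (intro F.adjoin_unique[OF y]) auto
    thus False using u(1) by simp
  qed
  from ac.dim_span_eq_card_independent[OF this] have "ac.dim ?E = 2" using y1 span by simp
  hence deg: "extension_degree ?E = 2 ^ 1" by (simp add: extension_degree_def)
  have yQ: "y \<in> Q" using Q_sqrt[of y] yy F_sub_Q by blast
  have EQ: "?E \<subseteq> Q" unfolding adjoin_def using yQ F_sub_Q by (auto intro!: Q.add Q.mult)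
  have "x \<in> F0" if x: "x \<in> ?E" "\<forall>\<sigma>\<in>field_auts ?E. \<sigma> x = x" for x
  proof (rule ccontr)
    assume n: "x \<notin> F0"
    have "x \<in> Q" using x(1) EQ by blast
    from moved_by_aut[OF this n] obtain \<sigma> where s: "is_aut F0 Q \<sigma>" "\<sigma> x \<noteq> x" by blast
    note D = is_autD[OF s(1)]
    have "\<sigma> y * \<sigma> y = y * y" using D(4)[OF yQ yQ] D(5)[OF yy] by simp
    hence sy: "\<sigma> y = y \<or> \<sigma> y = - y" by (rule square_eq_cases)
    have app: "\<sigma> (u + v * y) = u + v * \<sigma> y" if uv: "u \<in> F0" "v \<in> F0" for u v
    proof -
      have uvQ: "u \<in> Q" "v \<in> Q" using uv F_sub_Q by auto
      show ?thesis using D(3)[OF uvQ(1) Q.mult[OF uvQ(2) yQ]] D(4)[OF uvQ(2) yQ] D(5)[OF uv(1)] D(5)[OF uv(2)] by simp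
    qed
    have st: "\<sigma> z \<in> ?E \<and> (\<exists>z'\<in>?E. \<sigma> z' = z)" if z: "z \<in> ?E" for z
    proof -
      obtain u v where h: "z = u + v * y" "u \<in> F0" "v \<in> F0" using z unfolding adjoin_def by blast
      have m: "u + (- v) * y \<in> ?E" using h F.neg unfolding adjoin_def by blast
      from sy show ?thesis
      proof
        assume "\<sigma> y = y" thus ?thesis using app[OF h(2,3)] h z by (metis)
      next
        assume e: "\<sigma> y = - y"
        have "\<sigma> z = u + (- v) * y" using app[OF h(2,3)] h(1) e by simp
        moreover have "\<sigma> (u + (- v) * y) = z" using app[OF h(2) F.neg[OF h(3)]] h(1) e by simp
        ultimately show ?thesis using m by metis
      qed
    qed
    have "bij_betw \<sigma> ?E ?E"
    proof (rule bij_betwI')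
      show "(\<sigma> x = \<sigma> y) = (x = y)" if "x \<in> ?E" "y \<in> ?E" for x y using D(6) that EQ by blast
    qed (use st in metis)+
    hence "is_aut F0 ?E \<sigma>" unfolding is_aut_def using D(3,4,5) EQ by blast
    from field_auts_restrict[OF iE this] show False using x s(2) by fastforce
  qed
  moreover have "\<sigma> c = c" if "\<sigma> \<in> field_auts ?E" "c \<in> F0" for \<sigma> c
    using that by (auto simp: field_auts_def)
  ultimately have "galois_extension ?E" unfolding galois_extension_def using iE E(2) by blast
  thus ?thesis using fin deg unfolding finite_galois_2_extension_def by blast
qed

lemma sqrt_in_L:
  fixes y :: "'a alg_closure"
  assumes "y * y \<in> F0" shows "y \<in> L"
proof (cases "y \<in> F0")
  case True thus ?thesis using F0_sub_L by blast
next
  case False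
  have "y \<in> adjoin F0 y" by (rule subfield_of.sub_adjoin(2)[OF subfield_F0])
  thus ?thesis using galois_2_sub_L[OF quadratic_extension[OF assms False]] by blast
qed

lemma G_sqrt:
  assumes "g \<in> carrier G" "y * y \<in> F0" shows "g y = y \<or> g y = - y"
proof -
  note D = is_autD[OF G_aut[OF assms(1)]]
  have yL: "y \<in> L" by (rule sqrt_in_L[OF assms(2)])
  have "g y * g y = y * y" using D(4)[OF yL yL] D(5)[OF assms(2)] by simp
  thus ?thesis by (rule square_eq_cases)
qed

lemma G_neg: "g \<in> carrier G \<Longrightarrow> x \<in> L \<Longrightarrow> g (- x) = - g x"
  using is_aut_field(1)[OF G_aut subfield_L F0_sub_L subfield_F0] .

lemma stabilizer_index_two:
  assumes yy: "y * y \<in> F0" and y: "y \<notin> F0"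
  shows "index_two G {g \<in> carrier G. g y = y}" "closedin P.T {g \<in> carrier G. g y = y}"
proof -
  let ?M = "{g \<in> carrier G. g y = y}"
  have yL: "y \<in> L" by (rule sqrt_in_L[OF yy])
  have sM: "subgroup ?M G" using stabilizer_subgroup[of "{y}"] yL by simp
  have "?M \<noteq> carrier G" using G_fixed[OF yL] y by blast
  moreover have "g \<otimes>\<^bsub>G\<^esub> h \<in> ?M" if "g \<in> carrier G - ?M" "h \<in> carrier G - ?M" for g h
  proof -
    have gh: "g \<in> carrier G" "h \<in> carrier G" using that by auto
    have "g y = - y" "h y = - y" using G_sqrt[OF gh(1) yy] G_sqrt[OF gh(2) yy] that by auto
    hence "(g \<otimes>\<^bsub>G\<^esub> h) y = y" using G_mult[OF gh yL] G_neg[OF gh(1) yL] by simp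
    thus ?thesis using gh by simp
  qed
  ultimately show "index_two G ?M" unfolding index_two_def using sM by blast
  let ?E = "adjoin F0 y"
  have E: "finite_galois_2_extension ?E" by (rule quadratic_extension[OF yy y])
  let ?N = "{\<tau> \<in> carrier G. \<forall>x\<in>?E. \<tau> x = x}"
  have "?N \<in> \<N>" unfolding \<N>_def using E galois_2_sub_L[OF E] by (auto simp: finite_galois_2_extension_def)
  hence "?N \<in> P.\<K>" by (rule P.N_in_K)
  moreover have "?N \<subseteq> ?M" using subfield_of.sub_adjoin(2)[OF subfield_F0, of y] by blast
  ultimately show "closedin P.T ?M" using P.closedin_super sM by blast
qed

text \<open>
  \<open>M\<close> is the kernel of a sign character trivial on some open normal subgroup \<open>K\<close>.  The finitely many
  restrictions of \<open>G\<close> to the fixed field \<open>D\<close> of \<open>K\<close> are independent, so the projection onto the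
  eigenspace of this character does not vanish; any nonzero value \<open>y\<close> of it is the required square
  root.
\<close>

lemma index_two_stabilizer:
  assumes M: "index_two G M" "closedin P.T M"
  obtains y where "y * y \<in> F0" "y \<notin> F0" "M = {g \<in> carrier G. g y = y}"
proof -
  have sM: "subgroup M G" "M \<noteq> carrier G" and MM: "\<And>x y. x \<in> carrier G - M \<Longrightarrow> y \<in> carrier G - M \<Longrightarrow> x \<otimes>\<^bsub>G\<^esub> y \<in> M"
    using M(1) by (auto simp: index_two_def)
  have MG: "M \<subseteq> carrier G" using sM subgroup.subset by blast
  interpret L: subfield_of L by (rule subfield_L)
  obtain c0 where c0: "c0 \<in> carrier G" "c0 \<notin> M" using sM MG by blast
  have coset: "carrier G - M = M #>\<^bsub>G\<^esub> c0"
  proof (intro equalityI subsetI)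
    fix x assume x: "x \<in> carrier G - M"
    have "inv\<^bsub>G\<^esub> c0 \<notin> M" using subgroup.m_inv_closed[OF sM(1), of "inv\<^bsub>G\<^esub> c0"] c0 by auto
    hence "x \<otimes>\<^bsub>G\<^esub> inv\<^bsub>G\<^esub> c0 \<in> M" using MM x c0 by simp
    moreover have "x = (x \<otimes>\<^bsub>G\<^esub> inv\<^bsub>G\<^esub> c0) \<otimes>\<^bsub>G\<^esub> c0" using x c0 by (simp add: G.m_assoc)
    ultimately show "x \<in> M #>\<^bsub>G\<^esub> c0" unfolding r_coset_def by blast
  next
    fix x assume "x \<in> M #>\<^bsub>G\<^esub> c0"
    then obtain m where m: "m \<in> M" "x = m \<otimes>\<^bsub>G\<^esub> c0" by (auto simp: r_coset_def)
    have mG: "m \<in> carrier G" using m MG by blast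
    have "x \<notin> M"
    proof
      assume "x \<in> M"
      hence "inv\<^bsub>G\<^esub> m \<otimes>\<^bsub>G\<^esub> x \<in> M" using m sM(1) by (simp add: subgroup.m_closed subgroup.m_inv_closed)
      thus False using m(2) mG c0 by simp
    qed
    thus "x \<in> carrier G - M" using m mG c0 by simp
  qed
  have "closedin P.T (carrier G - M)" unfolding coset by (rule P.closedin_rcoset[OF M(2) c0(1)])
  hence "openin P.T (carrier G - (carrier G - M))" using P.topspace_T by (metis openin_diff openin_topspace)
  moreover have "carrier G - (carrier G - M) = M" using MG by blast
  ultimately have "openin P.T M" by simp
  then obtain K where K: "K \<in> P.\<K>" "\<And>h. h \<in> carrier G \<Longrightarrow> inv\<^bsub>G\<^esub> \<one>\<^bsub>G\<^esub> \<otimes>\<^bsub>G\<^esub> h \<in> K \<Longrightarrow> h \<in> M"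
    using P.openin_iff[of M] subgroup.one_closed[OF sM(1)] by blast
  interpret K: normal K G by (rule P.K_normal[OF K(1)])
  have KM: "K \<subseteq> M" using K(2) K.subset by auto
  define D where "D = {x \<in> L. \<forall>k\<in>K. k x = x}"
  have DL: "D \<subseteq> L" by (auto simp: D_def)
  have D1: "1 \<in> D" unfolding D_def using L.one is_autD(5)[OF G_aut] K.subset subfield_of.one[OF subfield_F0] by blast
  have Dm: "x * y \<in> D" if "x \<in> D" "y \<in> D" for x y
  proof -
    have "k (x * y) = x * y" if k: "k \<in> K" for k
    proof -
      have "k (x * y) = k x * k y" using \<open>x \<in> D\<close> \<open>y \<in> D\<close> DL k K.subset by (intro is_autD(4)[OF G_aut]) auto
      moreover have "k x = x" "k y = y" using \<open>x \<in> D\<close> \<open>y \<in> D\<close> k unfolding D_def by blast+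
      ultimately show ?thesis by simp
    qed
    thus ?thesis using that DL L.mult unfolding D_def by blast
  qed
  have Dg: "g x \<in> D" if g: "g \<in> carrier G" and x: "x \<in> D" for g x
  proof -
    have xL: "x \<in> L" using x DL by blast
    have "k (g x) = g x" if k: "k \<in> K" for k
    proof -
      have kG: "k \<in> carrier G" using k K.subset by blast
      have "inv\<^bsub>G\<^esub> g \<otimes>\<^bsub>G\<^esub> k \<otimes>\<^bsub>G\<^esub> g \<in> K" by (rule K.inv_op_closed1[OF g k])
      hence "(inv\<^bsub>G\<^esub> g \<otimes>\<^bsub>G\<^esub> k \<otimes>\<^bsub>G\<^esub> g) x = x" using x unfolding D_def by blast
      moreover have "g \<otimes>\<^bsub>G\<^esub> (inv\<^bsub>G\<^esub> g \<otimes>\<^bsub>G\<^esub> k \<otimes>\<^bsub>G\<^esub> g) = k \<otimes>\<^bsub>G\<^esub> g" using g kG by (simp add: G.m_assoc)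
      ultimately show ?thesis using G_mult[OF kG g xL] G_mult[OF g _ xL, of "inv\<^bsub>G\<^esub> g \<otimes>\<^bsub>G\<^esub> k \<otimes>\<^bsub>G\<^esub> g"] g kG by simp
    qed
    thus ?thesis using is_autD(2)[OF G_aut[OF g] xL] by (simp add: D_def)
  qed
  have faithful: "k \<in> K" if k: "k \<in> carrier G" "\<And>x. x \<in> D \<Longrightarrow> k x = x" for k
  proof -
    obtain \<F> where F: "\<F> \<subseteq> \<N>" "K = \<Inter>\<F>" using K(1) unfolding P.\<K>_def by blast
    have "k \<in> N" if N: "N \<in> \<F>" for N
    proof -
      obtain E where E: "E \<subseteq> L" "N = {\<tau> \<in> carrier G. \<forall>x\<in>E. \<tau> x = x}" using N F unfolding \<N>_def by blast
      have "E \<subseteq> D" using E F(2) N by (auto simp: D_def)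
      thus ?thesis using E(2) k by blast
    qed
    thus ?thesis using F(2) by blast
  qed
  let ?r = "\<lambda>g. restrict g D"
  define \<Phi> where "\<Phi> = ?r ` carrier G"
  have fin: "finite \<Phi>"
  proof -
    have "?r g = ?r (SOME h. h \<in> K #>\<^bsub>G\<^esub> g)" if g: "g \<in> carrier G" for g
    proof -
      have "\<exists>h. h \<in> K #>\<^bsub>G\<^esub> g" using G.rcos_self[OF g K.subgroup_axioms] by blast
      hence "(SOME h. h \<in> K #>\<^bsub>G\<^esub> g) \<in> K #>\<^bsub>G\<^esub> g" by (rule someI_ex)
      then obtain k where k: "k \<in> K" "(SOME h. h \<in> K #>\<^bsub>G\<^esub> g) = k \<otimes>\<^bsub>G\<^esub> g" by (auto simp: r_coset_def)
      have kG: "k \<in> carrier G" using k K.subset by blast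
      have "(k \<otimes>\<^bsub>G\<^esub> g) x = g x" if x: "x \<in> D" for x
        using G_mult[OF kG g, of x] Dg[OF g x] k(1) x DL by (auto simp: D_def)
      thus ?thesis unfolding k(2) by (intro restrict_ext) simp
    qed
    hence "\<Phi> \<subseteq> (\<lambda>C. ?r (SOME h. h \<in> C)) ` (rcosets\<^bsub>G\<^esub> K)" unfolding \<Phi>_def RCOSETS_def by blast
    thus ?thesis by (rule finite_subset) (use P.K_finite_index[OF K(1)] in simp)
  qed
  define c where "c \<phi> = (if \<exists>g\<in>M. \<phi> = ?r g then 1 else - 1 :: 'a alg_closure)" for \<phi>
  have cr: "c (?r g) = (if g \<in> M then 1 else - 1)" if g: "g \<in> carrier G" for g
  proof -
    have "g \<in> M" if h: "h \<in> M" "?r g = ?r h" for h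
    proof -
      have hG: "h \<in> carrier G" using h MG by blast
      have "(inv\<^bsub>G\<^esub> h \<otimes>\<^bsub>G\<^esub> g) x = x" if x: "x \<in> D" for x
      proof -
        have "g x = h x" using fun_cong[OF h(2), of x] x by simp
        thus ?thesis using G_mult[of "inv\<^bsub>G\<^esub> h" g x] G_inv(1)[OF hG, of x] g hG x DL by auto
      qed
      hence "inv\<^bsub>G\<^esub> h \<otimes>\<^bsub>G\<^esub> g \<in> M" using faithful[of "inv\<^bsub>G\<^esub> h \<otimes>\<^bsub>G\<^esub> g"] g hG KM by auto
      hence "h \<otimes>\<^bsub>G\<^esub> (inv\<^bsub>G\<^esub> h \<otimes>\<^bsub>G\<^esub> g) \<in> M" by (rule subgroup.m_closed[OF sM(1) h(1)])
      thus ?thesis using g hG by simp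
    qed
    thus ?thesis unfolding c_def by auto
  qed
  have "\<exists>x\<in>D. (\<Sum>\<phi>\<in>\<Phi>. c \<phi> * \<phi> x) \<noteq> 0"
  proof (rule ccontr)
    assume n: "\<not> ?thesis"
    have "\<forall>\<phi>\<in>\<Phi>. c \<phi> = 0"
    proof (rule character_independence[OF fin D1 Dm])
      show "\<phi> 1 = 1" if "\<phi> \<in> \<Phi>" for \<phi>
        using that D1 is_autD(5)[OF G_aut subfield_of.one[OF subfield_F0]] by (auto simp: \<Phi>_def)
      show "\<phi> (x * y) = \<phi> x * \<phi> y" if "\<phi> \<in> \<Phi>" "x \<in> D" "y \<in> D" for \<phi> x y
        using that Dm is_autD(4)[OF G_aut] DL by (auto simp: \<Phi>_def subset_iff)
      show "\<exists>x\<in>D. \<phi> x \<noteq> \<psi> x" if "\<phi> \<in> \<Phi>" "\<psi> \<in> \<Phi>" "\<phi> \<noteq> \<psi>" for \<phi> \<psi>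
      proof -
        have "\<phi> \<in> extensional D" "\<psi> \<in> extensional D" using that by (auto simp: \<Phi>_def)
        thus ?thesis using that(3) extensionalityI by blast
      qed
    next
      fix z assume "z \<in> D"
      show "(\<Sum>\<phi>\<in>\<Phi>. c \<phi> * \<phi> z) = 0"
        by (rule ccontr) (rule notE[OF n bexI[OF _ \<open>z \<in> D\<close>]])
    qed
    moreover have "?r \<one>\<^bsub>G\<^esub> \<in> \<Phi>" by (simp add: \<Phi>_def)
    ultimately have "c (?r \<one>\<^bsub>G\<^esub>) = 0" by blast
    thus False using cr[OF G.one_closed] by (auto split: if_splits)
  qed
  then obtain x where x: "x \<in> D" and nz: "(\<Sum>\<phi>\<in>\<Phi>. c \<phi> * \<phi> x) \<noteq> 0" by blast
  define y where "y = (\<Sum>\<phi>\<in>\<Phi>. c \<phi> * \<phi> x)"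
  have \<phi>L: "\<phi> x \<in> L" if "\<phi> \<in> \<Phi>" for \<phi> using that Dg x DL by (auto simp: \<Phi>_def)
  have F1: "(1 :: 'a alg_closure) \<in> F0" by (rule subfield_of.one[OF subfield_F0])
  have "(- 1 :: 'a alg_closure) \<in> F0" by (rule subfield_of.neg[OF subfield_F0 F1])
  with F1 have cF: "c \<phi> \<in> F0" for \<phi> unfolding c_def by simp
  have cL: "c \<phi> \<in> L" for \<phi> using cF F0_sub_L by blast
  have yL: "y \<in> L" unfolding y_def using \<phi>L cL by (intro L.sum L.mult)
  have gy: "g y = (if g \<in> M then y else - y)" if g: "g \<in> carrier G" for g
  proof -
    note A = is_autD[OF G_aut[OF g]]
    let ?t = "\<lambda>\<phi>. ?r (g \<circ> \<phi>)"
    have t: "?t (?r h) = ?r (g \<otimes>\<^bsub>G\<^esub> h)" if h: "h \<in> carrier G" for h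
      by (rule restrict_ext) (use G_mult[OF g h] DL in auto)
    have inj: "inj_on ?t \<Phi>"
    proof (rule inj_onI)
      fix \<phi> \<psi> assume h: "\<phi> \<in> \<Phi>" "\<psi> \<in> \<Phi>" "?t \<phi> = ?t \<psi>"
      have "\<phi> z = \<psi> z" if z: "z \<in> D" for z
      proof -
        have "g (\<phi> z) = g (\<psi> z)" using fun_cong[OF h(3), of z] z by simp
        moreover have "\<phi> z \<in> L" "\<psi> z \<in> L" using h(1,2) z Dg DL by (auto simp: \<Phi>_def)
        ultimately show ?thesis using A(6) by blast
      qed
      thus "\<phi> = \<psi>" using h(1,2) by (intro extensionalityI[of _ D]) (auto simp: \<Phi>_def)
    qed
    have "?t ` \<Phi> \<subseteq> \<Phi>" using t g by (auto simp: \<Phi>_def)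
    hence surj: "?t ` \<Phi> = \<Phi>" by (rule endo_inj_surj[OF fin _ inj])
    let ?e = "if g \<in> M then 1 else - 1 :: 'a alg_closure"
    have ct: "c (?t \<phi>) = ?e * c \<phi>" if "\<phi> \<in> \<Phi>" for \<phi>
    proof -
      obtain h where h: "h \<in> carrier G" "\<phi> = ?r h" using \<open>\<phi> \<in> \<Phi>\<close> by (auto simp: \<Phi>_def)
      have "g \<otimes>\<^bsub>G\<^esub> h \<in> M \<longleftrightarrow> (g \<in> M \<longleftrightarrow> h \<in> M)"
      proof (cases "g \<in> M")
        case True
        have "h \<in> M" if gh: "g \<otimes>\<^bsub>G\<^esub> h \<in> M"
        proof -
          have "inv\<^bsub>G\<^esub> g \<otimes>\<^bsub>G\<^esub> (g \<otimes>\<^bsub>G\<^esub> h) \<in> M" 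
            by (rule subgroup.m_closed[OF sM(1) subgroup.m_inv_closed[OF sM(1) True] gh])
          thus ?thesis using g h by simp
        qed
        thus ?thesis using True subgroup.m_closed[OF sM(1)] by blast
      next
        case False
        have "g \<otimes>\<^bsub>G\<^esub> h \<notin> M" if hM: "h \<in> M"
        proof
          assume "g \<otimes>\<^bsub>G\<^esub> h \<in> M"
          hence "(g \<otimes>\<^bsub>G\<^esub> h) \<otimes>\<^bsub>G\<^esub> inv\<^bsub>G\<^esub> h \<in> M"
            by (rule subgroup.m_closed[OF sM(1) _ subgroup.m_inv_closed[OF sM(1) hM]])
          thus False using g h False by (simp add: G.m_assoc)
        qed
        thus ?thesis using False MM g h by blast
      qed
      thus ?thesis unfolding h(2) t[OF h(1)] using cr[OF h(1)] cr[of "g \<otimes>\<^bsub>G\<^esub> h"] g h(1) by simp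
    qed
    have "g y = (\<Sum>\<phi>\<in>\<Phi>. g (c \<phi> * \<phi> x))" unfolding y_def
      by (rule is_aut_field(4)[OF G_aut[OF g] subfield_L F0_sub_L subfield_F0]) (use \<phi>L cL L.mult in blast)
    also have "\<dots> = (\<Sum>\<phi>\<in>\<Phi>. ?e * (c (?t \<phi>) * (?t \<phi>) x))"
    proof (rule sum.cong[OF refl])
      fix \<phi> assume p: "\<phi> \<in> \<Phi>"
      have "g (c \<phi> * \<phi> x) = c \<phi> * g (\<phi> x)" using A(4)[OF cL \<phi>L[OF p]] A(5)[OF cF] by simp
      thus "g (c \<phi> * \<phi> x) = ?e * (c (?t \<phi>) * (?t \<phi>) x)" using ct[OF p] x by simp
    qed
    also have "\<dots> = ?e * (\<Sum>\<phi>\<in>?t ` \<Phi>. c \<phi> * \<phi> x)"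
      unfolding sum_distrib_left[symmetric] by (subst sum.reindex[OF inj]) (simp add: comp_def)
    also have "\<dots> = ?e * y" unfolding surj y_def ..
    finally show ?thesis by simp
  qed
  have yn: "y \<noteq> - y"
  proof
    assume "y = - y"
    hence "2 * y = 0" by (metis mult_2 add.right_inverse)
    thus False using two_nz nz by (simp add: y_def)
  qed
  have "y * y \<in> F0"
  proof (rule G_fixed)
    show "y * y \<in> L" using yL L.mult by blast
    show "g (y * y) = y * y" if "g \<in> carrier G" for g
      using is_autD(4)[OF G_aut[OF that] yL yL] gy[OF that] by (auto split: if_splits)
  qed
  moreover have "y \<notin> F0" using is_autD(5)[OF G_aut[OF c0(1)]] gy[OF c0(1)] c0(2) yn by force
  moreover have "M = {g \<in> carrier G. g y = y}"
  proof (intro equalityI subsetI)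
    show "g \<in> {g \<in> carrier G. g y = y}" if "g \<in> M" for g using that gy[of g] MG by auto
    show "g \<in> M" if "g \<in> {g \<in> carrier G. g y = y}" for g using that gy[of g] yn by (auto split: if_splits)
  qed
  ultimately show ?thesis using that by blast
qed

section \<open>Orderings\<close>

lemma orderingD:
  assumes "r \<in> field_orderings ty"
  shows "(0, a) \<in> r \<or> (0, - a) \<in> r" "(0, a) \<in> r \<Longrightarrow> (0, - a) \<in> r \<Longrightarrow> a = 0"
    "(0, a) \<in> r \<Longrightarrow> (0, b) \<in> r \<Longrightarrow> (0, a + b) \<in> r" "(0, a) \<in> r \<Longrightarrow> (0, b) \<in> r \<Longrightarrow> (0, a * b) \<in> r"
    "(a, b) \<in> r \<longleftrightarrow> (0, b - a) \<in> r" "(0, a * a) \<in> r"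
proof -
  have lin: "linear_order r" and tr: "\<And>x y z. (x, y) \<in> r \<Longrightarrow> (x + z, y + z) \<in> r"
    and mu: "\<And>x y. (0, x) \<in> r \<Longrightarrow> (0, y) \<in> r \<Longrightarrow> (0, x * y) \<in> r"
    using assms by (auto simp: field_orderings_def)
  have tot: "(x, y) \<in> r \<or> (y, x) \<in> r" for x y
    using lin by (cases "x = y") (auto simp: linear_order_on_def partial_order_on_def preorder_on_def refl_on_def total_on_def)
  have as: "x = y" if "(x, y) \<in> r" "(y, x) \<in> r" for x y
    using lin that by (auto simp: linear_order_on_def partial_order_on_def antisym_def)
  have tra: "(x, z) \<in> r" if "(x, y) \<in> r" "(y, z) \<in> r" for x y z
    using lin that unfolding linear_order_on_def partial_order_on_def preorder_on_def trans_def by blast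
  show e: "(a, b) \<in> r \<longleftrightarrow> (0, b - a) \<in> r" for a b
    using tr[of a b "- a"] tr[of 0 "b - a" a] by auto
  show t: "(0, a) \<in> r \<or> (0, - a) \<in> r" for a using tot[of 0 a] e[of a 0] by auto
  show "a = 0" if "(0, a) \<in> r" "(0, - a) \<in> r" using as[of a 0] e[of a 0] that by auto
  show "(0, a + b) \<in> r" if "(0, a) \<in> r" "(0, b) \<in> r" using tra[OF that(1), of "a + b"] e[of a "a + b"] that by auto
  show "(0, a) \<in> r \<Longrightarrow> (0, b) \<in> r \<Longrightarrow> (0, a * b) \<in> r" by (rule mu)
  show "(0, a * a) \<in> r" using t[of a] mu[of a a] mu[of "- a" "- a"] by auto
qed

lemma ordering_eqI:
  assumes "r \<in> field_orderings ty" "r' \<in> field_orderings ty" "\<And>a. (0, a) \<in> r \<longleftrightarrow> (0, a) \<in> r'"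
  shows "r = r'"
  using orderingD(5)[OF assms(1)] orderingD(5)[OF assms(2)] assms(3) by auto

lemma neg_mem_ordering:
  assumes "r \<in> field_orderings ty" "a \<noteq> 0" shows "(0, - a) \<in> r \<longleftrightarrow> (0, a) \<notin> r"
  using orderingD(1,2)[OF assms(1), of a] assms(2) by blast

text \<open>
  For positive \<open>a\<close> the square roots lie in the euclidean hull, which the conjugation fixes; for negative \<open>a\<close>
  they are multiples of a square root of \<open>-1\<close>.
\<close>

lemma ordering_involution:
  assumes r: "r \<in> field_orderings ty"
  shows "\<exists>g\<in>carrier G. g \<otimes>\<^bsub>G\<^esub> g = \<one>\<^bsub>G\<^esub> \<and> (\<forall>a y. y * y = to_ac a \<longrightarrow> a \<noteq> 0 \<longrightarrow> (g y = y \<longleftrightarrow> (0, a) \<in> r))"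
proof -
  note O = orderingD[OF r]
  let ?P = "to_ac ` {a. (0, a) \<in> r}"
  have P1: "?P \<subseteq> F0" by blast
  have P2: "p * q \<in> ?P" if "p \<in> ?P" "q \<in> ?P" for p q using that O(4) by (auto simp flip: to_ac_mult)
  have P3: "p + q \<in> ?P" if "p \<in> ?P" "q \<in> ?P" for p q using that O(3) by (auto simp flip: to_ac_add)
  have P4: "x * x \<in> ?P" if "x \<in> F0" for x using that O(6) by (auto simp flip: to_ac_mult)
  have P5: "- 1 \<notin> ?P"
  proof
    assume "- 1 \<in> ?P"
    then obtain a where a: "(0, a) \<in> r" "to_ac a = to_ac (- 1)" by auto
    hence "a = - 1" using to_ac_eq_iff by blast
    hence "(0, - 1) \<in> r" using a(1) by simp
    thus False using O(2)[of 1] O(6)[of 1] by simp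
  qed
  obtain \<sigma> R where s: "is_aut F0 Q \<sigma>" "\<And>x. x \<in> Q \<Longrightarrow> \<sigma> (\<sigma> x) = x"
    and R: "subfield_of R" "F0 \<subseteq> R" "R \<subseteq> Q" "\<And>x. x \<in> R \<Longrightarrow> \<sigma> x = x" "\<And>p. p \<in> ?P \<Longrightarrow> \<exists>y\<in>R. p = y * y"
    and i: "\<And>i. i * i = - 1 \<Longrightarrow> \<sigma> i = - i"
    by (rule involution[OF P1 P2 P3 P4 P5], assumption+) (rule that, assumption+)
  interpret R: subfield_of R by fact
  define g where "g = restrict \<sigma> L"
  have gG: "g \<in> carrier G" unfolding g_def by (rule restrict_aut_Q[OF s(1)])
  have sL: "\<sigma> x \<in> L" if "x \<in> L" for x using is_autD(2)[OF aut_Q_L[OF s(1)] that] .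
  have "g \<otimes>\<^bsub>G\<^esub> g = \<one>\<^bsub>G\<^esub>"
  proof -
    have "g \<otimes>\<^bsub>G\<^esub> g = restrict (g \<circ> g) L" using gG by (simp add: galois_group_simps galois_group_mult)
    also have "\<dots> = (\<lambda>x\<in>L. x)" by (rule restrict_ext) (use sL s(2) L_sub_Q in \<open>auto simp: g_def\<close>)
    finally show ?thesis by (simp add: galois_group_simps)
  qed
  moreover have "g y = y \<longleftrightarrow> (0, a) \<in> r" if y: "y * y = to_ac a" "a \<noteq> 0" for a y
  proof -
    have yL: "y \<in> L" by (rule sqrt_in_L) (simp add: y)
    have gy: "g y = \<sigma> y" using yL by (simp add: g_def)
    have y0: "y \<noteq> 0" using y by auto
    show ?thesis
    proof (cases "(0, a) \<in> r")
      case True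
      then obtain z where z: "z \<in> R" "to_ac a = z * z" using R(5)[of "to_ac a"] by blast
      have "y = z \<or> y = - z" by (rule square_eq_cases) (use y z in simp)
      hence "y \<in> R" using z R.neg by blast
      thus ?thesis using True R(4) gy by simp
    next
      case False
      hence "(0, - a) \<in> r" using O(1) by blast
      then obtain z where z: "z \<in> R" "to_ac (- a) = z * z" using R(5)[of "to_ac (- a)"] by blast
      have z0: "z \<noteq> 0" using z y by auto
      have "(y / z) * (y / z) = (y * y) / (z * z)" by simp
      also have "\<dots> = - 1" unfolding y(1) z(2)[symmetric] using y(2) by simp
      finally have yz: "\<sigma> (y / z) = - (y / z)" by (rule i)
      have zQ: "z \<in> Q" and yQ: "y \<in> Q" using z R(3) yL L_sub_Q by auto
      have "\<sigma> y = \<sigma> (y / z * z)" using z0 by simp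
      also have "\<dots> = \<sigma> (y / z) * \<sigma> z" by (rule is_autD(4)[OF s(1) Q.div[OF yQ zQ] zQ])
      also have "\<dots> = - y" using yz R(4)[OF z(1)] z0 by simp
      finally have "\<sigma> y = - y" .
      moreover have "- y \<noteq> y"
      proof
        assume "- y = y"
        hence "2 * y = 0" by (metis mult_2 add.right_inverse)
        thus False using two_nz y0 by simp
      qed
      ultimately show ?thesis using False gy by simp
    qed
  qed
  ultimately show ?thesis using gG by blast
qed

end

context char_not_2
begin

text \<open>
  For a nonsquare \<open>a\<close> the elements \<open>x\<^sup>2 - a y\<^sup>2\<close> form a preordering, because in a Pythagorean field sums
  of squares are squares.  The order induced by its euclidean hull makes \<open>a\<close> negative.
\<close>

lemma nonsquare_negative:
  assumes fr: "is_formally_real_pythagorean ty" and a: "\<And>b :: 'a. a \<noteq> b * b"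
  shows "\<exists>r\<in>field_orderings ty. (0, a) \<notin> r"
proof -
  have sum2: "\<exists>w. u * u + v * v = w * w" for u v :: 'a
  proof -
    have "\<exists>y. (\<Sum>x\<leftarrow>[u, v]. x ^ 2) = y ^ 2"
      using fr unfolding is_formally_real_pythagorean_def is_pythagorean_def by blast
    thus ?thesis by (simp add: power2_eq_square)
  qed
  have real: "- 1 \<noteq> y * y" for y :: 'a
    using fr unfolding is_formally_real_pythagorean_def by (auto simp: power2_eq_square)
  define S where "S = {x * x - a * (y * y) | x y. True}"
  have S: "x * x - a * (y * y) \<in> S" for x y unfolding S_def by blast
  have S_add: "p + q \<in> S" if pq: "p \<in> S" "q \<in> S" for p q
  proof -
    obtain x y where p: "p = x * x - a * (y * y)" using pq unfolding S_def by blast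
    obtain u v where q: "q = u * u - a * (v * v)" using pq unfolding S_def by blast
    obtain s where s: "x * x + u * u = s * s" using sum2 by blast
    obtain t where t: "y * y + v * v = t * t" using sum2 by blast
    have "p + q = (x * x + u * u) - a * (y * y + v * v)" unfolding p q by (simp add: algebra_simps)
    thus ?thesis unfolding s t using S by simp
  qed
  have S_mult: "p * q \<in> S" if pq: "p \<in> S" "q \<in> S" for p q
  proof -
    obtain x y where p: "p = x * x - a * (y * y)" using pq unfolding S_def by blast
    obtain u v where q: "q = u * u - a * (v * v)" using pq unfolding S_def by blast
    obtain s where s: "(x * u) * (x * u) + (a * y * v) * (a * y * v) = s * s" using sum2 by blast
    obtain t where t: "(x * v) * (x * v) + (y * u) * (y * u) = t * t" using sum2 by blast
    have "p * q = ((x * u) * (x * u) + (a * y * v) * (a * y * v)) - a * ((x * v) * (x * v) + (y * u) * (y * u))"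
      unfolding p q by (simp add: algebra_simps)
    thus ?thesis unfolding s t using S by simp
  qed
  have S_neg: "- 1 \<notin> S"
  proof
    assume "- 1 \<in> S"
    then obtain x y where xy: "- 1 = x * x - a * (y * y)" unfolding S_def by blast
    have "y \<noteq> 0" using xy real[of x] by auto
    obtain s where s: "1 * 1 + x * x = s * s" using sum2 by blast
    have "a * (y * y) = 1 + x * x" using xy by (simp add: algebra_simps eq_diff_eq)
    hence "a * (y * y) = s * s" using s by simp
    hence "a = (s / y) * (s / y)" using \<open>y \<noteq> 0\<close> by (simp add: field_simps)
    thus False using a by blast
  qed
  let ?P = "to_ac ` S"
  have P1: "?P \<subseteq> F0" by blast
  have P2: "p * q \<in> ?P" if "p \<in> ?P" "q \<in> ?P" for p q using that S_mult by (auto simp flip: to_ac_mult)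
  have P3: "p + q \<in> ?P" if "p \<in> ?P" "q \<in> ?P" for p q using that S_add by (auto simp flip: to_ac_add)
  have P4: "x * x \<in> ?P" if "x \<in> F0" for x using that S[of _ 0] by (auto simp flip: to_ac_mult)
  have P5: "- 1 \<notin> ?P"
  proof
    assume "- 1 \<in> ?P"
    then obtain b where b: "b \<in> S" "to_ac b = to_ac (- 1)" by auto
    hence "b = - 1" using to_ac_eq_iff by blast
    thus False using b S_neg by simp
  qed
  obtain R where R: "subfield_of R" "F0 \<subseteq> R" "R \<subseteq> Q" "\<And>p. p \<in> ?P \<Longrightarrow> \<exists>y\<in>R. p = y * y"
    "\<And>x. x \<in> R \<Longrightarrow> (\<exists>y\<in>R. x = y * y) \<or> (\<exists>y\<in>R. - x = y * y)"
    "\<And>x. x \<in> R \<Longrightarrow> x * x \<noteq> - 1" "\<And>x y. x \<in> R \<Longrightarrow> y \<in> R \<Longrightarrow> \<exists>z\<in>R. x * x + y * y = z * z"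
    by (rule euclidean_hull[OF P1 P2 P3 P4 P5], assumption+) (rule that, assumption+)
  interpret R: subfield_of R by fact
  have "\<forall>x\<in>R. x * x \<noteq> - 1" using R(6) by blast
  note aniso = R.anisotropic[OF this]
  define r :: "'a rel" where "r = {(x, y). \<exists>z\<in>R. to_ac (y - x) = z * z}"
  have rI: "(x, y) \<in> r \<longleftrightarrow> (\<exists>z\<in>R. to_ac (y - x) = z * z)" for x y by (simp add: r_def)
  have "linear_order r"
    unfolding linear_order_on_def partial_order_on_def preorder_on_def
  proof (intro conjI)
    show "r \<subseteq> UNIV \<times> UNIV" by simp
    show "refl_on UNIV r" by (rule refl_onI) (use R.zero in \<open>auto simp: rI intro!: bexI[of _ 0]\<close>)
    show "trans r"
    proof (rule transI)
      fix x y z assume "(x, y) \<in> r" "(y, z) \<in> r"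
      then obtain u v where uv: "u \<in> R" "to_ac (y - x) = u * u" "v \<in> R" "to_ac (z - y) = v * v" by (auto simp: rI simp del: to_ac_diff)
      have "to_ac (z - x) = to_ac (y - x) + to_ac (z - y)" by simp
      thus "(x, z) \<in> r" unfolding rI uv(2,4) using R(7)[OF uv(1,3)] by simp
    qed
    show "antisym r"
    proof (rule antisymI)
      fix x y assume "(x, y) \<in> r" "(y, x) \<in> r"
      then obtain u v where uv: "u \<in> R" "to_ac (y - x) = u * u" "v \<in> R" "to_ac (x - y) = v * v" by (auto simp: rI simp del: to_ac_diff)
      have "u * u + v * v = 0" unfolding uv(2,4)[symmetric] by simp
      hence "u = 0" using aniso uv by blast
      hence "to_ac (y - x) = 0" using uv by simp
      hence "y - x = 0" using to_ac_eq_0_iff by blast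
      thus "x = y" by simp
    qed
    show "total r"
    proof (rule total_onI)
      fix x y :: 'a
      have "to_ac (y - x) \<in> R" using R(2) by blast
      moreover have "- to_ac (y - x) = to_ac (x - y)" by simp
      ultimately show "(x, y) \<in> r \<or> (y, x) \<in> r" unfolding rI using R(5)[of "to_ac (y - x)"] by metis
    qed
  qed
  moreover have "(x + z, y + z) \<in> r" if "(x, y) \<in> r" for x y z using that by (simp add: rI)
  moreover have "(0, x * y) \<in> r" if xy: "(0, x) \<in> r" "(0, y) \<in> r" for x y
  proof -
    obtain u v where uv: "u \<in> R" "to_ac x = u * u" "v \<in> R" "to_ac y = v * v" using xy by (auto simp: rI)
    have "to_ac (x * y) = (u * v) * (u * v)" using uv by simp
    thus ?thesis using R.mult[OF uv(1,3)] by (auto simp: rI)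
  qed
  ultimately have "r \<in> field_orderings ty" by (simp add: field_orderings_def)
  moreover have "(0, a) \<notin> r"
  proof
    assume "(0, a) \<in> r"
    then obtain u where u: "u \<in> R" "to_ac a = u * u" by (auto simp: rI)
    have "- a \<in> S" using S[of 0 1] by simp
    hence "to_ac (- a) \<in> ?P" by (rule imageI)
    then obtain v where v: "v \<in> R" "to_ac (- a) = v * v" using R(4) by blast
    have "u * u + v * v = 0" unfolding u(2)[symmetric] v(2)[symmetric] by simp
    hence "u = 0" using aniso u v by blast
    hence "a = 0" using u by simp
    thus False using a[of 0] by simp
  qed
  ultimately show ?thesis by blast
qed

text \<open>
  \<open>\<nu>\<close> is a homomorphism to the group of subsets under symmetric difference, with the squares as its
  kernel.
\<close>

lemma square_class_card:
  fixes \<nu> :: "'a \<Rightarrow> 'b set"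
  assumes mult: "\<And>a b. a \<noteq> 0 \<Longrightarrow> b \<noteq> 0 \<Longrightarrow> \<nu> (a * b) = (\<nu> a - \<nu> b) \<union> (\<nu> b - \<nu> a)"
    and ker: "\<And>a. a \<noteq> 0 \<Longrightarrow> \<nu> a = {} \<longleftrightarrow> (\<exists>b. a = b * b)"
  shows "order (square_class_group ty) = card (\<nu> ` {a. a \<noteq> 0})"
proof -
  interpret F: field "ring_of_type_algebra :: 'a ring" by (rule field_from_type_algebra)
  let ?U = "units_of (ring_of_type_algebra :: 'a ring)" and ?S = "{x ^ 2 | x :: 'a. x \<noteq> 0}"
  have U: "carrier ?U = {a. a \<noteq> 0}" using F.field_Units by (auto simp: units_of_def)
  have m: "monoid.mult ?U = (*)" by (simp add: units_of_def)
  have cos: "?S #>\<^bsub>?U\<^esub> a = {x ^ 2 * a | x. x \<noteq> 0}" for a by (auto simp: r_coset_def m)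
  have eq: "?S #>\<^bsub>?U\<^esub> a = ?S #>\<^bsub>?U\<^esub> b \<longleftrightarrow> \<nu> a = \<nu> b" if ab: "a \<noteq> 0" "b \<noteq> 0" for a b
  proof -
    have "\<nu> a = \<nu> b \<longleftrightarrow> \<nu> (a * b) = {}" using mult[OF ab] by blast
    also have "\<dots> \<longleftrightarrow> (\<exists>c. a * b = c * c)" using ker ab by simp
    also have "\<dots> \<longleftrightarrow> {x ^ 2 * a | x. x \<noteq> 0} = {x ^ 2 * b | x. x \<noteq> 0}"
    proof
      assume "\<exists>c. a * b = c * c"
      then obtain c where c: "a * b = c * c" by blast
      have c0: "c \<noteq> 0" using c ab by auto
      have 1: "x ^ 2 * a = (x * c / b) ^ 2 * b" for x using c ab by (simp add: field_simps power2_eq_square)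
      have 2: "x ^ 2 * b = (x * c / a) ^ 2 * a" for x using c ab by (simp add: field_simps power2_eq_square)
      show "{x ^ 2 * a | x. x \<noteq> 0} = {x ^ 2 * b | x. x \<noteq> 0}"
      proof (intro equalityI subsetI)
        fix z assume "z \<in> {x ^ 2 * a | x. x \<noteq> 0}"
        then obtain x where "z = x ^ 2 * a" "x \<noteq> 0" by blast
        thus "z \<in> {x ^ 2 * b | x. x \<noteq> 0}" using 1[of x] c0 ab by (intro CollectI exI[of _ "x * c / b"]) simp
      next
        fix z assume "z \<in> {x ^ 2 * b | x. x \<noteq> 0}"
        then obtain x where "z = x ^ 2 * b" "x \<noteq> 0" by blast
        thus "z \<in> {x ^ 2 * a | x. x \<noteq> 0}" using 2[of x] c0 ab by (intro CollectI exI[of _ "x * c / a"]) simp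
      qed
    next
      assume e: "{x ^ 2 * a | x. x \<noteq> 0} = {x ^ 2 * b | x. x \<noteq> 0}"
      have "1 ^ 2 * a \<in> {x ^ 2 * a | x. x \<noteq> 0}" by (rule CollectI, rule exI[of _ 1]) simp
      hence "1 ^ 2 * a \<in> {x ^ 2 * b | x. x \<noteq> 0}" unfolding e .
      then obtain x where "a = x ^ 2 * b" by auto
      hence "a * b = (x * b) * (x * b)" by (simp add: power2_eq_square)
      thus "\<exists>c. a * b = c * c" by blast
    qed
    finally show ?thesis unfolding cos by simp
  qed
  let ?A = "{a :: 'a. a \<noteq> 0}"
  have "carrier (square_class_group ty) = (\<lambda>a. ?S #>\<^bsub>?U\<^esub> a) ` ?A"
    unfolding square_class_group_def carrier_FactGroup U ..
  moreover have "card ((\<lambda>a. ?S #>\<^bsub>?U\<^esub> a) ` ?A) = card (\<nu> ` ?A)"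
  proof (rule bij_betw_same_card[of "\<lambda>C. \<nu> (SOME a. a \<in> ?A \<and> C = ?S #>\<^bsub>?U\<^esub> a)"])
    let ?h = "\<lambda>C. \<nu> (SOME a. a \<in> ?A \<and> C = ?S #>\<^bsub>?U\<^esub> a)"
    have h: "?h (?S #>\<^bsub>?U\<^esub> a) = \<nu> a" if a: "a \<in> ?A" for a
    proof -
      let ?b = "SOME b. b \<in> ?A \<and> ?S #>\<^bsub>?U\<^esub> a = ?S #>\<^bsub>?U\<^esub> b"
      have "?b \<in> ?A \<and> ?S #>\<^bsub>?U\<^esub> a = ?S #>\<^bsub>?U\<^esub> ?b" by (rule someI[of _ a]) (use a in simp)
      thus ?thesis using eq[of a ?b] a by simp
    qed
    show "bij_betw ?h ((\<lambda>a. ?S #>\<^bsub>?U\<^esub> a) ` ?A) (\<nu> ` ?A)"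
    proof (rule bij_betwI')
      fix C C' assume "C \<in> (\<lambda>a. ?S #>\<^bsub>?U\<^esub> a) ` ?A" "C' \<in> (\<lambda>a. ?S #>\<^bsub>?U\<^esub> a) ` ?A"
      then obtain a b where ab: "a \<in> ?A" "C = ?S #>\<^bsub>?U\<^esub> a" "b \<in> ?A" "C' = ?S #>\<^bsub>?U\<^esub> b" by blast
      show "(?h C = ?h C') = (C = C')" unfolding ab(2,4) h[OF ab(1)] h[OF ab(3)] using eq ab by simp
    next
      fix C assume "C \<in> (\<lambda>a. ?S #>\<^bsub>?U\<^esub> a) ` ?A"
      then obtain a where a: "a \<in> ?A" "C = ?S #>\<^bsub>?U\<^esub> a" by blast
      show "?h C \<in> \<nu> ` ?A" unfolding a(2) h[OF a(1)] using a by blast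
    next
      fix N assume "N \<in> \<nu> ` ?A"
      then obtain a where a: "a \<in> ?A" "N = \<nu> a" by blast
      show "\<exists>C\<in>(\<lambda>a. ?S #>\<^bsub>?U\<^esub> a) ` ?A. N = ?h C" unfolding a(2) h[OF a(1), symmetric] using a by blast
    qed
  qed
  ultimately show ?thesis by (simp add: order_def)
qed

text \<open>
  Since the involutions of the orderings form a basis of the Frattini quotient, each ordering is the only
  one that makes some element of \<open>F\<close> negative.  With \<open>\<nu> a\<close> the set of orderings that make \<open>a\<close> negative,
  every set of orderings is therefore of this form, and square classes can be counted by subsets.
\<close>

theorem SAP_from_zassenhaus:
  assumes fr: "is_formally_real_pythagorean ty"
    and c1: "zassenhaus_dim G P.T 1 = enat (d + 1)"
    and c2: "zassenhaus_dim G P.T 2 = enat (d * (d + 1) div 2)"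
  shows "finite (field_orderings ty) \<and> card (field_orderings ty) = d + 1 \<and>
    order (square_class_group ty) = 2 ^ (d + 1)"
proof -
  let ?O = "field_orderings ty"
  obtain s where s: "\<And>r. r \<in> ?O \<Longrightarrow> s r \<in> carrier G" "\<And>r. r \<in> ?O \<Longrightarrow> s r \<otimes>\<^bsub>G\<^esub> s r = \<one>\<^bsub>G\<^esub>"
    "\<And>r a y. r \<in> ?O \<Longrightarrow> y * y = to_ac a \<Longrightarrow> a \<noteq> 0 \<Longrightarrow> s r y = y \<longleftrightarrow> (0, a) \<in> r"
    using ordering_involution by metis
  have root: "\<exists>y :: 'a alg_closure. y * y = to_ac a" for a :: 'a by (rule ex_sqrt)
  have stab: "index_two G {g \<in> carrier G. g y = y} \<and> closedin P.T {g \<in> carrier G. g y = y}"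
    if y: "y * y = to_ac a" "a \<noteq> 0" and r: "r \<in> ?O" "(0, a) \<notin> r" for a y r
  proof -
    have yy: "y * y \<in> F0" using y by simp
    have "s r y \<noteq> y" using s(3)[OF r(1) y] r(2) by simp
    hence "y \<notin> F0" using is_autD(5)[OF G_aut[OF s(1)[OF r(1)]]] by blast
    thus ?thesis using stabilizer_index_two[OF yy] by blast
  qed
  have elem: "\<exists>a y. y * y = to_ac a \<and> a \<noteq> 0 \<and> M = {g \<in> carrier G. g y = y} \<and> (\<forall>b. a \<noteq> b * b)"
    if M: "index_two G M" "closedin P.T M" for M
  proof -
    obtain y where y: "y * y \<in> F0" "y \<notin> F0" "M = {g \<in> carrier G. g y = y}" using index_two_stabilizer[OF M] by blast
    then obtain a where a: "y * y = to_ac a" by blast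
    have "a \<noteq> b * b" for b
    proof
      assume "a = b * b"
      hence "y * y = to_ac b * to_ac b" using a by simp
      hence "y = to_ac b \<or> y = - to_ac b" by (rule square_eq_cases)
      hence "y = to_ac b \<or> y = to_ac (- b)" by simp
      thus False using y(2) by blast
    qed
    moreover from this[of 0] have "a \<noteq> 0" by simp
    ultimately show ?thesis using a y(3) by blast
  qed
  have mem: "s r \<in> {g \<in> carrier G. g y = y} \<longleftrightarrow> (0, a) \<in> r" if "r \<in> ?O" "y * y = to_ac a" "a \<noteq> 0" for r a y
    using s(1,3) that by simp
  have sep0: "\<exists>M. index_two G M \<and> closedin P.T M \<and> (s r \<in> M) \<noteq> (s r' \<in> M)" if r: "r \<in> ?O" "r' \<in> ?O" "r \<noteq> r'" for r r'
  proof -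
    obtain a where a: "(0, a) \<in> r \<longleftrightarrow> (0, a) \<notin> r'" using ordering_eqI[OF r(1,2)] r(3) by blast
    have a0: "a \<noteq> 0" using a orderingD(6)[OF r(1), of 0] orderingD(6)[OF r(2), of 0] by auto
    obtain y :: "'a alg_closure" where y: "y * y = to_ac a" using root by blast
    have "index_two G {g \<in> carrier G. g y = y} \<and> closedin P.T {g \<in> carrier G. g y = y}"
      using stab[OF y a0 r(1)] stab[OF y a0 r(2)] a by blast
    thus ?thesis using mem[OF r(1) y a0] mem[OF r(2) y a0] a by blast
  qed
  have "finite (s ` ?O) \<and> card (s ` ?O) = d + 1 \<and>
    (\<forall>x\<in>s ` ?O. \<exists>M. index_two G M \<and> closedin P.T M \<and> s ` ?O - {x} \<subseteq> M)"
  proof (rule P.involutions_basis[OF _ _ _ _ _ c1 c2])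
    show "s ` ?O \<subseteq> carrier G" using s(1) by blast
    show "x \<otimes>\<^bsub>G\<^esub> x = \<one>\<^bsub>G\<^esub>" if "x \<in> s ` ?O" for x using that s(2) by blast
    show "\<exists>x\<in>s ` ?O. x \<notin> M" if M: "index_two G M" "closedin P.T M" for M
    proof -
      obtain a y where a: "y * y = to_ac a" "a \<noteq> 0" "M = {g \<in> carrier G. g y = y}" "\<And>b. a \<noteq> b * b"
        using elem[OF M] by blast
      obtain r where r: "r \<in> ?O" "(0, a) \<notin> r" using nonsquare_negative[OF fr a(4)] by blast
      thus ?thesis using mem[OF r(1) a(1,2)] a(3) by blast
    qed
    show "\<exists>M. index_two G M \<and> closedin P.T M \<and> x \<notin> M" if x: "x \<in> s ` ?O" for x
    proof -
      obtain r where r: "r \<in> ?O" "x = s r" using x by blast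
      have n: "(0, - 1) \<notin> r" using orderingD(2,6)[OF r(1), of 1] by auto
      obtain y :: "'a alg_closure" where y: "y * y = to_ac (- 1)" using root by blast
      have "- 1 \<noteq> (0::'a)" by simp
      from stab[OF y this r(1) n] mem[OF r(1) y this] n show ?thesis unfolding r(2) by blast
    qed
    show "\<exists>M. index_two G M \<and> closedin P.T M \<and> (x \<in> M) \<noteq> (y \<in> M)"
      if xy: "x \<in> s ` ?O" "y \<in> s ` ?O" "x \<noteq> y" for x y
    proof -
      obtain r r' where r: "r \<in> ?O" "r' \<in> ?O" "x = s r" "y = s r'" using xy by blast
      show ?thesis unfolding r(3,4) by (rule sep0[OF r(1,2)]) (use xy(3) r in blast)
    qed
  qed
  hence fin: "finite (s ` ?O)" and card: "card (s ` ?O) = d + 1"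
    and single: "\<And>x. x \<in> s ` ?O \<Longrightarrow> \<exists>M. index_two G M \<and> closedin P.T M \<and> s ` ?O - {x} \<subseteq> M" by blast+
  have inj: "inj_on s ?O"
  proof (rule inj_onI, rule ccontr)
    fix r r' assume r: "r \<in> ?O" "r' \<in> ?O" "s r = s r'" "r \<noteq> r'"
    show False using sep0[OF r(1,2,4)] r(3) by simp
  qed
  have finO: "finite ?O" using fin finite_imageD inj by blast
  have cardO: "card ?O = d + 1" using card card_image[OF inj] by simp
  define \<nu> where "\<nu> a = {r \<in> ?O. (0, a) \<notin> r}" for a :: 'a
  have mult: "\<nu> (a * b) = (\<nu> a - \<nu> b) \<union> (\<nu> b - \<nu> a)" if ab: "a \<noteq> 0" "b \<noteq> 0" for a b
  proof -
    have "(0, a * b) \<in> r \<longleftrightarrow> ((0, a) \<in> r \<longleftrightarrow> (0, b) \<in> r)" if r: "r \<in> ?O" for r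
    proof -
      note M = orderingD(4)[OF r] and N = neg_mem_ordering[OF r]
      have ab0: "a * b \<noteq> 0" using ab by simp
      show ?thesis using M[of a b] M[of a "- b"] M[of "- a" b] M[of "- a" "- b"] N[OF ab(1)] N[OF ab(2)] N[OF ab0] by auto
    qed
    thus ?thesis unfolding \<nu>_def by blast
  qed
  have ker: "\<nu> a = {} \<longleftrightarrow> (\<exists>b. a = b * b)" for a
  proof
    assume "\<nu> a = {}"
    thus "\<exists>b. a = b * b" using nonsquare_negative[OF fr, of a] unfolding \<nu>_def by blast
  next
    assume "\<exists>b. a = b * b"
    thus "\<nu> a = {}" unfolding \<nu>_def using orderingD(6) by blast
  qed
  have sing: "\<exists>a. a \<noteq> 0 \<and> \<nu> a = {r}" if r: "r \<in> ?O" for r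
  proof -
    obtain M where M: "index_two G M" "closedin P.T M" "s ` ?O - {s r} \<subseteq> M" using single[of "s r"] r by blast
    obtain a y where a: "y * y = to_ac a" "a \<noteq> 0" "M = {g \<in> carrier G. g y = y}" "\<And>b. a \<noteq> b * b"
      using elem[OF M(1,2)] by blast
    have "(0, a) \<in> r'" if r': "r' \<in> ?O" "r' \<noteq> r" for r'
    proof -
      have "s r' \<noteq> s r" using inj_onD[OF inj] r r' by blast
      hence "s r' \<in> M" using M(3) r' by blast
      thus ?thesis using mem[OF r'(1) a(1,2)] a(3) by blast
    qed
    moreover have "\<nu> a \<noteq> {}" using ker a(4) by blast
    ultimately have "\<nu> a = {r}" unfolding \<nu>_def by blast
    thus ?thesis using a(2) by blast
  qed
  have all: "\<exists>a. a \<noteq> 0 \<and> \<nu> a = S" if "S \<subseteq> ?O" for S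
  proof -
    have "finite S" using that finO finite_subset by blast
    thus ?thesis using that
    proof (induction S rule: finite_induct)
      case empty
      have "\<nu> 1 = {}" using ker[of 1] by (metis mult_1)
      thus ?case by (intro exI[of _ 1]) simp
    next
      case (insert r S)
      have "S \<subseteq> ?O" using insert.prems by simp
      from insert.IH[OF this] obtain a where a: "a \<noteq> 0" "\<nu> a = S" by blast
      have "r \<in> ?O" using insert.prems by simp
      from sing[OF this] obtain b where b: "b \<noteq> 0" "\<nu> b = {r}" by blast
      have "\<nu> (a * b) = insert r S" using mult[OF a(1) b(1)] a(2) b(2) insert.hyps by auto
      thus ?case using a b by (intro exI[of _ "a * b"]) simp
    qed
  qed
  have "\<nu> ` {a. a \<noteq> 0} = Pow ?O"
  proof (intro equalityI subsetI)
    show "S \<in> Pow ?O" if "S \<in> \<nu> ` {a. a \<noteq> 0}" for S using that by (auto simp: \<nu>_def)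
    show "S \<in> \<nu> ` {a. a \<noteq> 0}" if "S \<in> Pow ?O" for S using all[of S] that by blast
  qed
  hence "order (square_class_group ty) = card (Pow ?O)"
    using square_class_card[of \<nu>, OF mult ker] by simp
  thus ?thesis using finO cardO by (simp add: card_Pow)
qed

end

theorem mainTheorem5:
  fixes F :: "'a::field itself" and d :: nat
  assumes "is_formally_real_pythagorean F"
    and "finite (carrier (square_class_group F))"
    and "zassenhaus_dim (galois_group_2 F) (galois_group_2_topology F) 1 = enat (d + 1)"
    and "zassenhaus_dim (galois_group_2 F) (galois_group_2_topology F) 2 = enat (d * (d + 1) div 2)"
  shows "is_SAP F \<and> card (field_orderings F) = d + 1"
proof -
  have "(2 :: 'a) \<noteq> 0"
  proof
    assume "(2 :: 'a) = 0"
    hence "1 + 1 = (0 :: 'a)" by (simp only: one_add_one)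
    hence "- 1 = (1 :: 'a)" by (rule minus_unique)
    hence "- 1 = (1 :: 'a) ^ 2" by simp
    thus False using assms(1) unfolding is_formally_real_pythagorean_def by blast
  qed
  then interpret char_not_2 F by unfold_locales
  have "finite (field_orderings F) \<and> card (field_orderings F) = d + 1 \<and>
    order (square_class_group F) = 2 ^ (d + 1)"
    by (rule SAP_from_zassenhaus[OF assms(1)])
       (use assms(3,4) in \<open>simp_all add: galois_group_2_def galois_group_2_topology_def krull_eq\<close>)
  thus ?thesis unfolding is_SAP_def using assms(1) by blast
qed

end
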